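(* Let $\Xi=\langle k_1,\ldots,k_s\,|\,l_1,\ldots,l_t\rangle$ be a simple type and let $v(\Xi)=s+t$. Then $$|\Xi|=\sum (-1)^{n-1}\,(v(\Xi)-1)^{n-2}\prod_{p=1}^{n}(v(\Xi_p)-1)!,$$ where the sum runs over all partitions $\Xi=\Xi_1\cup\cdots\cup\Xi_n$, $n=1,2,\ldots$, of $\Xi$ (including the trivial $1$-partition $\Xi$ itself, whose summand equals $(v(\Xi)-2)!$).
   Context: A w-tree is a finite connected plane tree in which every vertex and every edge carries a positive integer weight, such that the weight of each vertex equals the sum of the weights of the edges incident to it; its vertices are properly 2-colored white and black. The type $\langle k_1,\ldots,k_s\,|\,l_1,\ldots,l_t\rangle$ (positive integers with $\sum k_i=\sum l_j$) is the set of w-trees with $s$ white vertices of weights $k_1,\ldots,k_s$ and $t$ black vertices of weights $l_1,\ldots,l_t$, up to orientation-preserving isotopy of the plane preserving colors and weights; $|\Xi|$ is the number of such trees and $v(\Xi)=s+t$ is the number of vertices. The type is simple if the $k_i$ are pairwise distinct and the $l_j$ are pairwise distinct. An $n$-partition of $\Xi$ is an (unordered) collection of pairwise disjoint nonempty sets $I_1,\ldots,I_n$ with union $\{1,\ldots,s\}$ together with pairwise disjoint nonempty sets $J_1,\ldots,J_n$ with union $\{1,\ldots,t\}$ such that $\sum_{i\in I_p}k_i=\sum_{j\in J_p}l_j$ for each $p=1,\ldots,n$; the subtypes are $\Xi_p=\langle \{k_i\}_{i\in I_p}\,|\,\{l_j\}_{j\in J_p}\rangle$ with $v(\Xi_p)=|I_p|+|J_p|$,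 and one writes $\Xi=\Xi_1\cup\cdots\cup\Xi_n$. The type itself counts as its $1$-partition. *)

theory Defs
  imports Complex_Main "HOL-Library.Multiset" "HOL-Library.Disjoint_Sets"
    "HOL-Combinatorics.Orbits"
begin

text \<open>
  A plane tree is encoded by its rotation system: an abstract tree together with, for every
  vertex \<open>v\<close>, the map \<open>rot v\<close> sending an edge at \<open>v\<close> to the next edge at \<open>v\<close> in
  counterclockwise order. Two embeddings of a tree in the oriented plane are related by an
  orientation-preserving isotopy of the plane iff their rotation systems are isomorphic,
  so isotopy classes are isomorphism classes of such structures.
\<close>

record 'a w_tree =
  whites :: "'a set"
  blacks :: "'a set"
  edges :: "'a set set"
  rot :: "'a \<Rightarrow> 'a set \<Rightarrow> 'a set"
  vweight :: "'a \<Rightarrow> nat"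
  eweight :: "'a set \<Rightarrow> nat"

definition verts :: "'a w_tree \<Rightarrow> 'a set" where
  "verts T = whites T \<union> blacks T"

definition incident :: "'a w_tree \<Rightarrow> 'a \<Rightarrow> 'a set set" where
  "incident T v = {e \<in> edges T. v \<in> e}"

definition graph_connected :: "'a set \<Rightarrow> 'a set set \<Rightarrow> bool" where
  "graph_connected V E \<longleftrightarrow>
     V \<noteq> {} \<and> (\<forall>u\<in>V. \<forall>v\<in>V. (u, v) \<in> {(x, y). {x, y} \<in> E}\<^sup>*)"

definition graph_cycle :: "'a set set \<Rightarrow> 'a list \<Rightarrow> bool" where
  "graph_cycle E c \<longleftrightarrow>
     3 \<le> length c \<and> distinct c \<and>
     (\<forall>i<length c. {c ! i, c ! (Suc i mod length c)} \<in> E)"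

definition graph_tree :: "'a set \<Rightarrow> 'a set set \<Rightarrow> bool" where
  "graph_tree V E \<longleftrightarrow>
     finite V \<and> (\<forall>e\<in>E. e \<subseteq> V \<and> card e = 2) \<and>
     graph_connected V E \<and> (\<nexists>c. graph_cycle E c)"

definition properly_colored :: "'a w_tree \<Rightarrow> bool" where
  "properly_colored T \<longleftrightarrow>
     whites T \<inter> blacks T = {} \<and>
     (\<forall>e\<in>edges T. \<exists>u\<in>whites T. \<exists>v\<in>blacks T. e = {u, v})"

definition is_w_tree :: "'a w_tree \<Rightarrow> bool" where
  "is_w_tree T \<longleftrightarrow>
     graph_tree (verts T) (edges T) \<and>
     properly_colored T \<and>
     (\<forall>v\<in>verts T. cyclic_on (rot T v) (incident T v)) \<and>
     (\<forall>v\<in>verts T. 0 < vweight T v) \<and>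
     (\<forall>e\<in>edges T. 0 < eweight T e) \<and>
     (\<forall>v\<in>verts T. vweight T v = (\<Sum>e\<in>incident T v. eweight T e))"

definition w_tree_iso :: "'a w_tree \<Rightarrow> 'b w_tree \<Rightarrow> bool" where
  "w_tree_iso S T \<longleftrightarrow>
     (\<exists>f. bij_betw f (verts S) (verts T) \<and>
          f ` whites S = whites T \<and>
          f ` blacks S = blacks T \<and>
          (\<lambda>e. f ` e) ` edges S = edges T \<and>
          (\<forall>v\<in>verts S. \<forall>e\<in>incident S v. rot T (f v) (f ` e) = f ` rot S v e) \<and>
          (\<forall>v\<in>verts S. vweight T (f v) = vweight S v) \<and>
          (\<forall>e\<in>edges S. eweight T (f ` e) = eweight S e))"

definition is_type :: "nat list \<Rightarrow> nat list \<Rightarrow> bool" where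
  "is_type k l \<longleftrightarrow>
     k \<noteq> [] \<and> l \<noteq> [] \<and> (\<forall>x\<in>set k. 0 < x) \<and> (\<forall>y\<in>set l. 0 < y) \<and>
     sum_list k = sum_list l"

definition simple_type :: "nat list \<Rightarrow> nat list \<Rightarrow> bool" where
  "simple_type k l \<longleftrightarrow> is_type k l \<and> distinct k \<and> distinct l"

text \<open>
  Every finite tree is isomorphic to one whose vertices are natural numbers, so it suffices to
  classify those.
\<close>

definition w_trees_of_type :: "nat list \<Rightarrow> nat list \<Rightarrow> nat w_tree set" where
  "w_trees_of_type k l =
     {T. is_w_tree T \<and>
         image_mset (vweight T) (mset_set (whites T)) = mset k \<and>
         image_mset (vweight T) (mset_set (blacks T)) = mset l}"

definition type_classes :: "nat list \<Rightarrow> nat list \<Rightarrow> nat w_tree set set" where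
  "type_classes k l =
     w_trees_of_type k l //
       {(S, T). S \<in> w_trees_of_type k l \<and> T \<in> w_trees_of_type k l \<and> w_tree_iso S T}"

definition num_w_trees :: "nat list \<Rightarrow> nat list \<Rightarrow> nat" where
  "num_w_trees k l = card (type_classes k l)"

text \<open>
  An \<open>n\<close>-partition is a set of \<open>n\<close> pairs \<open>(I, J)\<close> of sets of (0-based) indices. Injectivity of the
  projections makes the \<open>n\<close> sets \<open>I\<close> pairwise disjoint as a family, and likewise the sets \<open>J\<close>.
\<close>

definition type_partitions :: "nat list \<Rightarrow> nat list \<Rightarrow> (nat set \<times> nat set) set set" where
  "type_partitions k l =
     {P. partition_on {..<length k} (fst ` P) \<and> inj_on fst P \<and>
         partition_on {..<length l} (snd ` P) \<and> inj_on snd P \<and>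
         (\<forall>(I, J)\<in>P. (\<Sum>i\<in>I. k ! i) = (\<Sum>j\<in>J. l ! j))}"

definition num_verts :: "nat list \<Rightarrow> nat list \<Rightarrow> nat" where
  "num_verts k l = length k + length l"

definition partition_term :: "nat list \<Rightarrow> nat list \<Rightarrow> (nat set \<times> nat set) set \<Rightarrow> real" where
  "partition_term k l P =
     (-1) ^ (card P - 1) *
     real (num_verts k l - 1) powi (int (card P) - 2) *
     (\<Prod>(I, J)\<in>P. fact (card I + card J - 1))"

end

theory Submission
  imports Defs "HOL-Combinatorics.Multiset_Permutations"
begin

text \<open>
  Give white vertices weight \<open>k\<^sub>i\<close> and black ones \<open>-l\<^sub>j\<close>, so that the type is a set \<open>V\<close> with a signed weight
  function of total \<open>0\<close>; since all labels differ, a w-tree of the type is a spanning tree on \<open>V\<close> with a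
  positive flow (which is then unique) together with a cyclic order at each vertex.

  Cutting an edge of a tree leaves two planted trees. Let \<open>b(S)\<close> count the edge-rooted trees on a balanced
  set \<open>S\<close>, so that \<open>b(V) = (v - 1) |\<Xi>|\<close>. Laying a planted tree out as a word (preorder for white roots,
  postorder for black ones) and attaching to every vertex a balanced word with nonnegative prefix sums
  (a Dyck word), one gets the words of positive weight that consist of a white letter and a word with
  nonpositive suffix sums, or the mirror image of this.
  In the ring of set functions under subset convolution this reads
  \<open>D = 1 + (\<Sum>S. b(S) x\<^sub>S D\<^bsup>|S|\<^esup>)\<close>, with \<open>D\<close> the generating function of Dyck words. By the cycle lemma
  \<open>D = exp C\<close> where \<open>C(S) = (|S| - 1)!\<close> for balanced \<open>S\<close>, and Lagrange inversion
  \<open>(v - 1) b(V) = - [x\<^sub>V] D\<^bsup>1 - v\<^esup> = - [x\<^sub>V] exp (-(v - 1) C)\<close> is the asserted sum over partitions.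
\<close>

section \<open>Set functions under subset convolution\<close>

text \<open>Neither the layout of a tree as a word nor its inverse is ever constructed. Planted
  trees with Dyck words attached and the words themselves solve one recursion, which swaps the
  colours by passing from \<open>x\<close> to \<open>- x\<close> and computes each coefficient from
  smaller sets; hence they agree. What makes the recursion local is conservation of flow: the weight
  on an edge is, up to sign, the total of \<open>x\<close> on the side away from the root, so a
  positive flow exists iff the branches cut off have totals of the right sign. The exponent |S| in
  the equation for D arises because every vertex receives a Dyck word of its own; these words are
  balanced, so no sign condition is disturbed. Rooting at an edge turns a balanced tree into a
  product of a white and a black planted tree, the same shape as a Dyck word cut in two. It costs
  one factor v - 1, the inversion costs another, and together they lower the exponent n produced by
  exp to n - 2. Below a finite set only finitely many coefficients matter, so exp, the inverse of D
  and the substitution are finite sums and no convergence arises.\<close>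

typedef 'a sfun = "{f :: 'a set \<Rightarrow> real. \<forall>S. infinite S \<longrightarrow> f S = 0}"
  morphisms coef Abs_sfun
  by (rule exI[of _ "\<lambda>_. 0"]) simp

text \<open>Infinite sets get the value 0 because convolution sums over all subsets; elements are
  then equal as soon as they agree on finite sets.\<close>

definition sfun :: "('a set \<Rightarrow> real) \<Rightarrow> 'a sfun" where
  "sfun f = Abs_sfun (\<lambda>S. if finite S then f S else 0)"

lemma coef_sfun [simp]: "coef (sfun f) S = (if finite S then f S else 0)"
  by (simp add: sfun_def Abs_sfun_inverse)

lemma coef_infinite [simp]: "infinite S \<Longrightarrow> coef f S = 0"
  using coef[of f] by simp

lemma sfun_eqI: "(\<And>S. finite S \<Longrightarrow> coef f S = coef g S) \<Longrightarrow> f = g"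
  by (metis coef_infinite coef_inject ext)

instantiation sfun :: (type) comm_ring_1
begin

definition zero_sfun :: "'a sfun" where "0 = sfun (\<lambda>_. 0)"
definition one_sfun :: "'a sfun" where "1 = sfun (\<lambda>S. if S = {} then 1 else 0)"
definition plus_sfun :: "'a sfun \<Rightarrow> 'a sfun \<Rightarrow> 'a sfun" where
  "f + g = sfun (\<lambda>S. coef f S + coef g S)"
definition minus_sfun :: "'a sfun \<Rightarrow> 'a sfun \<Rightarrow> 'a sfun" where
  "f - g = sfun (\<lambda>S. coef f S - coef g S)"
definition uminus_sfun :: "'a sfun \<Rightarrow> 'a sfun" where
  "- f = sfun (\<lambda>S. - coef f S)"
definition times_sfun :: "'a sfun \<Rightarrow> 'a sfun \<Rightarrow> 'a sfun" where
  "f * g = sfun (\<lambda>S. \<Sum>A\<in>Pow S. coef f A * coef g (S - A))"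

instance
proof
  fix f g h :: "'a sfun"
  have assoc: "(\<Sum>T\<in>Pow S. (\<Sum>A\<in>Pow T. coef f A * coef g (T - A)) * coef h (S - T)) =
      (\<Sum>A\<in>Pow S. coef f A * (\<Sum>B\<in>Pow (S - A). coef g B * coef h (S - A - B)))"
    if S: "finite S" for S
  proof -
    have fin: "T \<subseteq> S \<Longrightarrow> finite (Pow T)" for T using S finite_subset by auto
    have "(\<Sum>T\<in>Pow S. (\<Sum>A\<in>Pow T. coef f A * coef g (T - A)) * coef h (S - T)) =
      (\<Sum>(T, A)\<in>Sigma (Pow S) Pow. coef f A * coef g (T - A) * coef h (S - T))"
      using S fin by (subst sum.Sigma[symmetric]) (auto simp: sum_distrib_right)
    \<comment> \<open>Both sums run over ordered splittings of S into three parts, coded by nested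
      sets before and by disjoint sets after.\<close>
    also have "\<dots> = (\<Sum>(A, B)\<in>Sigma (Pow S) (\<lambda>A. Pow (S - A)). coef f A * coef g B * coef h (S - A - B))"
      by (rule sum.reindex_bij_witness[of _ "\<lambda>(A, B). (A \<union> B, A)" "\<lambda>(T, A). (A, T - A)"])
        (auto intro!: arg_cong[of _ _ "coef h"] arg_cong[of _ _ "coef g"])
    also have "\<dots> = (\<Sum>A\<in>Pow S. coef f A * (\<Sum>B\<in>Pow (S - A). coef g B * coef h (S - A - B)))"
      using S fin by (subst sum.Sigma[symmetric]) (auto simp: sum_distrib_left mult.assoc)
    finally show ?thesis .
  qed
  show "f * g * h = f * (g * h)"
    by (rule sfun_eqI) (simp add: times_sfun_def assoc finite_subset)
  show "f * g = g * f"
  proof (rule sfun_eqI)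
    fix S :: "'a set" assume S: "finite S"
    have "(\<Sum>A\<in>Pow S. coef f A * coef g (S - A)) = (\<Sum>A\<in>Pow S. coef g A * coef f (S - A))"
      by (rule sum.reindex_bij_witness[of _ "\<lambda>A. S - A" "\<lambda>A. S - A"]) (auto simp: double_diff)
    then show "coef (f * g) S = coef (g * f) S" using S by (simp add: times_sfun_def)
  qed
  show "1 * f = f"
  proof (rule sfun_eqI)
    fix S :: "'a set" assume S: "finite S"
    have "coef (1 * f) S = (\<Sum>A\<in>Pow S. coef 1 A * coef f (S - A))"
      using S by (simp add: times_sfun_def)
    also have "\<dots> = (\<Sum>A\<in>Pow S. if A = {} then coef f S else 0)"
      using S by (intro sum.cong) (auto simp: one_sfun_def dest: finite_subset)
    also have "\<dots> = coef f S" using S by simp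
    finally show "coef (1 * f) S = coef f S" .
  qed
  show "(f + g) * h = f * h + g * h"
    by (rule sfun_eqI)
      (auto simp: times_sfun_def plus_sfun_def algebra_simps sum.distrib[symmetric] finite_subset
        intro!: sum.cong)
  have "coef (0::'a sfun) {} \<noteq> coef 1 {}" by (simp add: zero_sfun_def one_sfun_def)
  then show "(0::'a sfun) \<noteq> 1" by metis
qed (auto intro!: sfun_eqI simp: zero_sfun_def plus_sfun_def minus_sfun_def uminus_sfun_def)

end

lemma coef_zero [simp]: "coef 0 S = 0"
  and coef_one [simp]: "coef 1 S = (if S = {} then 1 else 0)"
  and coef_add [simp]: "coef (f + g) S = coef f S + coef g S"
  and coef_diff [simp]: "coef (f - g) S = coef f S - coef g S"
  and coef_uminus [simp]: "coef (- f) S = - coef f S"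
  by (cases "finite S";
      auto simp: zero_sfun_def one_sfun_def plus_sfun_def minus_sfun_def uminus_sfun_def)+

lemma coef_mult: "coef (f * g) S = (\<Sum>A\<in>Pow S. coef f A * coef g (S - A))"
  by (cases "finite S") (auto simp: times_sfun_def)

lemma coef_mult_empty [simp]: "coef (f * g) {} = coef f {} * coef g {}"
  by (simp add: coef_mult)

lemma coef_sum [simp]: "coef (sum f I) S = (\<Sum>i\<in>I. coef (f i) S)"
  by (induction I rule: infinite_finite_induct) auto

lemma coef_of_nat_mult [simp]: "coef (of_nat n * f) S = real n * coef f S"
  by (induction n) (auto simp: algebra_simps)

section \<open>Monomials, derivations and the exponential\<close>

definition scal :: "real \<Rightarrow> 'a sfun" where
  "scal c = sfun (\<lambda>S. if S = {} then c else 0)"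

text \<open>The monomial x_A in a ring where every letter squares to zero.\<close>

definition mono_at :: "'a set \<Rightarrow> 'a sfun" where
  "mono_at A = sfun (\<lambda>S. if S = A then 1 else 0)"

lemma coef_mono_at_mult:
  assumes "finite S"
  shows "coef (mono_at A * f) S = (if A \<subseteq> S then coef f (S - A) else 0)"
proof -
  have "coef (mono_at A * f) S = (\<Sum>B\<in>Pow S. if B = A then coef f (S - A) else 0)"
    unfolding coef_mult using assms
    by (intro sum.cong) (auto simp: mono_at_def dest: finite_subset)
  then show ?thesis using assms by simp
qed

lemma coef_scal_mult [simp]: "coef (scal c * f) S = c * coef f S"
proof (cases "finite S")
  case True
  have "coef (scal c * f) S = (\<Sum>B\<in>Pow S. if B = {} then c * coef f S else 0)"
    unfolding coef_mult using True
    by (intro sum.cong) (auto simp: scal_def dest: finite_subset)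
  then show ?thesis using True by simp
qed simp

lemma scal_add: "scal (c + d) = scal c + scal d"
  by (rule sfun_eqI) (auto simp: scal_def)

lemma scal_0 [simp]: "scal 0 = 0"
  by (rule sfun_eqI) (auto simp: scal_def)

lemma mono_at_mult:
  assumes "finite A" "finite B"
  shows "mono_at A * mono_at B = (if A \<inter> B = {} then mono_at (A \<union> B) else 0)"
proof (rule sfun_eqI)
  fix S :: "'a set" assume S: "finite S"
  have "A \<subseteq> S \<Longrightarrow> S - A = B \<longleftrightarrow> A \<inter> B = {} \<and> S = A \<union> B" by auto
  then show "coef (mono_at A * mono_at B) S = coef (if A \<inter> B = {} then mono_at (A \<union> B) else 0) S"
    unfolding coef_mono_at_mult[OF S] using S by (auto simp: mono_at_def)
qed

text \<open>A derivation that is diagonal on monomials. Weight 1 on all letters gives the Euler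
  operator, which counts letters; a point mass at \<open>a\<close> gives x_a d/dx_a, which keeps the
  sets containing \<open>a\<close>.\<close>

definition deriv_wrt :: "('a \<Rightarrow> real) \<Rightarrow> 'a sfun \<Rightarrow> 'a sfun" where
  "deriv_wrt w f = sfun (\<lambda>S. sum w S * coef f S)"

lemma coef_deriv [simp]: "coef (deriv_wrt w f) S = sum w S * coef f S"
  by (simp add: deriv_wrt_def)

lemma deriv_mult: "deriv_wrt w (f * g) = deriv_wrt w f * g + f * deriv_wrt w g"
proof (rule sfun_eqI)
  fix S :: "'a set" assume S: "finite S"
  have "sum w S * (coef f A * coef g (S - A)) =
      sum w A * coef f A * coef g (S - A) + coef f A * (sum w (S - A) * coef g (S - A))"
    if "A \<subseteq> S" for A
    using sum.subset_diff[OF that S, of w] by (simp add: algebra_simps)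
  then show "coef (deriv_wrt w (f * g)) S = coef (deriv_wrt w f * g + f * deriv_wrt w g) S"
    by (auto simp: coef_mult sum_distrib_left sum.distrib[symmetric] intro!: sum.cong)
qed

lemma deriv_one [simp]: "deriv_wrt w 1 = 0"
  by (rule sfun_eqI) auto

lemma deriv_power: "deriv_wrt w (f ^ Suc n) = of_nat (Suc n) * f ^ n * deriv_wrt w f"
proof (induction n)
  case (Suc n)
  have "deriv_wrt w (f ^ Suc (Suc n)) = deriv_wrt w f * f ^ Suc n + f * deriv_wrt w (f ^ Suc n)"
    by (simp only: power_Suc[of f "Suc n"] deriv_mult)
  then show ?case unfolding Suc.IH by (simp add: algebra_simps)
qed simp

text \<open>exp(c C) by the exponential formula. Set partitions instead of a power series give the
  shape of the final sum at once; the laws of exp follow from the differential equation.\<close>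

definition exp_coeffs :: "'a sfun \<Rightarrow> real \<Rightarrow> 'a sfun" where
  "exp_coeffs C c = sfun (\<lambda>S. \<Sum>P | partition_on S P. c ^ card P * (\<Prod>p\<in>P. coef C p))"

abbreviation "point_deriv a \<equiv> deriv_wrt (\<lambda>x. if x = a then 1 else 0)"

lemma sum_indicator_point: "finite S \<Longrightarrow> sum (\<lambda>x. if x = a then 1 else 0) S = (if a \<in> S then 1 else (0::real))"
  by simp

lemma coef_point_deriv_mult:
  assumes "finite S" "a \<in> S"
  shows "coef (scal c * point_deriv a C * f) S =
    (\<Sum>A | A \<subseteq> S \<and> a \<in> A. c * coef C A * coef f (S - A))"
proof -
  have "coef (scal c * point_deriv a C * f) S =
      (\<Sum>A\<in>Pow S. c * (sum (\<lambda>x. if x = a then 1 else 0) A * coef C A) * coef f (S - A))"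
    unfolding coef_mult[of "scal c * point_deriv a C"] by simp
  also have "\<dots> = (\<Sum>A | A \<subseteq> S \<and> a \<in> A. c * coef C A * coef f (S - A))"
    using assms by (intro sum.mono_neutral_cong_right)
      (auto simp: sum_indicator_point finite_subset split: if_splits)
  finally show ?thesis .
qed

text \<open>In a partition of S exactly one block contains \<open>a\<close>; taking it out leaves a
  partition of the rest and contributes the factor c C(A).\<close>

lemma exp_coeffs_point_deriv:
  "point_deriv a (exp_coeffs C c) = scal c * point_deriv a C * exp_coeffs C c"
proof (rule sfun_eqI)
  fix S :: "'a set" assume S: "finite S"
  show "coef (point_deriv a (exp_coeffs C c)) S = coef (scal c * point_deriv a C * exp_coeffs C c) S"
  proof (cases "a \<in> S")
    case False
    then have "coef (scal c * point_deriv a C * exp_coeffs C c) S = 0"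
      unfolding coef_mult[of "scal c * point_deriv a C"]
      by (intro sum.neutral) (use S in \<open>auto simp: sum_indicator_point finite_subset\<close>)
    then show ?thesis using S False by (simp add: sum_indicator_point)
  next
    case True
    let ?t = "\<lambda>P. c ^ card P * (\<Prod>p\<in>P. coef C p)"
    have "coef (point_deriv a (exp_coeffs C c)) S = sum ?t {P. partition_on S P}"
      using S True by (simp add: sum_indicator_point exp_coeffs_def)
    also have "\<dots> = (\<Sum>(A, Q)\<in>Sigma {A. A \<subseteq> S \<and> a \<in> A} (\<lambda>A. {Q. partition_on (S - A) Q}).
        c * coef C A * ?t Q)"
    proof (rule sum.reindex_bij_witness[of _ "\<lambda>(A, Q). insert A Q" 
          "\<lambda>P. (THE A. A \<in> P \<and> a \<in> A, P - {THE A. A \<in> P \<and> a \<in> A})"])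
      fix P assume P: "P \<in> {P. partition_on S P}"
      then obtain A where A: "A \<in> P" "a \<in> A" using True unfolding partition_on_def by auto
      have the: "(THE A. A \<in> P \<and> a \<in> A) = A"
        using P A by (intro the_equality) (auto simp: partition_on_def disjoint_def)
      show "(case (THE A. A \<in> P \<and> a \<in> A, P - {THE A. A \<in> P \<and> a \<in> A}) of (A, Q) \<Rightarrow> insert A Q) = P"
        using A the by auto
      have "partition_on S (insert A (P - {A}))" using P A by (simp add: insert_absorb)
      moreover have "disjnt A (\<Union>(P - {A}))" 
        using P A by (auto simp: partition_on_def disjoint_def disjnt_def)
      ultimately have "partition_on (S - A) (P - {A})" "A \<subseteq> S"
        by (simp_all only: partition_on_insert)
      then show "(THE A. A \<in> P \<and> a \<in> A, P - {THE A. A \<in> P \<and> a \<in> A}) \<in>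
          Sigma {A. A \<subseteq> S \<and> a \<in> A} (\<lambda>A. {Q. partition_on (S - A) Q})"
        using A the by auto
      have "finite P" using P S by (auto intro: finite_elements)
      then have "?t P = c * coef C A * ?t (P - {A})"
        using A(1) by (simp only: prod.remove[of P A] card.remove[of P A] power_Suc mult_ac)
      then show "(case (THE A. A \<in> P \<and> a \<in> A, P - {THE A. A \<in> P \<and> a \<in> A}) of
          (A, Q) \<Rightarrow> c * coef C A * ?t Q) = ?t P"
        using the by simp
    next
      fix z assume z: "z \<in> Sigma {A. A \<subseteq> S \<and> a \<in> A} (\<lambda>A. {Q. partition_on (S - A) Q})"
      then obtain A Q where zz: "z = (A, Q)" "A \<subseteq> S" "a \<in> A" "partition_on (S - A) Q" by auto
      have d: "disjnt A (\<Union>Q)" using zz partition_onD1[of "S - A" Q] by (auto simp: disjnt_def)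
      then have P: "partition_on S (insert A Q)" using zz by (auto simp: partition_on_insert)
      have "B = A" if "B \<in> insert A Q" "a \<in> B" for B
        using that d zz by (auto simp: disjnt_def)
      then have the: "(THE B. B \<in> insert A Q \<and> a \<in> B) = A" using zz by (intro the_equality) auto
      have "A \<notin> Q" using d zz by (auto simp: disjnt_def)
      then show "(THE B. B \<in> (case z of (A, Q) \<Rightarrow> insert A Q) \<and> a \<in> B,
          (case z of (A, Q) \<Rightarrow> insert A Q) - {THE B. B \<in> (case z of (A, Q) \<Rightarrow> insert A Q) \<and> a \<in> B}) = z"
        using zz the by simp
      show "(case z of (A, Q) \<Rightarrow> insert A Q) \<in> {P. partition_on S P}" using P zz by simp
    qed
    also have "\<dots> = (\<Sum>A | A \<subseteq> S \<and> a \<in> A. c * coef C A * coef (exp_coeffs C c) (S - A))"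
      using S by (subst sum.Sigma[symmetric])
        (auto simp: finitely_many_partition_on exp_coeffs_def sum_distrib_left finite_subset)
    finally show ?thesis using coef_point_deriv_mult[OF S True] by metis
  qed
qed

lemma coef_exp_coeffs_empty [simp]:
  fixes C :: "'a sfun"
  shows "coef (exp_coeffs C c) {} = 1"
proof -
  have "{P. partition_on ({} :: 'a set) P} = {{}}" by (auto simp: partition_on_empty)
  then show ?thesis by (simp add: exp_coeffs_def)
qed

text \<open>For \<open>a\<close> in S, the equation for \<open>point_deriv a\<close> at S expresses
  the coefficient of \<open>f\<close> at S by those at S - A with \<open>a\<close> in A, which are
  all smaller sets.\<close>

lemma exp_coeffs_unique:
  assumes eq: "\<And>a. point_deriv a f = scal c * point_deriv a C * f"
    and f0: "coef f {} = 1"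
  shows "f = exp_coeffs C c"
proof (rule sfun_eqI)
  fix S :: "'a set" assume "finite S"
  then show "coef f S = coef (exp_coeffs C c) S"
  proof (induction S rule: finite_psubset_induct)
    case (psubset S)
    show ?case
    proof (cases "S = {}")
      case False
      then obtain a where a: "a \<in> S" by blast
      have "coef g S = (\<Sum>A | A \<subseteq> S \<and> a \<in> A. c * coef C A * coef g (S - A))"
        if "point_deriv a g = scal c * point_deriv a C * g" for g
        using coef_point_deriv_mult[OF psubset.hyps a, of c C g] psubset.hyps a
        unfolding that[symmetric] by (simp add: sum_indicator_point)
      moreover have "coef f (S - A) = coef (exp_coeffs C c) (S - A)" if "A \<subseteq> S" "a \<in> A" for A
        using that a by (intro psubset.IH) auto
      ultimately show ?thesis
        using eq[of a] exp_coeffs_point_deriv[of a C c] by (metis (no_types, lifting) sum.cong mem_Collect_eq)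
    qed (simp add: f0)
  qed
qed

lemma exp_coeffs_0: "exp_coeffs C 0 = 1"
  by (rule exp_coeffs_unique[symmetric]) auto

lemma exp_coeffs_add: "exp_coeffs C (c + d) = exp_coeffs C c * exp_coeffs C d"
  by (rule exp_coeffs_unique[symmetric])
    (simp_all add: deriv_mult exp_coeffs_point_deriv scal_add algebra_simps)

lemma exp_coeffs_power: "exp_coeffs C c ^ n = exp_coeffs C (real n * c)"
  by (induction n) (simp_all add: exp_coeffs_0 exp_coeffs_add[symmetric] algebra_simps)

section \<open>Substitution of x_S D^|S| for x_S, and Lagrange inversion\<close>

definition twist :: "'a sfun \<Rightarrow> 'a sfun \<Rightarrow> 'a sfun" where
  "twist D f = sfun (\<lambda>S. \<Sum>A\<in>Pow S. coef f A * coef (D ^ card A) (S - A))"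

lemma coef_twist: "coef (twist D f) S = (\<Sum>A\<in>Pow S. coef f A * coef (D ^ card A) (S - A))"
  by (cases "finite S") (auto simp: twist_def)

text \<open>The sum over all A is no ring expression. Cut off at a finite V it is one, with the same
  coefficients inside V, so that ring laws and the Leibniz rule can be applied termwise.\<close>

definition twist_upto :: "'a set \<Rightarrow> 'a sfun \<Rightarrow> 'a sfun \<Rightarrow> 'a sfun" where
  "twist_upto V D f = (\<Sum>A\<in>Pow V. scal (coef f A) * (mono_at A * D ^ card A))"

lemma coef_twist_upto:
  assumes "finite V" "T \<subseteq> V"
  shows "coef (twist_upto V D f) T = coef (twist D f) T"
proof -
  have "coef (twist_upto V D f) T =
      (\<Sum>A\<in>Pow V. if A \<subseteq> T then coef f A * coef (D ^ card A) (T - A) else 0)"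
    using finite_subset[OF assms(2,1)]
    by (auto simp: twist_upto_def coef_mono_at_mult intro!: sum.cong)
  also have "\<dots> = coef (twist D f) T"
    unfolding coef_twist using assms by (intro sum.mono_neutral_cong_right) auto
  finally show ?thesis .
qed

lemma coef_mult_cong:
  assumes "\<And>A. A \<subseteq> S \<Longrightarrow> coef f A = coef f' A" "\<And>A. A \<subseteq> S \<Longrightarrow> coef g A = coef g' A"
  shows "coef (f * g) S = coef (f' * g') S"
  unfolding coef_mult using assms by (auto intro!: sum.cong)

text \<open>The substitution is multiplicative because sizes add on disjoint unions, while monomials
  that overlap multiply to 0.\<close>

lemma twist_mult: "twist D (f * g) = twist D f * twist D g"
proof (rule sfun_eqI)
  fix S :: "'a set" assume S: "finite S"
  have fin: "A \<subseteq> S \<Longrightarrow> finite A" for A using S finite_subset by blast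
  have "coef (twist D f * twist D g) S = coef (twist_upto S D f * twist_upto S D g) S"
    by (rule coef_mult_cong) (simp_all add: coef_twist_upto S)
  also have "twist_upto S D f * twist_upto S D g =
      (\<Sum>A\<in>Pow S. \<Sum>B\<in>Pow S. (scal (coef f A) * scal (coef g B)) * 
        ((mono_at A * mono_at B) * D ^ (card A + card B)))"
    unfolding twist_upto_def sum_product by (simp add: power_add algebra_simps)
  also have "coef \<dots> S = (\<Sum>A\<in>Pow S. \<Sum>B\<in>Pow S. if A \<inter> B = {} then
       coef f A * coef g B * coef (D ^ (card A + card B)) (S - (A \<union> B)) else 0)"
    by (auto simp: coef_mono_at_mult mono_at_mult fin mult.assoc S intro!: sum.cong)
  also have "\<dots> = (\<Sum>A\<in>Pow S. \<Sum>B\<in>Pow (S - A).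
       coef f A * coef g B * coef (D ^ (card A + card B)) (S - (A \<union> B)))"
    using S by (intro sum.cong refl sum.mono_neutral_cong_right) auto
  also have "\<dots> = (\<Sum>(A, B)\<in>Sigma (Pow S) (\<lambda>A. Pow (S - A)).
       coef f A * coef g B * coef (D ^ (card A + card B)) (S - (A \<union> B)))"
    using S by (subst sum.Sigma) auto
  also have "\<dots> = (\<Sum>(T, A)\<in>Sigma (Pow S) Pow. coef f A * coef g (T - A) * coef (D ^ card T) (S - T))"
  proof (rule sum.reindex_bij_witness[of _ "\<lambda>(T, A). (A, T - A)" "\<lambda>(A, B). (A \<union> B, A)"])
    fix z assume "z \<in> Sigma (Pow S) (\<lambda>A. Pow (S - A))"
    then obtain A B where "z = (A, B)" "A \<subseteq> S" "B \<subseteq> S - A" by auto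
    moreover then have "A \<union> B - A = B" "card (A \<union> B) = card A + card B"
      using fin[of A] fin[of B] by (auto intro!: card_Un_disjoint)
    ultimately show "(case case z of (A, B) \<Rightarrow> (A \<union> B, A) of
         (T, A) \<Rightarrow> coef f A * coef g (T - A) * coef (D ^ card T) (S - T)) =
        (case z of (A, B) \<Rightarrow> coef f A * coef g B * coef (D ^ (card A + card B)) (S - (A \<union> B)))"
      by simp
  qed auto
  also have "\<dots> = coef (twist D (f * g)) S"
    unfolding coef_twist coef_mult[of f] using S fin
    by (subst sum.Sigma[symmetric]) (auto simp: sum_distrib_right)
  finally show "coef (twist D (f * g)) S = coef (twist D f * twist D g) S" by simp
qed

lemma twist_add: "twist D (f + g) = twist D f + twist D g"
  by (rule sfun_eqI) (simp add: coef_twist algebra_simps sum.distrib)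

text \<open>Write ' for the Euler operator. From J' = - J^2 D', at a set of n letters J^(n+1) D' and
  - J^n have the same coefficient if n > 0. Expanding D' by the equation for D and multiplying by
  J^v, all terms at V cancel except v b(V), that of A = V. The coefficient of J^v D' at V is also
  known directly from J^(v-1).\<close>

lemma lagrange_inversion:
  assumes inv: "D * J = 1" and D: "D = 1 + twist D b" and b0: "coef b {} = 0"
    and V: "finite V" "V \<noteq> {}"
  shows "real (card V - 1) * coef b V = - coef (J ^ (card V - 1)) V"
proof -
  define v where "v = card V"
  let ?d = "deriv_wrt (\<lambda>_. 1)"
  have v: "v > 0" using V by (auto simp: v_def)
  have "?d (J * D) = 0" using inv by (simp add: mult.commute)
  then have "?d J * D + J * ?d D = 0" by (simp only: deriv_mult)
  then have "J * (?d J * D + J * ?d D) = 0" by simp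
  moreover have "J * (?d J * D + J * ?d D) = ?d J * (D * J) + J ^ 2 * ?d D"
    by (simp add: algebra_simps power2_eq_square)
  ultimately have dJ: "?d J = - (J ^ 2 * ?d D)" using inv by (simp add: add_eq_0_iff)
  have JD: "J ^ n * D ^ m = J ^ (n - m)" if "m \<le> n" for n m
  proof -
    have "J ^ n = J ^ (n - m) * J ^ m" using that by (simp add: power_add[symmetric])
    then have "J ^ n * D ^ m = J ^ (n - m) * (D * J) ^ m"
      by (simp add: power_mult_distrib algebra_simps)
    then show ?thesis using inv by simp
  qed
  have dJn: "real n * coef (J ^ Suc n * ?d D) S = - (real (card S) * coef (J ^ n) S)" for n S
  proof (cases n)
    case (Suc m)
    have "?d (J ^ n) = of_nat n * J ^ m * ?d J" unfolding Suc deriv_power ..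
    also have "\<dots> = - (of_nat n * (J ^ Suc n * ?d D))"
      unfolding dJ Suc by (simp add: algebra_simps power2_eq_square)
    finally have "coef (?d (J ^ n)) S = - (real n * coef (J ^ Suc n * ?d D) S)"
      by (simp del: coef_deriv power_Suc)
    then show ?thesis by simp
  qed simp
  have dD: "coef (?d D) T = coef (\<Sum>A\<in>Pow V. scal (coef b A) * (mono_at A * ?d (D ^ card A) +
       of_nat (card A) * (mono_at A * D ^ card A))) T" if "T \<subseteq> V" for T
  proof -
    have dmono: "?d (mono_at A) = of_nat (card A) * mono_at A" for A :: "'a set"
      by (rule sfun_eqI) (auto simp: mono_at_def)
    have dscal: "?d (scal c * f) = scal c * ?d f" for c f
      by (rule sfun_eqI) simp
    have dsum: "?d (sum f I) = (\<Sum>i\<in>I. ?d (f i))" for f :: "'a set \<Rightarrow> 'a sfun" and I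
      by (rule sfun_eqI) (auto simp: sum_distrib_left)
    have "coef (?d D) T = coef (?d (twist D b)) T"
      by (subst D) simp
    also have "\<dots> = coef (?d (twist_upto V D b)) T"
      using that V by (simp add: coef_twist_upto)
    also have "?d (twist_upto V D b) = (\<Sum>A\<in>Pow V. scal (coef b A) * (mono_at A * ?d (D ^ card A) +
       of_nat (card A) * (mono_at A * D ^ card A)))"
      unfolding twist_upto_def dsum dscal unfolding deriv_mult dmono by (simp add: algebra_simps)
    finally show ?thesis .
  qed
  have "coef (J ^ v * ?d D) V = coef (J ^ v * (\<Sum>A\<in>Pow V. scal (coef b A) * (mono_at A * ?d (D ^ card A) +
       of_nat (card A) * (mono_at A * D ^ card A)))) V"
    by (rule coef_mult_cong) (use dD in auto)
  also have "J ^ v * (\<Sum>A\<in>Pow V. scal (coef b A) * (mono_at A * ?d (D ^ card A) +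
       of_nat (card A) * (mono_at A * D ^ card A))) =
     (\<Sum>A\<in>Pow V. scal (coef b A) * (mono_at A * (J ^ v * ?d (D ^ card A) +
       of_nat (card A) * (J ^ v * D ^ card A))))"
    by (simp add: sum_distrib_left algebra_simps)
  also have "coef \<dots> V = (\<Sum>A\<in>Pow V. coef b A * coef (J ^ v * ?d (D ^ card A) +
       of_nat (card A) * (J ^ v * D ^ card A)) (V - A))"
    using V by (auto simp: coef_mono_at_mult intro!: sum.cong)
  \<comment> \<open>Once J^v has absorbed D^(|A|-1), the exponent of J in front of D' is one more
    than the size of V - A. So \<open>dJn\<close> applies with n = |V - A| and the two summands
    cancel unless n = 0.\<close>
  also have "\<dots> = (\<Sum>A\<in>Pow V. if A = V then real v * coef b V else 0)"
  proof (rule sum.cong[OF refl])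
    fix A assume A: "A \<in> Pow V"
    then have fA: "finite A" "card A \<le> v" using V by (auto simp: v_def finite_subset card_mono)
    have r: "card (V - A) = v - card A" using A fA by (simp add: card_Diff_subset v_def)
    show "coef b A * coef (J ^ v * ?d (D ^ card A) + of_nat (card A) * (J ^ v * D ^ card A)) (V - A) =
      (if A = V then real v * coef b V else 0)"
    proof (cases "A = {}")
      case True
      then show ?thesis using b0 V by simp
    next
      case False
      then obtain m where m: "card A = Suc m" using fA by (cases "card A") auto
      have "J ^ v * ?d (D ^ card A) = of_nat (card A) * ((J ^ v * D ^ m) * ?d D)"
        unfolding m deriv_power by (simp add: algebra_simps)
      also have "J ^ v * D ^ m = J ^ Suc (v - card A)"
        using fA m by (simp add: JD Suc_diff_Suc del: power_Suc)
      finally have e: "coef (J ^ v * ?d (D ^ card A) + of_nat (card A) * (J ^ v * D ^ card A)) (V - A) =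
        real (card A) * (coef (J ^ Suc (v - card A) * ?d D) (V - A) + coef (J ^ (v - card A)) (V - A))"
        using fA by (simp add: JD algebra_simps del: power_Suc)
      show ?thesis
      proof (cases "A = V")
        case True
        then show ?thesis unfolding e by (simp add: v_def)
      next
        case neq: False
        then have "v - card A \<noteq> 0" using A V r by (auto simp: card_eq_0_iff)
        then have "coef (J ^ Suc (v - card A) * ?d D) (V - A) = - coef (J ^ (v - card A)) (V - A)"
          using dJn[of "v - card A" "V - A"] unfolding r
          by (metis mult_cancel_left mult_minus_right of_nat_eq_0_iff)
        then show ?thesis unfolding e using neq by simp
      qed
    qed
  qed
  also have "\<dots> = real v * coef b V" using V by simp
  finally have "coef (J ^ Suc (v - 1) * ?d D) V = real v * coef b V" using v by simp
  with dJn[of "v - 1" V] have "real (v - 1) * (real v * coef b V) = - (real v * coef (J ^ (v - 1)) V)"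
    by (simp add: v_def)
  then have "real v * (real (v - 1) * coef b V) = real v * (- coef (J ^ (v - 1)) V)"
    by (simp add: algebra_simps)
  then show ?thesis using v unfolding v_def by (metis mult_cancel_left of_nat_eq_0_iff less_irrefl)
qed

section \<open>Words with sign-restricted partial sums\<close>

definition wcount :: "('a list \<Rightarrow> bool) \<Rightarrow> 'a sfun" where
  "wcount G = sfun (\<lambda>S. real (card {xs \<in> permutations_of_set S. G xs}))"

text \<open>Letters do not repeat, so a splitting of a word determines which letters go to the left.
  Convolution counts pairs of factors, and \<open>uniq\<close> lets each word come from only one
  pair.\<close>

lemma wcount_concat:
  assumes uniq: "\<And>ys zs ys' zs'. G ys \<Longrightarrow> H zs \<Longrightarrow> G ys' \<Longrightarrow> H zs' \<Longrightarrow> distinct (ys @ zs) \<Longrightarrow>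
      ys @ zs = ys' @ zs' \<Longrightarrow> ys = ys'"
  shows "wcount (\<lambda>xs. \<exists>ys zs. xs = ys @ zs \<and> G ys \<and> H zs) = wcount G * wcount H"
proof (rule sfun_eqI)
  fix S :: "'a set" assume S: "finite S"
  let ?Z = "Sigma (Pow S) (\<lambda>A. {ys \<in> permutations_of_set A. G ys} \<times> {zs \<in> permutations_of_set (S - A). H zs})"
  have "bij_betw (\<lambda>(A, ys, zs). ys @ zs) ?Z
      {xs \<in> permutations_of_set S. \<exists>ys zs. xs = ys @ zs \<and> G ys \<and> H zs}"
  proof (rule bij_betw_imageI)
    show "inj_on (\<lambda>(A, ys, zs). ys @ zs) ?Z"
    proof (rule inj_onI)
      fix u v assume "u \<in> ?Z" "v \<in> ?Z" "(\<lambda>(A, ys, zs). ys @ zs) u = (\<lambda>(A, ys, zs). ys @ zs) v"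
      then show "u = v"
        using uniq[of "fst (snd u)" "snd (snd u)" "fst (snd v)" "snd (snd v)"]
        by (auto simp: permutations_of_set_def)
    qed
    show "(\<lambda>(A, ys, zs). ys @ zs) ` ?Z =
        {xs \<in> permutations_of_set S. \<exists>ys zs. xs = ys @ zs \<and> G ys \<and> H zs}"
    proof (intro equalityI subsetI)
      fix xs assume "xs \<in> {xs \<in> permutations_of_set S. \<exists>ys zs. xs = ys @ zs \<and> G ys \<and> H zs}"
      then obtain ys zs where "xs = ys @ zs" "G ys" "H zs" "set (ys @ zs) = S" "distinct (ys @ zs)"
        by (auto simp: permutations_of_set_def)
      then have "(set ys, ys, zs) \<in> ?Z" "xs = (\<lambda>(A, ys, zs). ys @ zs) (set ys, ys, zs)"
        by (auto simp: permutations_of_set_def)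
      then show "xs \<in> (\<lambda>(A, ys, zs). ys @ zs) ` ?Z" by (rule rev_image_eqI)
    qed (auto simp: permutations_of_set_def)
  qed
  from bij_betw_same_card[OF this, symmetric] S
  show "coef (wcount (\<lambda>xs. \<exists>ys zs. xs = ys @ zs \<and> G ys \<and> H zs)) S = coef (wcount G * wcount H) S"
    by (auto simp: wcount_def coef_mult card_cartesian_product finite_subset intro!: sum.cong)
qed

lemma wcount_disj:
  assumes "\<And>xs. \<not> (G xs \<and> H xs)"
  shows "wcount (\<lambda>xs. G xs \<or> H xs) = wcount G + wcount H"
proof (rule sfun_eqI)
  fix S :: "'a set" assume "finite S"
  moreover have "{xs \<in> permutations_of_set S. G xs \<or> H xs} =
      {xs \<in> permutations_of_set S. G xs} \<union> {xs \<in> permutations_of_set S. H xs}" by auto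
  ultimately show "coef (wcount (\<lambda>xs. G xs \<or> H xs)) S = coef (wcount G + wcount H) S"
    using assms by (auto simp: wcount_def card_Un_disjoint disjoint_iff)
qed

definition restr :: "('a set \<Rightarrow> bool) \<Rightarrow> 'a sfun \<Rightarrow> 'a sfun" where
  "restr Q f = sfun (\<lambda>S. if Q S then coef f S else 0)"

lemma coef_restr [simp]: "coef (restr Q f) S = (if Q S then coef f S else 0)"
  by (simp add: restr_def)

lemma restr_wcount: "restr Q (wcount G) = wcount (\<lambda>xs. G xs \<and> Q (set xs))"
proof (rule sfun_eqI)
  fix S :: "'a set" assume "finite S"
  moreover have "{xs \<in> permutations_of_set S. G xs \<and> Q (set xs)} =
      (if Q S then {xs \<in> permutations_of_set S. G xs} else {})"
    by (auto simp: permutations_of_set_def)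
  ultimately show "coef (restr Q (wcount G)) S = coef (wcount (\<lambda>xs. G xs \<and> Q (set xs))) S"
    by (simp add: wcount_def)
qed

lemma wcount_cong: "(\<And>xs. distinct xs \<Longrightarrow> G xs = H xs) \<Longrightarrow> wcount G = wcount H"
  by (rule sfun_eqI) (auto simp: wcount_def permutations_of_set_def intro!: arg_cong[of _ _ card])

section \<open>Partial sums of words and canonical cuts\<close>

abbreviation wsum :: "('a \<Rightarrow> int) \<Rightarrow> 'a list \<Rightarrow> int" where
  "wsum x xs \<equiv> sum_list (map x xs)"

lemma wsum_distinct: "distinct xs \<Longrightarrow> wsum x xs = sum x (set xs)"
  by (simp add: sum_list_distinct_conv_sum_set)

definition nonneg_prefixes :: "('a \<Rightarrow> int) \<Rightarrow> 'a list \<Rightarrow> bool" where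
  "nonneg_prefixes x xs \<longleftrightarrow> (\<forall>n. 0 \<le> wsum x (take n xs))"

text \<open>The encoding by reversal reduces counting to prefixes, see \<open>suffix_gf\<close>. The
  whole word is among its suffixes, so its total is at most 0.\<close>

definition nonpos_suffixes :: "('a \<Rightarrow> int) \<Rightarrow> 'a list \<Rightarrow> bool" where
  "nonpos_suffixes x xs \<longleftrightarrow> nonneg_prefixes (\<lambda>v. - x v) (rev xs)"

definition pos_prefixes :: "('a \<Rightarrow> int) \<Rightarrow> 'a list \<Rightarrow> bool" where
  "pos_prefixes x xs \<longleftrightarrow> (\<forall>ys zs. xs = ys @ zs \<longrightarrow> ys \<noteq> [] \<longrightarrow> 0 < wsum x ys)"

definition dyck :: "('a \<Rightarrow> int) \<Rightarrow> 'a list \<Rightarrow> bool" where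
  "dyck x xs \<longleftrightarrow> nonneg_prefixes x xs \<and> wsum x xs = 0"

lemma nonneg_prefixes_Nil [simp]: "nonneg_prefixes x []"
  by (simp add: nonneg_prefixes_def)

lemma nonneg_prefixes_append:
  "nonneg_prefixes x (ys @ zs) \<longleftrightarrow>
     nonneg_prefixes x ys \<and> (\<forall>n. 0 \<le> wsum x ys + wsum x (take n zs))"
proof (intro iffI conjI allI)
  assume h: "nonneg_prefixes x (ys @ zs)"
  show "0 \<le> wsum x ys + wsum x (take n zs)" for n
    using h[unfolded nonneg_prefixes_def, rule_format, of "length ys + n"] by simp
  show "nonneg_prefixes x ys" unfolding nonneg_prefixes_def
  proof
    fix n
    have "0 \<le> wsum x (take (min n (length ys)) (ys @ zs))"
      using h unfolding nonneg_prefixes_def by blast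
    then show "0 \<le> wsum x (take n ys)" by (cases "n \<le> length ys") (auto simp: min_def)
  qed
next
  assume h: "nonneg_prefixes x ys \<and> (\<forall>n. 0 \<le> wsum x ys + wsum x (take n zs))"
  show "nonneg_prefixes x (ys @ zs)" unfolding nonneg_prefixes_def
  proof
    fix n
    show "0 \<le> wsum x (take n (ys @ zs))"
      using h by (cases "n \<le> length ys") (auto simp: nonneg_prefixes_def)
  qed
qed

lemma nonneg_prefixes_wsum: "nonneg_prefixes x xs \<Longrightarrow> 0 \<le> wsum x xs"
  using nonneg_prefixes_append[of x xs "[]"] by simp

lemma nonneg_prefixes_snoc:
  "nonneg_prefixes x (ys @ [b]) \<longleftrightarrow> nonneg_prefixes x ys \<and> 0 \<le> wsum x ys + x b"
  unfolding nonneg_prefixes_append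
  by (auto dest: spec[of _ 1] simp: take_Cons' nonneg_prefixes_wsum)

lemma wsum_rev [simp]: "wsum x (rev xs) = wsum x xs"
  by (simp add: rev_map[symmetric] sum_list_rev)

lemma wsum_uminus [simp]: "wsum (\<lambda>v. - x v) xs = - wsum x xs"
  by (induction xs) auto

lemma nonpos_suffixes_Nil [simp]: "nonpos_suffixes x []"
  by (simp add: nonpos_suffixes_def)

lemma nonpos_suffixes_Cons:
  "nonpos_suffixes x (a # xs) \<longleftrightarrow> nonpos_suffixes x xs \<and> x a + wsum x xs \<le> 0"
  by (auto simp: nonpos_suffixes_def nonneg_prefixes_snoc)

lemma nonpos_suffixes_appendD: "nonpos_suffixes x (ys @ zs) \<Longrightarrow> nonpos_suffixes x zs"
  by (induction ys) (auto simp: nonpos_suffixes_Cons)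

lemma nonpos_suffixes_wsum: "nonpos_suffixes x xs \<Longrightarrow> wsum x xs \<le> 0"
  by (cases xs) (auto simp: nonpos_suffixes_Cons)

lemma nonpos_suffixes_take: "nonpos_suffixes x xs \<Longrightarrow> wsum x xs \<le> wsum x (take n xs)"
proof (induction xs arbitrary: n)
  case (Cons a xs)
  then show ?case by (cases n) (auto simp: nonpos_suffixes_Cons)
qed simp

lemma pos_prefixes_Nil [simp]: "pos_prefixes x []"
  by (simp add: pos_prefixes_def)

lemma pos_prefixes_wsum: "pos_prefixes x xs \<Longrightarrow> xs \<noteq> [] \<Longrightarrow> 0 < wsum x xs"
  by (auto simp: pos_prefixes_def)

lemma pos_prefixes_take: "pos_prefixes x xs \<Longrightarrow> 0 \<le> wsum x (take n xs)"
  unfolding pos_prefixes_def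
  by (metis append_take_drop_id less_imp_le list.map(1) sum_list.Nil order_refl)

text \<open>Scan from the right and stop at the first positive suffix sum. The suffix
  \<open>r\<close> before that is still nonpositive, which forces \<open>w\<close> to be a positive
  letter.\<close>

lemma last_positive_suffix:
  "\<not> nonpos_suffixes x xs \<Longrightarrow>
     \<exists>ys w r. xs = ys @ w # r \<and> nonpos_suffixes x r \<and> 0 < x w + wsum x r"
proof (induction xs)
  case (Cons a xs)
  show ?case
  proof (cases "nonpos_suffixes x xs")
    case True
    with Cons.prems have "0 < x a + wsum x xs" by (simp add: nonpos_suffixes_Cons)
    with True show ?thesis by (intro exI[of _ "[]"] exI[of _ a] exI[of _ xs]) auto
  next
    case False
    then obtain ys w r where "xs = ys @ w # r" "nonpos_suffixes x r" "0 < x w + wsum x r"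
      using Cons.IH by blast
    then show ?thesis by (intro exI[of _ "a # ys"] exI[of _ w] exI[of _ r]) auto
  qed
qed simp

text \<open>The cut is at the last minimum of the partial sums: the condition on \<open>Q\<close>
  says that no earlier one is lower, the condition on \<open>p\<close> that every later one is
  strictly higher.\<close>

lemma split_last_minimum: "\<exists>Q p. xs = Q @ p \<and> nonpos_suffixes x Q \<and> pos_prefixes x p"
proof (induction xs)
  case Nil
  show ?case by (intro exI[of _ "[]"]) auto
next
  case (Cons b xs)
  then obtain Q p where h: "xs = Q @ p" "nonpos_suffixes x Q" "pos_prefixes x p" by blast
  show ?case
  proof (cases "x b + wsum x Q \<le> 0")
    case True
    then show ?thesis using h
      by (intro exI[of _ "b # Q"] exI[of _ p]) (auto simp: nonpos_suffixes_Cons)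
  next
    case False
    \<comment> \<open>Now even the old minimum lies above the new starting level, so the cut moves
      to the front.\<close>
    have "pos_prefixes x (b # Q @ p)" unfolding pos_prefixes_def
    proof (intro allI impI)
      fix ys zs assume yz: "b # Q @ p = ys @ zs" "ys \<noteq> []"
      then obtain ys' where ys: "ys = b # ys'" "Q @ p = ys' @ zs" by (cases ys) auto
      have "ys' = take (length ys') (Q @ p)" unfolding ys(2) by simp
      then have "wsum x ys' = wsum x (take (length ys') Q) + wsum x (take (length ys' - length Q) p)"
        by (metis map_append sum_list.append take_append)
      with nonpos_suffixes_take[OF h(2), of "length ys'"] pos_prefixes_take[OF h(3), of "length ys' - length Q"]
      show "0 < wsum x ys" using False unfolding ys by simp
    qed
    then show ?thesis using h by (intro exI[of _ "[]"] exI[of _ "b # Q @ p"]) auto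
  qed
qed

text \<open>The cut is at the last return of the partial sums to 0; the strict inequality in
  \<open>pos_prefixes\<close> makes it the last one.\<close>

lemma split_last_zero:
  "nonneg_prefixes x m \<Longrightarrow> \<exists>ys p. m = ys @ p \<and> wsum x ys = 0 \<and> pos_prefixes x p"
proof (induction m rule: rev_induct)
  case Nil
  show ?case by (intro exI[of _ "[]"]) auto
next
  case (snoc c m)
  show ?case
  proof (cases "wsum x (m @ [c]) = 0")
    case True
    then show ?thesis by (intro exI[of _ "m @ [c]"] exI[of _ "[]"]) auto
  next
    case False
    from snoc obtain ys p where h: "m = ys @ p" "wsum x ys = 0" "pos_prefixes x p"
      by (auto simp: nonneg_prefixes_snoc)
    have "0 \<le> wsum x (m @ [c])" using nonneg_prefixes_wsum[OF snoc.prems] .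
    then have "0 < wsum x (p @ [c])" using False h by simp
    then have "pos_prefixes x (p @ [c])" unfolding pos_prefixes_def
    proof (intro allI impI)
      fix us zs assume "p @ [c] = us @ zs" "us \<noteq> []"
      then show "0 < wsum x us" using h(3) \<open>0 < wsum x (p @ [c])\<close>
        by (cases zs rule: rev_cases) (auto simp: pos_prefixes_def)
    qed
    then show ?thesis using h by (intro exI[of _ ys] exI[of _ "p @ [c]"]) auto
  qed
qed

section \<open>Generating functions of words and the cycle lemma\<close>

definition dyck_gf :: "('a \<Rightarrow> int) \<Rightarrow> 'a sfun" where
  "dyck_gf x = wcount (dyck x)"

definition prefix_gf :: "('a \<Rightarrow> int) \<Rightarrow> 'a sfun" where
  "prefix_gf x = wcount (nonneg_prefixes x)"

definition pos_point_gf :: "('a \<Rightarrow> int) \<Rightarrow> 'a sfun" where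
  "pos_point_gf x = wcount (\<lambda>xs. \<exists>w. xs = [w] \<and> 0 < x w)"

definition cycle_gf :: "('a \<Rightarrow> int) \<Rightarrow> 'a sfun" where
  "cycle_gf x = sfun (\<lambda>S. if S \<noteq> {} \<and> sum x S = 0 then fact (card S - 1) else 0)"

lemma coef_wcount_Nil [simp]: "coef (wcount G) {} = (if G [] then 1 else 0)"
proof -
  have "{xs. xs = [] \<and> G xs} = (if G [] then {[]} else {})" by auto
  then show ?thesis by (simp add: wcount_def)
qed

lemma coef_wcount_rev: "wcount (\<lambda>xs. G (rev xs)) = wcount G"
proof (rule sfun_eqI)
  fix S :: "'a set" assume "finite S"
  have "bij_betw rev {xs \<in> permutations_of_set S. G (rev xs)} {xs \<in> permutations_of_set S. G xs}"
    by (rule bij_betw_byWitness[of _ rev]) (auto simp: permutations_of_set_def)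
  then show "coef (wcount (\<lambda>xs. G (rev xs))) S = coef (wcount G) S"
    using bij_betw_same_card by (fastforce simp: wcount_def)
qed

text \<open>A prefix of the reversed word is a suffix of the word, and since the total is 0 its sum
  is minus that of the complementary prefix. As a consequence both colours share one series
  \<open>dyck_gf\<close>.\<close>

lemma dyck_rev: "dyck x (rev xs) \<longleftrightarrow> dyck (\<lambda>v. - x v) xs"
proof -
  have *: "dyck y (rev xs)" if "dyck (\<lambda>v. - y v) xs" for y and xs :: "'a list"
  proof -
    have "0 \<le> wsum y (take n (rev xs))" for n
    proof -
      have "wsum y xs = wsum y (take (length xs - n) xs) + wsum y (drop (length xs - n) xs)"
        by (metis append_take_drop_id map_append sum_list.append)
      moreover have "wsum y (take (length xs - n) xs) \<le> 0"
        using that unfolding dyck_def nonneg_prefixes_def by (simp add: neg_le_0_iff_le)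
      ultimately show ?thesis using that by (simp add: take_rev dyck_def)
    qed
    then show ?thesis using that by (simp add: dyck_def nonneg_prefixes_def)
  qed
  show ?thesis using *[of x xs] *[of "\<lambda>v. - x v" "rev xs"] by auto
qed

lemma dyck_gf_uminus: "dyck_gf (\<lambda>v. - x v) = dyck_gf x"
  unfolding dyck_gf_def dyck_rev[symmetric] by (rule coef_wcount_rev)

lemma suffix_gf: "wcount (nonpos_suffixes x) = prefix_gf (\<lambda>v. - x v)"
  unfolding prefix_gf_def nonpos_suffixes_def by (rule coef_wcount_rev)

text \<open>Cut a word with nonnegative prefix sums before its shortest suffix of positive weight.\<close>

lemma prefix_gf_decomp:
  "prefix_gf x = dyck_gf x +
     prefix_gf x * restr (\<lambda>S. 0 < sum x S) (pos_point_gf x * prefix_gf (\<lambda>v. - x v))"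
proof -
  let ?W = "\<lambda>xs. \<exists>w r. xs = w # r \<and> 0 < x w \<and> nonpos_suffixes x r \<and> 0 < wsum x xs"
  have "pos_point_gf x * prefix_gf (\<lambda>v. - x v) =
      wcount (\<lambda>xs. \<exists>ys zs. xs = ys @ zs \<and> (\<exists>w. ys = [w] \<and> 0 < x w) \<and> nonpos_suffixes x zs)"
    unfolding suffix_gf[symmetric] pos_point_gf_def by (rule wcount_concat[symmetric]) auto
  also have "\<dots> = wcount (\<lambda>xs. \<exists>w r. xs = w # r \<and> 0 < x w \<and> nonpos_suffixes x r)"
    by (rule wcount_cong) (metis append.simps)
  finally have W: "restr (\<lambda>S. 0 < sum x S) (pos_point_gf x * prefix_gf (\<lambda>v. - x v)) = wcount ?W"
    by (auto simp: restr_wcount wsum_distinct intro!: wcount_cong)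
  have PW: "prefix_gf x * wcount ?W =
      wcount (\<lambda>xs. \<exists>ys zs. xs = ys @ zs \<and> nonneg_prefixes x ys \<and> ?W zs)"
    unfolding prefix_gf_def
  proof (rule wcount_concat[symmetric])
    fix ys zs ys' zs' assume h: "?W zs" "?W zs'" "ys @ zs = ys' @ zs'"
    \<comment> \<open>The shorter of two such suffixes would lie in the tail of the longer one,
      where suffix sums are nonpositive.\<close>
    have *: "t = []" if "?W zs" "?W zs'" "zs = t @ zs'" for t zs zs'
    proof (rule ccontr)
      assume "t \<noteq> []"
      then obtain c t' where "t = c # t'" by (cases t) auto
      with that have "nonpos_suffixes x (t' @ zs')" by auto
      then have "wsum x zs' \<le> 0" using nonpos_suffixes_appendD nonpos_suffixes_wsum by metis
      then show False using that by auto
    qed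
    from h(3) obtain t where "ys = ys' @ t \<and> t @ zs = zs' \<or> ys @ t = ys' \<and> zs = t @ zs'"
      by (auto simp: append_eq_append_conv2)
    then show "ys = ys'"
    proof
      assume t: "ys = ys' @ t \<and> t @ zs = zs'"
      then show ?thesis using *[OF h(2,1), of t] by simp
    next
      assume t: "ys @ t = ys' \<and> zs = t @ zs'"
      then show ?thesis using *[OF h(1,2), of t] by simp
    qed
  qed
  have eq: "nonneg_prefixes x xs \<longleftrightarrow>
      dyck x xs \<or> (\<exists>ys zs. xs = ys @ zs \<and> nonneg_prefixes x ys \<and> ?W zs)" for xs
  proof
    assume h: "nonneg_prefixes x xs"
    show "dyck x xs \<or> (\<exists>ys zs. xs = ys @ zs \<and> nonneg_prefixes x ys \<and> ?W zs)"
    proof (cases "wsum x xs = 0")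
      case False
      then have "\<not> nonpos_suffixes x xs" using nonneg_prefixes_wsum[OF h] nonpos_suffixes_wsum by force
      then obtain ys w r where "xs = ys @ w # r" "nonpos_suffixes x r" "0 < x w + wsum x r"
        using last_positive_suffix by blast
      then show ?thesis using h nonpos_suffixes_wsum[of x r]
        by (intro disjI2 exI[of _ ys] exI[of _ "w # r"]) (auto simp: nonneg_prefixes_append)
    qed (use h in \<open>simp add: dyck_def\<close>)
  next
    assume "dyck x xs \<or> (\<exists>ys zs. xs = ys @ zs \<and> nonneg_prefixes x ys \<and> ?W zs)"
    then show "nonneg_prefixes x xs"
    proof
      assume "\<exists>ys zs. xs = ys @ zs \<and> nonneg_prefixes x ys \<and> ?W zs"
      then obtain ys w r where h: "xs = ys @ w # r" "nonneg_prefixes x ys" "nonpos_suffixes x r"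
        "0 < x w + wsum x r" by auto
      have "0 \<le> wsum x ys + wsum x (take n (w # r))" for n
        using nonneg_prefixes_wsum[OF h(2)] nonpos_suffixes_take[OF h(3), of "n - 1"] h(4)
        by (cases n) auto
      then show ?thesis using h by (simp add: nonneg_prefixes_append)
    qed (simp add: dyck_def)
  qed
  have "prefix_gf x = wcount (\<lambda>xs. dyck x xs \<or> (\<exists>ys zs. xs = ys @ zs \<and> nonneg_prefixes x ys \<and> ?W zs))"
    unfolding prefix_gf_def by (rule wcount_cong) (rule eq)
  also have "\<dots> = dyck_gf x + wcount (\<lambda>xs. \<exists>ys zs. xs = ys @ zs \<and> nonneg_prefixes x ys \<and> ?W zs)"
    unfolding dyck_gf_def
  proof (rule wcount_disj)
    fix xs
    show "\<not> (dyck x xs \<and> (\<exists>ys zs. xs = ys @ zs \<and> nonneg_prefixes x ys \<and> ?W zs))"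
    proof clarify
      fix ys w r assume "dyck x (ys @ w # r)" "nonneg_prefixes x ys" "0 < wsum x (w # r)"
      then show False using nonneg_prefixes_wsum[of x ys] by (simp add: dyck_def)
    qed
  qed
  finally show ?thesis unfolding W PW .
qed

text \<open>For transferring a sign: if the whole is balanced and one factor lives on positive
  totals, only negative totals of the other factor matter.\<close>

lemma restr_mult_support:
  assumes "\<And>S A. finite S \<Longrightarrow> A \<subseteq> S \<Longrightarrow> Q S \<Longrightarrow> coef f A \<noteq> 0 \<Longrightarrow> coef g (S - A) \<noteq> 0 \<Longrightarrow> R (S - A)"
  shows "restr Q (f * g) = restr Q (f * restr R g)"
proof (rule sfun_eqI)
  fix S :: "'a set" assume S: "finite S"
  have "coef f A * coef g (S - A) = coef f A * coef (restr R g) (S - A)" if "Q S" "A \<subseteq> S" for A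
    using assms[OF S that(2,1)] by (cases "coef f A = 0"; cases "coef g (S - A) = 0") auto
  then show "coef (restr Q (f * g)) S = coef (restr Q (f * restr R g)) S"
    by (auto simp: coef_mult simp del: coef_restr intro!: sum.cong) (auto simp: coef_mult intro!: sum.cong)
qed

lemma coef_dyck_gf_nonzero: "coef (dyck_gf x) S \<noteq> 0 \<Longrightarrow> sum x S = 0"
  by (auto simp: dyck_gf_def wcount_def dyck_def card_gt_0_iff permutations_of_set_def wsum_distinct
      split: if_splits)

lemma coef_pos_point_gf: "coef (pos_point_gf x) S = (if \<exists>w. S = {w} \<and> 0 < x w then 1 else 0)"
proof (cases "\<exists>w. S = {w} \<and> 0 < x w")
  case True
  then obtain w where w: "S = {w}" "0 < x w" by blast
  then have "{xs. xs = [w] \<and> (\<exists>w. xs = [w] \<and> 0 < x w)} = {[w]}" by auto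
  then show ?thesis using w by (auto simp: pos_point_gf_def wcount_def)
next
  case False
  then have "{xs \<in> permutations_of_set S. \<exists>w. xs = [w] \<and> 0 < x w} = {}"
    by (auto simp: permutations_of_set_def)
  then show ?thesis using False unfolding pos_point_gf_def wcount_def
    by (auto split del: if_split) auto
qed

text \<open>A nonempty Dyck word is a word with nonnegative prefix sums followed by a negative
  letter. \<open>prefix_gf_decomp\<close> splits the first factor: the Dyck part plus one letter
  cannot be balanced, and in the other part commutativity regroups the last letter with the prefix
  word into the mirror image of \<open>W\<close>.\<close>

lemma dyck_gf_decomp:
  assumes nz: "\<And>v. x v \<noteq> 0"
  defines "W \<equiv> restr (\<lambda>S. 0 < sum x S) (pos_point_gf x * prefix_gf (\<lambda>v. - x v))"
    and "K \<equiv> restr (\<lambda>S. sum x S < 0) (pos_point_gf (\<lambda>v. - x v) * prefix_gf x)"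
  shows "dyck_gf x = 1 + restr (\<lambda>S. sum x S = 0) (W * K)"
proof -
  let ?l = "pos_point_gf (\<lambda>v. - x v)"
  let ?bal = "\<lambda>S. sum x S = 0"
  let ?G = "\<lambda>xs. \<exists>ys zs. xs = ys @ zs \<and> nonneg_prefixes x ys \<and> (\<exists>w. zs = [w] \<and> 0 < - x w)"
  have eq: "dyck x xs \<longleftrightarrow> xs = [] \<or> (?G xs \<and> wsum x xs = 0)" for xs
  proof (cases xs rule: rev_cases)
    case (snoc p b)
    show ?thesis
    proof
      assume h: "dyck x xs"
      then have "nonneg_prefixes x p" "x b < 0" "wsum x xs = 0"
        using nz[of b] nonneg_prefixes_wsum[of x p] unfolding snoc
        by (auto simp: dyck_def nonneg_prefixes_snoc)
      then show "xs = [] \<or> (?G xs \<and> wsum x xs = 0)"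
        unfolding snoc by (intro disjI2 conjI exI[of _ p] exI[of _ "[b]"]) auto
    next
      assume "xs = [] \<or> (?G xs \<and> wsum x xs = 0)"
      then show "dyck x xs" using snoc by (auto simp: dyck_def nonneg_prefixes_snoc)
    qed
  qed (simp add: dyck_def)
  have "wcount ?G = prefix_gf x * ?l"
    unfolding prefix_gf_def pos_point_gf_def by (rule wcount_concat) auto
  then have "restr ?bal (prefix_gf x * ?l) = wcount (\<lambda>xs. ?G xs \<and> wsum x xs = 0)"
    by (simp only: flip: \<open>wcount ?G = prefix_gf x * ?l\<close>)
      (simp only: restr_wcount, rule wcount_cong, simp only: wsum_distinct)
  moreover have "wcount (\<lambda>xs. xs = []) = (1 :: 'a sfun)"
  proof (rule sfun_eqI)
    fix S :: "'a set" assume "finite S"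
    have "{xs \<in> permutations_of_set S. xs = []} = (if S = {} then {[]} else {})"
      by (auto simp: permutations_of_set_def)
    then show "coef (wcount (\<lambda>xs. xs = [])) S = coef 1 S" by (simp add: wcount_def)
  qed
  moreover have "dyck_gf x = wcount (\<lambda>xs. xs = []) + wcount (\<lambda>xs. ?G xs \<and> wsum x xs = 0)"
    unfolding dyck_gf_def
    by (subst wcount_disj[symmetric]) (use eq in \<open>auto intro!: wcount_cong\<close>)
  ultimately have "dyck_gf x = 1 + restr ?bal (prefix_gf x * ?l)" by simp
  also have "prefix_gf x * ?l = dyck_gf x * ?l + W * (?l * prefix_gf x)"
    unfolding W_def by (subst (1) prefix_gf_decomp) (simp add: algebra_simps)
  also have "restr ?bal (dyck_gf x * ?l + W * (?l * prefix_gf x)) =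
      restr ?bal (dyck_gf x * ?l) + restr ?bal (W * (?l * prefix_gf x))"
    by (rule sfun_eqI) auto
  also have "restr ?bal (dyck_gf x * ?l) = 0"
  proof -
    have "coef (dyck_gf x) A * coef ?l (S - A) = 0" if "finite S" "A \<subseteq> S" "sum x S = 0" for S A
    proof (rule ccontr)
      assume "coef (dyck_gf x) A * coef ?l (S - A) \<noteq> 0"
      then obtain w where "sum x A = 0" "S - A = {w}" "x w < 0"
        using coef_dyck_gf_nonzero by (force simp: coef_pos_point_gf split: if_splits)
      then show False using that sum.subset_diff[of A S x] by simp
    qed
    then show ?thesis by (intro sfun_eqI) (auto simp: coef_mult intro!: sum.neutral)
  qed
  also have "restr ?bal (W * (?l * prefix_gf x)) = restr ?bal (W * K)"
    unfolding K_def
  proof (rule restr_mult_support)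
    fix S A assume h: "finite S" "A \<subseteq> S" "sum x S = 0" "coef W A \<noteq> 0"
    then have "0 < sum x A" by (auto simp: W_def split: if_splits)
    then show "sum x (S - A) < 0" using h sum.subset_diff[of A S x] by simp
  qed
  finally show ?thesis by simp
qed

text \<open>The cycle lemma. Read a cyclic arrangement of S from \<open>a\<close> on as
  \<open>a # zs\<close>. Exactly one rotation \<open>p @ a # q\<close> is a Dyck word without return
  to 0 before \<open>a\<close>, the one that starts at the last minimum. So these words correspond
  to the arrangements \<open>zs\<close> of the other letters.\<close>

lemma card_first_component:
  assumes S: "finite S" "a \<in> S" "sum x S = 0"
  shows "card {xs \<in> permutations_of_set S. dyck x xs \<and> (\<exists>p q. xs = p @ a # q \<and> pos_prefixes x p)}
    = fact (card S - 1)"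
proof -
  let ?T = "{(p, q). p @ a # q \<in> permutations_of_set S \<and> dyck x (p @ a # q) \<and> pos_prefixes x p}"
  have "bij_betw (\<lambda>(p, q). p @ a # q) ?T
      {xs \<in> permutations_of_set S. dyck x xs \<and> (\<exists>p q. xs = p @ a # q \<and> pos_prefixes x p)}"
  proof (rule bij_betw_imageI)
    show "inj_on (\<lambda>(p, q). p @ a # q) ?T"
    proof (rule inj_onI, clarify)
      fix p q p' q' assume "p @ a # q \<in> permutations_of_set S" and eq: "p @ a # q = p' @ a # q'"
      then have "distinct (p @ a # q)" by (simp only: permutations_of_set_def mem_Collect_eq)
      then have "a \<notin> set p" "a \<notin> set q" by auto
      then show "p = p' \<and> q = q'" using append_Cons_eq_iff[of a p q p' q'] eq by blast
    qed
    show "(\<lambda>(p, q). p @ a # q) ` ?T =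
      {xs \<in> permutations_of_set S. dyck x xs \<and> (\<exists>p q. xs = p @ a # q \<and> pos_prefixes x p)}"
      by (intro equalityI subsetI; clarify) (blast, rule image_eqI[of _ _ "(_, _)"], auto)
  qed
  then have "card {xs \<in> permutations_of_set S. dyck x xs \<and> (\<exists>p q. xs = p @ a # q \<and> pos_prefixes x p)}
    = card ?T" by (simp add: bij_betw_same_card)
  also have "bij_betw (\<lambda>(p, q). q @ p) ?T (permutations_of_set (S - {a}))"
  proof (rule bij_betw_imageI)
    show "inj_on (\<lambda>(p, q). q @ p) ?T"
    proof (rule inj_onI, clarify)
      fix p q p' q'
      assume h: "q @ p = q' @ p'" "dyck x (p @ a # q)" "pos_prefixes x p"
        "dyck x (p' @ a # q')" "pos_prefixes x p'"
      \<comment> \<open>Two candidates differ by a block \<open>t\<close> that opens one word and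
        closes the other. As a nonempty prefix of \<open>p\<close> it has positive total, as the end
        of a Dyck word it cannot.\<close>
      have *: "t = []" if "p = t @ p'" "q' = q @ t" "pos_prefixes x p" "dyck x (p' @ a # q')" for t p q p' q'
      proof (rule ccontr)
        assume "t \<noteq> []"
        then have "0 < wsum x t" using that by (simp add: pos_prefixes_def)
        moreover have "nonneg_prefixes x ((p' @ a # q) @ t)" "wsum x ((p' @ a # q) @ t) = 0"
          using that by (simp_all add: dyck_def)
        then have "0 \<le> wsum x (p' @ a # q)" "wsum x (p' @ a # q) + wsum x t = 0"
          using nonneg_prefixes_wsum[of x "p' @ a # q"]
          unfolding nonneg_prefixes_append[of x "p' @ a # q"] by auto
        ultimately show False by simp
      qed
      from h(1) obtain t where "q = q' @ t \<and> t @ p = p' \<or> q @ t = q' \<and> p = t @ p'"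
        by (auto simp: append_eq_append_conv2)
      then show "p = p' \<and> q = q'"
      proof
        assume t: "q = q' @ t \<and> t @ p = p'"
        then show ?thesis using *[of p' t p q q'] h(2,5) by simp
      next
        assume t: "q @ t = q' \<and> p = t @ p'"
        then show ?thesis using *[of p t p' q' q] h(3,4) by simp
      qed
    qed
    show "(\<lambda>(p, q). q @ p) ` ?T = permutations_of_set (S - {a})"
    proof (intro equalityI subsetI)
      fix zs assume zs: "zs \<in> permutations_of_set (S - {a})"
      then have azs: "distinct (a # zs)" "set (a # zs) = S" using S by (auto simp: permutations_of_set_def)
      then have tot: "wsum x (a # zs) = 0" using S(3) by (simp only: wsum_distinct)
      obtain Q p where Qp: "a # zs = Q @ p" "nonpos_suffixes x Q" "pos_prefixes x p"
        using split_last_minimum by blast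
      \<comment> \<open>With the minimum at the front the balanced word would have positive total.
        Hence \<open>Q\<close> starts with \<open>a\<close>.\<close>
      have "Q \<noteq> []" using tot pos_prefixes_wsum[OF Qp(3)] Qp(1) by auto
      then obtain q where Q: "Q = a # q" "zs = q @ p" using Qp(1) by (cases Q) auto
      have sum0: "wsum x p + wsum x Q = 0" using tot unfolding Qp(1) by simp
      have "nonneg_prefixes x p" using pos_prefixes_take[OF Qp(3)] by (simp add: nonneg_prefixes_def)
      moreover have "0 \<le> wsum x p + wsum x (take n Q)" for n
        using nonpos_suffixes_take[OF Qp(2), of n] sum0 by simp
      ultimately have "dyck x (p @ a # q)"
        using sum0 unfolding dyck_def nonneg_prefixes_append Q(1)[symmetric] by simp
      moreover have "p @ a # q \<in> permutations_of_set S"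
        using azs unfolding Q by (auto simp: permutations_of_set_def)
      ultimately show "zs \<in> (\<lambda>(p, q). q @ p) ` ?T" using Qp Q by (auto simp: image_iff)
    qed (auto simp: permutations_of_set_def)
  qed
  then have "card ?T = card (permutations_of_set (S - {a}))" by (rule bij_betw_same_card)
  also have "\<dots> = fact (card S - 1)" using S by simp
  finally show ?thesis .
qed

text \<open>A Dyck word containing \<open>a\<close> is cut at its last return to 0 before
  \<open>a\<close>: any Dyck word may stand to the left, and \<open>card_first_component\<close>
  counts the right part. This is D' = C' D in the letter \<open>a\<close>.\<close>

lemma dyck_gf_point_deriv: "point_deriv a (dyck_gf x) = point_deriv a (cycle_gf x) * dyck_gf x"
proof -
  let ?Y = "\<lambda>xs. dyck x xs \<and> (\<exists>p q. xs = p @ a # q \<and> pos_prefixes x p)"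
  have "coef (point_deriv a (cycle_gf x)) S = coef (wcount ?Y) S" if S: "finite S" for S
  proof (cases "a \<in> S \<and> sum x S = 0")
    case True
    then show ?thesis using S card_first_component[of S a x]
      by (auto simp: sum_indicator_point cycle_gf_def wcount_def)
  next
    case False
    have "a \<in> S \<and> sum x S = 0" if "xs \<in> permutations_of_set S" "?Y xs" for xs
    proof -
      have "set xs = S" "distinct xs" using that(1) by (auto simp: permutations_of_set_def)
      moreover have "a \<in> set xs" "wsum x xs = 0" using that(2) by (auto simp: dyck_def)
      ultimately show ?thesis using wsum_distinct by metis
    qed
    with False have "{xs \<in> permutations_of_set S. ?Y xs} = {}" by blast
    then have "coef (wcount ?Y) S = 0" by (simp only: wcount_def coef_sfun) simp
    then show ?thesis using S False
      by (auto simp: sum_indicator_point cycle_gf_def)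
  qed
  then have Y: "point_deriv a (cycle_gf x) = wcount ?Y" by (rule sfun_eqI)
  have conc: "dyck_gf x * wcount ?Y = wcount (\<lambda>xs. \<exists>ys zs. xs = ys @ zs \<and> dyck x ys \<and> ?Y zs)"
    unfolding dyck_gf_def
  proof (rule wcount_concat[symmetric])
    fix ys zs ys' zs'
    assume h: "dyck x ys" "?Y zs" "dyck x ys'" "?Y zs'" "distinct (ys @ zs)" "ys @ zs = ys' @ zs'"
    \<comment> \<open>A later cut would leave a nonempty block \<open>t\<close> of sum 0 in front of
      \<open>a\<close>, where the partial sums of \<open>zs\<close> are positive.\<close>
    have *: "t = []" if k: "?Y zs" "?Y zs'" "zs = t @ zs'" "wsum x t = 0" "distinct zs" for t zs zs'
    proof (rule ccontr)
      assume "t \<noteq> []"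
      obtain p q where p: "zs = p @ a # q" "pos_prefixes x p" using k by blast
      have "a \<in> set zs'" using k by auto
      then have "a \<notin> set t" using k by auto
      with p(1) k(3) obtain u where "p = t @ u"
        by (auto simp: append_eq_append_conv2 append_eq_Cons_conv)
      then show False using p(2) \<open>t \<noteq> []\<close> k(4) by (auto simp: pos_prefixes_def)
    qed
    from h(6) obtain t where "ys = ys' @ t \<and> t @ zs = zs' \<or> ys @ t = ys' \<and> zs = t @ zs'"
      by (auto simp: append_eq_append_conv2)
    then show "ys = ys'"
    proof
      assume t: "ys = ys' @ t \<and> t @ zs = zs'"
      have "wsum x ys = 0" "wsum x ys' = 0" using h(1,3) by (simp_all add: dyck_def)
      then have "wsum x t = 0" using t by auto
      moreover have "distinct zs'" using h(5,6) by (metis distinct_append)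
      ultimately show ?thesis using *[OF h(4,2), of t] t by simp
    next
      assume t: "ys @ t = ys' \<and> zs = t @ zs'"
      have "wsum x ys = 0" "wsum x ys' = 0" using h(1,3) by (simp_all add: dyck_def)
      then have "wsum x t = 0" using t by auto
      moreover have "distinct zs" using h(5) by simp
      ultimately show ?thesis using *[OF h(2,4), of t] t by simp
    qed
  qed
  have eq: "dyck x xs \<and> a \<in> set xs \<longleftrightarrow> (\<exists>ys zs. xs = ys @ zs \<and> dyck x ys \<and> ?Y zs)" for xs
  proof
    assume h: "dyck x xs \<and> a \<in> set xs"
    then obtain m q where m: "xs = m @ a # q" by (auto simp: in_set_conv_decomp)
    then have "nonneg_prefixes x m" using h by (simp add: dyck_def nonneg_prefixes_append)
    then obtain ys p where yp: "m = ys @ p" "wsum x ys = 0" "pos_prefixes x p"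
      using split_last_zero by blast
    have "nonneg_prefixes x ys" using h unfolding m yp by (simp add: dyck_def nonneg_prefixes_append)
    then have "dyck x ys" using yp by (simp add: dyck_def)
    moreover have "nonneg_prefixes x (ys @ (p @ a # q))" using h unfolding m yp by (simp add: dyck_def)
    then have "nonneg_prefixes x (p @ a # q)"
      unfolding nonneg_prefixes_append[of x ys] nonneg_prefixes_def[of x "p @ a # q"] using yp by simp
    then have "dyck x (p @ a # q)" using h yp unfolding m by (simp add: dyck_def)
    ultimately show "\<exists>ys zs. xs = ys @ zs \<and> dyck x ys \<and> ?Y zs"
      using m yp by (intro exI[of _ ys] exI[of _ "p @ a # q"]) auto
  next
    assume "\<exists>ys zs. xs = ys @ zs \<and> dyck x ys \<and> ?Y zs"
    then obtain ys zs where h: "xs = ys @ zs" "dyck x ys" "?Y zs" by blast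
    then have "\<And>n. 0 \<le> wsum x (take n zs)" by (simp add: dyck_def nonneg_prefixes_def)
    then have "dyck x xs" using h unfolding h(1) dyck_def nonneg_prefixes_append by simp
    then show "dyck x xs \<and> a \<in> set xs" using h by auto
  qed
  have "point_deriv a (dyck_gf x) = restr (\<lambda>S. a \<in> S) (dyck_gf x)"
    by (rule sfun_eqI) (simp add: sum_indicator_point)
  also have "\<dots> = wcount (\<lambda>xs. \<exists>ys zs. xs = ys @ zs \<and> dyck x ys \<and> ?Y zs)"
    unfolding dyck_gf_def restr_wcount by (rule wcount_cong) (rule eq)
  finally show ?thesis unfolding Y conc[symmetric] by (simp add: mult.commute)
qed

lemma scal_1 [simp]: "scal 1 = 1"
  by (rule sfun_eqI) (auto simp: scal_def)

lemma dyck_gf_eq_exp: "dyck_gf x = exp_coeffs (cycle_gf x) 1"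
  by (rule exp_coeffs_unique) (simp_all add: dyck_gf_point_deriv, simp add: dyck_gf_def dyck_def)

section \<open>Splitting trees at an edge\<close>

definition adj :: "'a set set \<Rightarrow> ('a \<times> 'a) set" where
  "adj E = {(x, y). {x, y} \<in> E}"

lemma adj_iff [simp]: "(x, y) \<in> adj E \<longleftrightarrow> {x, y} \<in> E"
  by (simp add: adj_def)

lemma sym_adj: "sym (adj E)"
  by (auto simp: sym_def insert_commute)

lemma adj_rtrancl_sym: "(x, y) \<in> (adj E)\<^sup>* \<Longrightarrow> (y, x) \<in> (adj E)\<^sup>*"
  by (meson sym_adj sym_rtrancl symD)

lemma adj_rtrancl_mono: "(x, y) \<in> (adj E)\<^sup>* \<Longrightarrow> E \<subseteq> F \<Longrightarrow> (x, y) \<in> (adj F)\<^sup>*"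
  by (erule rtrancl_mono[THEN subsetD, rotated]) (auto simp: adj_def)

lemma graph_connected_iff:
  "graph_connected V E \<longleftrightarrow> V \<noteq> {} \<and> (\<forall>u\<in>V. \<forall>v\<in>V. (u, v) \<in> (adj E)\<^sup>*)"
  by (simp add: graph_connected_def adj_def)

lemma graph_connectedI:
  assumes "r \<in> V" "\<And>v. v \<in> V \<Longrightarrow> (r, v) \<in> (adj E)\<^sup>*"
  shows "graph_connected V E"
  unfolding graph_connected_iff using assms by (meson adj_rtrancl_sym empty_iff rtrancl_trans)

lemma rtrancl_simple_path:
  assumes "(u, v) \<in> r\<^sup>*"
  shows "\<exists>p. p \<noteq> [] \<and> hd p = u \<and> last p = v \<and> distinct p \<and> successively (\<lambda>a b. (a, b) \<in> r) p"
  using assms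
proof (induction rule: converse_rtrancl_induct)
  case base
  show ?case by (intro exI[of _ "[v]"]) auto
next
  case (step u y)
  then obtain p where p: "p \<noteq> []" "hd p = y" "last p = v" "distinct p"
    "successively (\<lambda>a b. (a, b) \<in> r) p" by blast
  show ?case
  proof (cases "u \<in> set p")
    case True
    then obtain as bs where "p = as @ u # bs" by (auto simp: in_set_conv_decomp)
    then show ?thesis using p by (intro exI[of _ "u # bs"]) (auto simp: successively_append_iff)
  next
    case False
    then show ?thesis using p step.hyps by (intro exI[of _ "u # p"]) (auto simp: successively_Cons)
  qed
qed

text \<open>A simple detour from u to v closes up with the edge to a cycle.\<close>

lemma graph_tree_bridge:
  assumes T: "graph_tree V E" and e: "{u, v} \<in> E"
  shows "(u, v) \<notin> (adj (E - {{u, v}}))\<^sup>*"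
proof
  assume "(u, v) \<in> (adj (E - {{u, v}}))\<^sup>*"
  then obtain p where p: "p \<noteq> []" "hd p = u" "last p = v" "distinct p"
    "successively (\<lambda>a b. (a, b) \<in> adj (E - {{u, v}})) p"
    using rtrancl_simple_path by metis
  have "card {u, v} = 2" using T e by (auto simp: graph_tree_def)
  then have uv: "u \<noteq> v" by auto
  let ?n = "length p"
  have nth: "{p ! i, p ! Suc i} \<in> E - {{u, v}}" if "Suc i < ?n" for i
    using p(5) that by (simp add: successively_conv_nth)
  have h: "p ! 0 = u" "p ! (?n - 1) = v" using p by (simp_all add: hd_conv_nth last_conv_nth)
  have "?n \<noteq> 0" "?n \<noteq> 1" using h uv p by auto
  moreover have "?n \<noteq> 2" using nth[of 0] h by auto
  ultimately have n: "3 \<le> ?n" by linarith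
  have "{p ! i, p ! (Suc i mod ?n)} \<in> E" if "i < ?n" for i
  proof (cases "Suc i < ?n")
    case True
    then show ?thesis using nth[of i] by simp
  next
    case False
    then have "i = ?n - 1" "Suc i mod ?n = 0" using that by (linarith, simp add: mod_if)
    then show ?thesis using h e by (simp add: insert_commute)
  qed
  then have "graph_cycle E p" using n p by (simp add: graph_cycle_def)
  then show False using T by (auto simp: graph_tree_def)
qed

text \<open>The rest of a cycle is a detour around one of its edges. With bridges in place of
  acyclicity, cutting and joining trees is a matter of reachability, and no cycle has to be followed
  through the construction.\<close>

lemma graph_treeI_bridge:
  assumes "finite V" "\<And>e. e \<in> E \<Longrightarrow> e \<subseteq> V \<and> card e = 2" "graph_connected V E"
    and bridge: "\<And>u v. {u, v} \<in> E \<Longrightarrow> (u, v) \<notin> (adj (E - {{u, v}}))\<^sup>*"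
  shows "graph_tree V E"
proof -
  have False if c: "graph_cycle E c" for c
  proof -
    let ?n = "length c"
    have n: "3 \<le> ?n" "distinct c" and ed: "\<And>i. i < ?n \<Longrightarrow> {c ! i, c ! (Suc i mod ?n)} \<in> E"
      using c by (auto simp: graph_cycle_def)
    have "Suc (?n - 1) = ?n" using n by linarith
    then have "{c ! (?n - 1), c ! 0} \<in> E" using ed[of "?n - 1"] by simp
    then have e: "{c ! 0, c ! (?n - 1)} \<in> E" by (simp add: insert_commute)
    have "i < ?n \<Longrightarrow> (c ! 0, c ! i) \<in> (adj (E - {{c ! 0, c ! (?n - 1)}}))\<^sup>*" for i
    proof (induction i)
      case (Suc i)
      have "{c ! i, c ! Suc i} \<noteq> {c ! 0, c ! (?n - 1)}"
      proof
        assume "{c ! i, c ! Suc i} = {c ! 0, c ! (?n - 1)}"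
        then have "c ! i = c ! 0 \<and> c ! Suc i = c ! (?n - 1) \<or> c ! i = c ! (?n - 1) \<and> c ! Suc i = c ! 0"
          by (simp add: doubleton_eq_iff)
        moreover have "c ! i = c ! 0 \<longleftrightarrow> i = 0" "c ! Suc i = c ! (?n - 1) \<longleftrightarrow> Suc i = ?n - 1"
          "c ! Suc i = c ! 0 \<longleftrightarrow> Suc i = 0"
        proof -
          have "i < ?n" "0 < ?n" "Suc i < ?n" "?n - 1 < ?n" using Suc.prems n(1) by linarith+
          then show "c ! i = c ! 0 \<longleftrightarrow> i = 0" "c ! Suc i = c ! (?n - 1) \<longleftrightarrow> Suc i = ?n - 1"
            "c ! Suc i = c ! 0 \<longleftrightarrow> Suc i = 0"
            using nth_eq_iff_index_eq[OF n(2)] by blast+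
        qed
        ultimately have "i = 0 \<and> Suc i = ?n - 1 \<or> Suc i = 0" by blast
        then show False using n(1) by linarith
      qed
      then have "(c ! i, c ! Suc i) \<in> adj (E - {{c ! 0, c ! (?n - 1)}})"
        using ed[of i] Suc.prems by simp
      then show ?case using Suc by (meson Suc_lessD rtrancl.rtrancl_into_rtrancl)
    qed simp
    then show False using bridge[OF e] n by simp
  qed
  then show ?thesis using assms by (auto simp: graph_tree_def)
qed

lemma graph_tree_finite: "graph_tree V E \<Longrightarrow> finite V"
  and graph_tree_nonempty: "graph_tree V E \<Longrightarrow> V \<noteq> {}"
  and graph_tree_edge: "graph_tree V E \<Longrightarrow> e \<in> E \<Longrightarrow> e \<subseteq> V \<and> card e = 2"
  and graph_tree_reach: "graph_tree V E \<Longrightarrow> u \<in> V \<Longrightarrow> v \<in> V \<Longrightarrow> (u, v) \<in> (adj E)\<^sup>*"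
  by (auto simp: graph_tree_def graph_connected_iff)

lemma graph_tree_finite_edges: "graph_tree V E \<Longrightarrow> finite E"
  by (rule finite_subset[of _ "Pow V"]) (auto dest: graph_tree_edge graph_tree_finite)

lemma finite_graph_trees: "finite V \<Longrightarrow> finite {E. graph_tree V E}"
  by (rule finite_subset[of _ "Pow (Pow V)"]) (auto dest: graph_tree_edge)

text \<open>The side of the edge away from \<open>w\<close>.\<close>

definition branch :: "'a set set \<Rightarrow> 'a \<Rightarrow> 'a \<Rightarrow> 'a set" where
  "branch E w b = {v. (b, v) \<in> (adj (E - {{w, b}}))\<^sup>*}"

lemma graph_tree_split:
  assumes T: "graph_tree V E" and e: "{w, b} \<in> E"
  defines "B \<equiv> branch E w b"
  shows "B \<subseteq> V - {w}" "b \<in> B" "graph_tree (V - B) {e \<in> E. e \<subseteq> V - B}" "graph_tree B {e \<in> E. e \<subseteq> B}"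
    "E = insert {w, b} ({e \<in> E. e \<subseteq> V - B} \<union> {e \<in> E. e \<subseteq> B})"
proof -
  let ?E' = "E - {{w, b}}"
  let ?E1 = "{e \<in> E. e \<subseteq> V - B}" and ?E2 = "{e \<in> E. e \<subseteq> B}"
  have wbV: "w \<in> V" "b \<in> V" using graph_tree_edge[OF T e] by auto
  have edges: "y \<in> V" "z \<in> V" if "{y, z} \<in> E" for y z using graph_tree_edge[OF T that] by auto
  show bB: "b \<in> B" by (simp add: B_def branch_def)
  have wB: "w \<notin> B"
    using graph_tree_bridge[OF T e] adj_rtrancl_sym by (fastforce simp: B_def branch_def)
  have BV: "v \<in> V" if "v \<in> B" for v
  proof -
    have "(b, v) \<in> (adj ?E')\<^sup>*" using that by (simp add: B_def branch_def)
    then show ?thesis by (induction rule: rtrancl_induct) (use wbV edges in auto)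
  qed
  then show "B \<subseteq> V - {w}" using wB by blast
  have closed: "y \<in> B \<longleftrightarrow> z \<in> B" if "{y, z} \<in> ?E'" for y z
  proof -
    have "z \<in> B" if "{y, z} \<in> ?E'" "y \<in> B" for y z
      using that rtrancl_into_rtrancl[of b y "adj ?E'" z] by (auto simp: B_def branch_def)
    from this[of y z] this[of z y] that show ?thesis by (auto simp: insert_commute)
  qed
  have doubleton: "\<exists>y z. e = {y, z}" if "e \<in> E" for e
    using graph_tree_edge[OF T that] by (auto simp: card_2_iff)
  show "E = insert {w, b} (?E1 \<union> ?E2)"
  proof (intro equalityI subsetI)
    fix e assume "e \<in> E"
    moreover then obtain y z where "e = {y, z}" using doubleton by blast
    ultimately show "e \<in> insert {w, b} (?E1 \<union> ?E2)" using closed[of y z] edges by auto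
  qed (use e in auto)
  have sub: "graph_tree A {e \<in> E. e \<subseteq> A}" if "A \<subseteq> V" "graph_connected A {e \<in> E. e \<subseteq> A}" for A
  proof (rule graph_treeI_bridge)
    fix u v assume uv: "{u, v} \<in> {e \<in> E. e \<subseteq> A}"
    show "(u, v) \<notin> (adj ({e \<in> E. e \<subseteq> A} - {{u, v}}))\<^sup>*"
      using graph_tree_bridge[OF T, of u v] uv
        adj_rtrancl_mono[of u v "{e \<in> E. e \<subseteq> A} - {{u, v}}" "E - {{u, v}}"] by blast
  qed (use that T in \<open>auto dest: graph_tree_edge graph_tree_finite finite_subset\<close>)
  show "graph_tree B ?E2"
  proof (rule sub)
    show "graph_connected B ?E2"
    proof (rule graph_connectedI[OF bB])
      fix v assume "v \<in> B"
      then have "(b, v) \<in> (adj ?E')\<^sup>*" by (simp add: B_def branch_def)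
      then show "(b, v) \<in> (adj ?E2)\<^sup>*"
      proof (induction rule: rtrancl_induct)
        case (step y z)
        have "y \<in> B" using step.hyps(1) by (simp add: B_def branch_def)
        then have "(y, z) \<in> adj ?E2" using step.hyps(2) closed[of y z] by auto
        then show ?case using step.IH by (rule rtrancl_into_rtrancl[rotated])
      qed simp
    qed
  qed (use BV in auto)
  show "graph_tree (V - B) ?E1"
  proof (rule sub)
    show "graph_connected (V - B) ?E1"
    proof (rule graph_connectedI[of w])
      fix v assume v: "v \<in> V - B"
      then have "(w, v) \<in> (adj E)\<^sup>*" using graph_tree_reach[OF T] wbV by auto
      \<comment> \<open>The claim is weakened because a path in E may wander through B; it can leave
        B only over the cut edge and thus restarts at \<open>w\<close>.\<close>
      then have "v \<in> B \<or> (w, v) \<in> (adj ?E1)\<^sup>*"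
      proof (induction rule: rtrancl_induct)
        case (step y z)
        show ?case
        proof (cases "z \<in> B \<or> z = w")
          case False
          then have ne: "{y, z} \<noteq> {w, b}" using bB by (auto simp: doubleton_eq_iff)
          then have y: "y \<notin> B" using step.hyps(2) closed[of y z] False by auto
          then have "(y, z) \<in> adj ?E1" using step.hyps(2) False edges[of y z] by auto
          then show ?thesis using step.IH y by (meson rtrancl.rtrancl_into_rtrancl)
        qed auto
      qed simp
      then show "(w, v) \<in> (adj ?E1)\<^sup>*" using v by simp
    qed (use wbV wB in auto)
  qed auto
qed

text \<open>Collapse B onto \<open>w\<close>. The new edge and the edges of \<open>E2\<close> become
  steps that stay in place, so a detour in the joined tree maps to a detour in
  \<open>E1\<close>.\<close>

lemma graph_tree_join_bridge:
  assumes T1: "graph_tree A E1" and T2: "graph_tree B E2"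
    and AB: "A \<inter> B = {}" "w \<in> A" "b \<in> B" and uv: "{u, v} \<in> E1"
  shows "(u, v) \<notin> (adj (insert {w, b} (E1 \<union> E2) - {{u, v}}))\<^sup>*"
proof
  define f where "f y = (if y \<in> A then y else w)" for y
  have e1: "y \<in> A" "z \<in> A" if "{y, z} \<in> E1" for y z using graph_tree_edge[OF T1 that] by auto
  have e2: "y \<in> B" "z \<in> B" if "{y, z} \<in> E2" for y z using graph_tree_edge[OF T2 that] by auto
  assume uv': "(u, v) \<in> (adj (insert {w, b} (E1 \<union> E2) - {{u, v}}))\<^sup>*"
  \<comment> \<open>The endpoint \<open>v\<close> varies in the induction below, so the deleted edge
    is frozen under a name.\<close>
  define e0 where "e0 = {u, v}"
  from uv' have "(u, f v) \<in> (adj (E1 - {e0}))\<^sup>*"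
    unfolding e0_def[symmetric]
  proof (induction rule: rtrancl_induct)
    case base
    then show ?case using e1[OF uv] by (simp add: f_def)
  next
    case (step y z)
    consider "{y, z} = {w, b}" | "{y, z} \<in> E1 - {e0}" | "{y, z} \<in> E2" using step.hyps(2) by auto
    then show ?case
    proof cases
      case 1
      then have "f y = f z" using AB by (auto simp: f_def doubleton_eq_iff)
      then show ?thesis using step.IH by simp
    next
      case 2
      then have "f y = y" "f z = z" using e1[of y z] by (auto simp: f_def)
      then show ?thesis using step.IH 2 by (metis adj_iff rtrancl.rtrancl_into_rtrancl)
    next
      case 3
      then have "f y = f z" using e2[of y z] AB by (auto simp: f_def)
      then show ?thesis using step.IH by simp
    qed
  qed
  then show False using graph_tree_bridge[OF T1 uv] e1[OF uv] by (simp add: f_def e0_def)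
qed

lemma reach_in_part:
  assumes "(u, v) \<in> (adj (E1 \<union> E2))\<^sup>*" "u \<in> A"
    and "\<And>e. e \<in> E1 \<Longrightarrow> e \<subseteq> A" "\<And>e. e \<in> E2 \<Longrightarrow> e \<inter> A = {}"
  shows "v \<in> A"
  using assms(1,2)
proof (induction rule: rtrancl_induct)
  case (step y z)
  then show ?case using assms(3)[of "{y, z}"] assms(4)[of "{y, z}"] by auto
qed

lemma graph_tree_join:
  assumes T1: "graph_tree A E1" and T2: "graph_tree B E2"
    and AB: "A \<inter> B = {}" "w \<in> A" "b \<in> B"
  defines "E \<equiv> insert {w, b} (E1 \<union> E2)"
  shows "graph_tree (A \<union> B) E" "{w, b} \<in> E" "branch E w b = B"
    "{e \<in> E. e \<subseteq> A} = E1" "{e \<in> E. e \<subseteq> B} = E2"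
proof -
  have e1: "e \<subseteq> A" "card e = 2" if "e \<in> E1" for e using graph_tree_edge[OF T1 that] by auto
  have e2: "e \<subseteq> B" "card e = 2" if "e \<in> E2" for e using graph_tree_edge[OF T2 that] by auto
  have ne: "{} \<notin> E1" "{} \<notin> E2" using e1[of "{}"] e2[of "{}"] by auto
  have not_in: "{w, b} \<notin> E1 \<union> E2" using e1[of "{w, b}"] e2[of "{w, b}"] AB by auto
  then have E': "E - {{w, b}} = E1 \<union> E2" by (auto simp: E_def)
  have E'': "E - {{b, w}} = E2 \<union> E1" using E' by (auto simp: insert_commute)
  show wbE: "{w, b} \<in> E" by (simp add: E_def)
  have d1: "e \<inter> B = {}" if "e \<in> E1" for e using e1(1)[OF that] AB by auto
  have d2: "e \<inter> A = {}" if "e \<in> E2" for e using e2(1)[OF that] AB by auto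
  have rA: "v \<in> A" if "(w, v) \<in> (adj (E - {{w, b}}))\<^sup>*" for v
    using reach_in_part[of w v E1 E2 A] that e1 d2 AB unfolding E' by auto
  have rB: "v \<in> B" if "(b, v) \<in> (adj (E - {{w, b}}))\<^sup>*" for v
    using reach_in_part[of b v E2 E1 B] that e2 d1 AB unfolding E' by (auto simp: Un_commute)
  show "branch E w b = B"
  proof (intro equalityI subsetI)
    fix v assume "v \<in> B"
    then have "(b, v) \<in> (adj E2)\<^sup>*" using graph_tree_reach[OF T2] AB by auto
    then show "v \<in> branch E w b" unfolding branch_def E' by (auto intro: adj_rtrancl_mono)
  qed (auto simp: branch_def intro: rB)
  show "{e \<in> E. e \<subseteq> A} = E1"
  proof (intro equalityI subsetI)
    fix e assume "e \<in> {e \<in> E. e \<subseteq> A}"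
    then show "e \<in> E1" using AB d2[of e] ne by (auto simp: E_def Int_absorb2)
  qed (use e1 in \<open>auto simp: E_def\<close>)
  show "{e \<in> E. e \<subseteq> B} = E2"
  proof (intro equalityI subsetI)
    fix e assume "e \<in> {e \<in> E. e \<subseteq> B}"
    then show "e \<in> E2" using AB d1[of e] ne by (auto simp: E_def Int_absorb2)
  qed (use e2 in \<open>auto simp: E_def\<close>)
  show "graph_tree (A \<union> B) E"
  proof (rule graph_treeI_bridge)
    show "finite (A \<union> B)" using T1 T2 by (simp add: graph_tree_finite)
    show "e \<subseteq> A \<union> B \<and> card e = 2" if "e \<in> E" for e
    proof -
      have "w \<noteq> b" using AB by auto
      then show ?thesis using that e1[of e] e2[of e] AB by (auto simp: E_def)
    qed
    show "graph_connected (A \<union> B) E"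
    proof (rule graph_connectedI[of w])
      fix v assume "v \<in> A \<union> B"
      then show "(w, v) \<in> (adj E)\<^sup>*"
      proof
        assume "v \<in> A"
        then have "(w, v) \<in> (adj E1)\<^sup>*" using graph_tree_reach[OF T1] AB by auto
        then show ?thesis by (rule adj_rtrancl_mono) (auto simp: E_def)
      next
        assume "v \<in> B"
        then have "(b, v) \<in> (adj E2)\<^sup>*" using graph_tree_reach[OF T2] AB by auto
        then have "(b, v) \<in> (adj E)\<^sup>*" by (rule adj_rtrancl_mono) (auto simp: E_def)
        moreover have "(w, b) \<in> adj E" using wbE by simp
        ultimately show ?thesis by (rule converse_rtrancl_into_rtrancl[rotated])
      qed
    qed (use AB in auto)
    show "(u, v) \<notin> (adj (E - {{u, v}}))\<^sup>*" if "{u, v} \<in> E" for u v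
    proof -
      consider "{u, v} = {w, b}" | "{u, v} \<in> E1" | "{u, v} \<in> E2" using \<open>{u, v} \<in> E\<close> by (auto simp: E_def)
      then show ?thesis
      proof cases
        case 1
        then have "u = w \<and> v = b \<or> u = b \<and> v = w" by (simp add: doubleton_eq_iff)
        then show ?thesis using rA[of v] rB[of v] AB 1 by auto
      next
        case 2
        show ?thesis unfolding E_def by (rule graph_tree_join_bridge[OF T1 T2 AB 2])
      next
        case 3
        have "(u, v) \<notin> (adj (insert {b, w} (E2 \<union> E1) - {{u, v}}))\<^sup>*"
          by (rule graph_tree_join_bridge[OF T2 T1 _ _ _ 3]) (use AB in auto)
        then show ?thesis unfolding E_def by (simp add: insert_commute Un_commute)
      qed
    qed
  qed
qed

lemma graph_tree_singleton: "graph_tree {r} E \<longleftrightarrow> E = {}"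
proof
  assume T: "graph_tree {r} E"
  have "card e \<le> card {r}" if "e \<in> E" for e
    using graph_tree_edge[OF T that] by (intro card_mono) auto
  then show "E = {}" using graph_tree_edge[OF T] by fastforce
next
  assume "E = {}"
  then show "graph_tree {r} E"
    by (intro graph_treeI_bridge) (auto intro: graph_connectedI[of r])
qed

lemma graph_tree_edge_at:
  assumes T: "graph_tree V E" and r: "r \<in> V" and V: "V \<noteq> {r}"
  shows "\<exists>b. {r, b} \<in> E"
proof -
  obtain v where v: "v \<in> V" "v \<noteq> r" using r V by blast
  then have "(r, v) \<in> (adj E)\<^sup>*" using graph_tree_reach[OF T r] by blast
  then show ?thesis using v by (cases rule: converse_rtranclE) auto
qed

lemma graph_tree_card: "graph_tree V E \<Longrightarrow> card E = card V - 1"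
proof (induction "card V" arbitrary: V E rule: less_induct)
  case less
  note T = less.prems
  obtain r where r: "r \<in> V" using graph_tree_nonempty[OF T] by blast
  show ?case
  proof (cases "V = {r}")
    case True
    then show ?thesis using T by (simp add: graph_tree_singleton)
  next
    case False
    then obtain b where e: "{r, b} \<in> E" using graph_tree_edge_at[OF T r] by blast
    define B where "B = branch E r b"
    note s = graph_tree_split[OF T e, folded B_def]
    let ?E1 = "{e \<in> E. e \<subseteq> V - B}" and ?E2 = "{e \<in> E. e \<subseteq> B}"
    have fin: "finite V" "finite E" using T by (auto dest: graph_tree_finite graph_tree_finite_edges)
    have V: "B \<subset> V" "V - B \<subset> V" using s r by auto
    then have lt: "card B < card V" "card (V - B) < card V" using fin by (auto intro: psubset_card_mono)
    have c1: "card ?E1 = card (V - B) - 1" and c2: "card ?E2 = card B - 1"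
      using less.hyps[OF lt(2) s(3)] less.hyps[OF lt(1) s(4)] by auto
    have "{} \<notin> E" using graph_tree_edge[OF T, of "{}"] by auto
    moreover have "e = {}" if "e \<subseteq> V - B" "e \<subseteq> B" for e using that by blast
    ultimately have dis: "?E1 \<inter> ?E2 = {}" by blast
    have ni: "{r, b} \<notin> ?E1 \<union> ?E2" using s(1,2) by auto
    have "card E = card (insert {r, b} (?E1 \<union> ?E2))" using s(5) by simp
    also have "\<dots> = Suc (card ?E1 + card ?E2)"
      using fin dis ni by (simp add: card_Un_disjoint)
    also have "\<dots> = card V - 1"
    proof -
      have "card V = card (V - B) + card B" using V fin
        by (metis card_Diff_subset card_mono finite_subset le_add_diff_inverse2 psubset_imp_subset)
      moreover have "0 < card B" "0 < card (V - B)"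
        using graph_tree_nonempty[OF s(3)] graph_tree_nonempty[OF s(4)] fin V
        by (auto simp: card_gt_0_iff finite_subset)
      ultimately show ?thesis unfolding c1 c2 by linarith
    qed
    finally show ?thesis .
  qed
qed

text \<open>A tree with a marked edge at \<open>w\<close> amounts to its two halves and the far end
  \<open>b\<close>, since \<open>graph_tree_split\<close> and \<open>graph_tree_join\<close> invert
  each other.\<close>

lemma sum_edge_split:
  fixes F :: "'a set set \<Rightarrow> 'a \<Rightarrow> real"
  assumes V: "finite V" and w: "w \<in> V"
  shows "(\<Sum>E | graph_tree V E. \<Sum>b | {w, b} \<in> E. F E b) =
    (\<Sum>B | B \<subseteq> V - {w}. \<Sum>b\<in>B. \<Sum>E1 | graph_tree (V - B) E1. \<Sum>E2 | graph_tree B E2.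
       F (insert {w, b} (E1 \<union> E2)) b)"
proof -
  let ?L = "Sigma {E. graph_tree V E} (\<lambda>E. {b. {w, b} \<in> E})"
  let ?R = "Sigma {B. B \<subseteq> V - {w}} (\<lambda>B. Sigma B (\<lambda>b. {E1. graph_tree (V - B) E1} \<times> {E2. graph_tree B E2}))"
  have finB: "finite B" if "B \<subseteq> V - {w}" for B using that V finite_subset by auto
  have finb: "finite {b. {w, b} \<in> E}" if "graph_tree V E" for E
    by (rule finite_subset[OF _ V]) (use graph_tree_edge[OF that] in auto)
  have "(\<Sum>E | graph_tree V E. \<Sum>b | {w, b} \<in> E. F E b) = (\<Sum>(E, b)\<in>?L. F E b)"
    using V finb by (subst sum.Sigma) (auto simp: finite_graph_trees)
  also have "\<dots> = (\<Sum>(B, b, E1, E2)\<in>?R. F (insert {w, b} (E1 \<union> E2)) b)"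
  proof (rule sum.reindex_bij_witness[of _ "\<lambda>(B, b, E1, E2). (insert {w, b} (E1 \<union> E2), b)"
        "\<lambda>(E, b). (branch E w b, b, {e \<in> E. e \<subseteq> V - branch E w b}, {e \<in> E. e \<subseteq> branch E w b})"])
    fix z assume "z \<in> ?L"
    then obtain E b where z: "z = (E, b)" "graph_tree V E" "{w, b} \<in> E" by auto
    note s = graph_tree_split[OF z(2,3)]
    show "(case case z of (E, b) \<Rightarrow> (branch E w b, b, {e \<in> E. e \<subseteq> V - branch E w b}, {e \<in> E. e \<subseteq> branch E w b}) of
        (B, b, E1, E2) \<Rightarrow> (insert {w, b} (E1 \<union> E2), b)) = z"
      using s(5)[symmetric] z(1) by simp
    show "(case z of (E, b) \<Rightarrow> (branch E w b, b, {e \<in> E. e \<subseteq> V - branch E w b}, {e \<in> E. e \<subseteq> branch E w b})) \<in> ?R"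
      using s z(1) by simp
    show "(case case z of (E, b) \<Rightarrow> (branch E w b, b, {e \<in> E. e \<subseteq> V - branch E w b}, {e \<in> E. e \<subseteq> branch E w b}) of
        (B, b, E1, E2) \<Rightarrow> F (insert {w, b} (E1 \<union> E2)) b) = (case z of (E, b) \<Rightarrow> F E b)"
      using s(5)[symmetric] z(1) by simp
  next
    fix z assume "z \<in> ?R"
    then obtain B b E1 E2 where z: "z = (B, b, E1, E2)" "B \<subseteq> V - {w}" "b \<in> B"
      "graph_tree (V - B) E1" "graph_tree B E2" by auto
    have d: "(V - B) \<inter> B = {}" "w \<in> V - B" and V: "V - B \<union> B = V" using z w by auto
    note j = graph_tree_join[OF z(4,5) d z(3), unfolded V]
    show "(case case z of (B, b, E1, E2) \<Rightarrow> (insert {w, b} (E1 \<union> E2), b) of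
         (E, b) \<Rightarrow> (branch E w b, b, {e \<in> E. e \<subseteq> V - branch E w b}, {e \<in> E. e \<subseteq> branch E w b})) = z"
      using j z(1) by simp
    show "(case z of (B, b, E1, E2) \<Rightarrow> (insert {w, b} (E1 \<union> E2), b)) \<in> ?L"
      using j z(1) by simp
  qed
  also have "\<dots> = (\<Sum>B | B \<subseteq> V - {w}. \<Sum>(b, E1, E2) \<in> Sigma B (\<lambda>b. {E1. graph_tree (V - B) E1} \<times> {E2. graph_tree B E2}).
       F (insert {w, b} (E1 \<union> E2)) b)"
    using V finB by (subst sum.Sigma) (auto intro!: finite_SigmaI finite_cartesian_product finite_graph_trees)
  also have "\<dots> = (\<Sum>B | B \<subseteq> V - {w}. \<Sum>b\<in>B. \<Sum>(E1, E2) \<in> {E1. graph_tree (V - B) E1} \<times> {E2. graph_tree B E2}.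
       F (insert {w, b} (E1 \<union> E2)) b)"
    using V finB by (intro sum.cong refl, subst sum.Sigma)
      (auto intro!: finite_cartesian_product finite_graph_trees)
  finally show ?thesis by (simp add: sum.cartesian_product)
qed

section \<open>Trees with a positive flow\<close>

definition sign_bipartite :: "('a \<Rightarrow> int) \<Rightarrow> 'a set set \<Rightarrow> bool" where
  "sign_bipartite x E \<longleftrightarrow> (\<forall>e\<in>E. \<exists>w b. e = {w, b} \<and> 0 < x w \<and> x b < 0)"

definition pos_flow :: "('a \<Rightarrow> int) \<Rightarrow> 'a set \<Rightarrow> 'a set set \<Rightarrow> ('a set \<Rightarrow> int) \<Rightarrow> bool" where
  "pos_flow x A E g \<longleftrightarrow> (\<forall>e\<in>E. 0 < g e) \<and> (\<forall>v\<in>A. (\<Sum>e | e \<in> E \<and> v \<in> e. g e) = \<bar>x v\<bar>)"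

text \<open>The set A on which the vertex weights are prescribed is a separate argument so that a
  root can be exempted.\<close>

definition feasible :: "('a \<Rightarrow> int) \<Rightarrow> 'a set \<Rightarrow> 'a set set \<Rightarrow> bool" where
  "feasible x A E \<longleftrightarrow> sign_bipartite x E \<and> (\<exists>g. pos_flow x A E g)"

lemma sign_bipartite_uminus: "sign_bipartite (\<lambda>v. - x v) E \<longleftrightarrow> sign_bipartite x E"
proof -
  have "sign_bipartite (\<lambda>v. - x v) E" if "sign_bipartite x E" for x :: "'a \<Rightarrow> int"
    using that unfolding sign_bipartite_def by (metis insert_commute neg_0_less_iff_less neg_less_0_iff_less)
  from this[of x] this[of "\<lambda>v. - x v"] show ?thesis by auto
qed

lemma feasible_uminus: "feasible (\<lambda>v. - x v) A E \<longleftrightarrow> feasible x A E"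
  by (simp add: feasible_def sign_bipartite_uminus pos_flow_def)

lemma sgn_mult_abs_int: "sgn x * \<bar>x\<bar> = (x::int)"
  by (simp add: sgn_if)

text \<open>Every edge is counted twice, with sign + at its white end and with sign - at its black
  end.\<close>

lemma signed_flow_sum:
  assumes V: "finite V" and E: "\<And>e. e \<in> E \<Longrightarrow> e \<subseteq> V" and bip: "sign_bipartite x E"
  shows "(\<Sum>v\<in>V. sgn (x v) * (\<Sum>e | e \<in> E \<and> v \<in> e. g e)) = 0"
proof -
  have fE: "finite E" using E V by (intro finite_subset[of E "Pow V"]) auto
  have "(\<Sum>v\<in>V. sgn (x v) * (\<Sum>e | e \<in> E \<and> v \<in> e. g e)) =
      (\<Sum>v\<in>V. \<Sum>e | e \<in> E \<and> v \<in> e. sgn (x v) * g e)" by (simp add: sum_distrib_left)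
  also have "\<dots> = (\<Sum>e\<in>E. \<Sum>v | v \<in> V \<and> v \<in> e. sgn (x v) * g e)"
    using V fE by (rule sum.swap_restrict)
  also have "\<dots> = 0"
  proof (rule sum.neutral, rule ballI)
    fix e assume e: "e \<in> E"
    then obtain w b where wb: "e = {w, b}" "0 < x w" "x b < 0" using bip by (auto simp: sign_bipartite_def)
    moreover have "{v \<in> V. v \<in> e} = {w, b}" using E[OF e] wb by auto
    moreover have "w \<noteq> b" using wb by auto
    ultimately show "(\<Sum>v | v \<in> V \<and> v \<in> e. sgn (x v) * g e) = 0" by simp
  qed
  finally show ?thesis .
qed

text \<open>By the vanishing signed sum the other vertices determine the flow at the exempted one.
  The deficit sgn (x r) * sum x V is what a stem planted at \<open>r\<close> has to carry.\<close>

lemma flow_at_root: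
  assumes V: "finite V" "r \<in> V" and E: "\<And>e. e \<in> E \<Longrightarrow> e \<subseteq> V" and bip: "sign_bipartite x E"
    and flow: "pos_flow x (V - {r}) E g" and r0: "x r \<noteq> 0"
  shows "(\<Sum>e | e \<in> E \<and> r \<in> e. g e) = \<bar>x r\<bar> - sgn (x r) * sum x V"
proof -
  let ?s = "\<lambda>v. \<Sum>e | e \<in> E \<and> v \<in> e. g e"
  have "0 = sgn (x r) * ?s r + (\<Sum>v\<in>V - {r}. sgn (x v) * ?s v)"
    using signed_flow_sum[OF V(1) E bip, of g] V by (simp add: sum.remove)
  also have "(\<Sum>v\<in>V - {r}. sgn (x v) * ?s v) = sum x (V - {r})"
    using flow by (intro sum.cong) (auto simp: pos_flow_def sgn_mult_abs_int)
  also have "\<dots> = sum x V - x r" using V by (simp add: sum_diff1)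
  finally have eq: "sgn (x r) * ?s r = x r - sum x V" by simp
  have "sgn (x r) * (sgn (x r) * ?s r) = \<bar>x r\<bar> - sgn (x r) * sum x V"
    unfolding eq by (simp add: algebra_simps abs_sgn)
  moreover have "sgn (x r) * (sgn (x r) * ?s r) = ?s r"
    using r0 by (simp add: sgn_if)
  ultimately show ?thesis by simp
qed

lemma pos_flow_balanced:
  assumes V: "finite V" "r \<in> V" and E: "\<And>e. e \<in> E \<Longrightarrow> e \<subseteq> V" and bip: "sign_bipartite x E"
    and r0: "x r \<noteq> 0" and bal: "sum x V = 0"
  shows "pos_flow x (V - {r}) E g \<longleftrightarrow> pos_flow x V E g"
proof
  assume h: "pos_flow x (V - {r}) E g"
  have r: "(\<Sum>e | e \<in> E \<and> r \<in> e. g e) = \<bar>x r\<bar>"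
    using flow_at_root[OF V E bip h r0] bal by simp
  show "pos_flow x V E g" unfolding pos_flow_def
  proof (intro conjI ballI)
    fix v assume "v \<in> V"
    then show "(\<Sum>e | e \<in> E \<and> v \<in> e. g e) = \<bar>x v\<bar>"
      using h r by (cases "v = r") (auto simp: pos_flow_def)
  qed (use h in \<open>auto simp: pos_flow_def\<close>)
qed (auto simp: pos_flow_def)

lemma join_incident:
  assumes T1: "graph_tree A E1" and T2: "graph_tree B E2"
    and AB: "A \<inter> B = {}" "w \<in> A" "b \<in> B"
  defines "E \<equiv> insert {w, b} (E1 \<union> E2)"
  shows "v \<in> A - {w} \<Longrightarrow> {e \<in> E. v \<in> e} = {e \<in> E1. v \<in> e}"
    and "v \<in> B - {b} \<Longrightarrow> {e \<in> E. v \<in> e} = {e \<in> E2. v \<in> e}"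
    and "{e \<in> E. w \<in> e} = insert {w, b} {e \<in> E1. w \<in> e}"
    and "{e \<in> E. b \<in> e} = insert {w, b} {e \<in> E2. b \<in> e}"
    and "{w, b} \<notin> E1" "{w, b} \<notin> E2" "E1 \<inter> E2 = {}"
proof -
  have e1: "e \<subseteq> A" "card e = 2" if "e \<in> E1" for e using graph_tree_edge[OF T1 that] by auto
  have e2: "e \<subseteq> B" "card e = 2" if "e \<in> E2" for e using graph_tree_edge[OF T2 that] by auto
  show "{w, b} \<notin> E1" "{w, b} \<notin> E2" using e1(1)[of "{w, b}"] e2(1)[of "{w, b}"] AB by auto
  have "e = {}" if "e \<in> E1" "e \<in> E2" for e using e1(1)[OF that(1)] e2(1)[OF that(2)] AB by blast
  moreover have "{} \<notin> E1" using e1(2)[of "{}"] by auto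
  ultimately show "E1 \<inter> E2 = {}" by blast
  show "v \<in> A - {w} \<Longrightarrow> {e \<in> E. v \<in> e} = {e \<in> E1. v \<in> e}"
    using e2 AB unfolding E_def by blast
  show "v \<in> B - {b} \<Longrightarrow> {e \<in> E. v \<in> e} = {e \<in> E2. v \<in> e}"
    using e1 AB unfolding E_def by blast
  show "{e \<in> E. w \<in> e} = insert {w, b} {e \<in> E1. w \<in> e}"
    using e2 AB unfolding E_def by blast
  show "{e \<in> E. b \<in> e} = insert {w, b} {e \<in> E2. b \<in> e}"
    using e1 AB unfolding E_def by blast
qed

lemma sign_bipartite_edge:
  "sign_bipartite x (insert {w, b} F) \<longleftrightarrow> x w * x b < 0 \<and> sign_bipartite x F"
  unfolding sign_bipartite_def by (auto simp: doubleton_eq_iff mult_less_0_iff)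

text \<open>In the branch B all vertices but \<open>b\<close> are saturated by \<open>E2\<close>
  alone, and the deficit at \<open>b\<close> must come over the cut edge.\<close>

lemma pos_flow_cut:
  assumes T1: "graph_tree A E1" and T2: "graph_tree B E2"
    and AB: "A \<inter> B = {}" "w \<in> A" "b \<in> B"
    and nz: "x b \<noteq> 0" and bip: "sign_bipartite x (insert {w, b} (E1 \<union> E2))"
    and flow: "pos_flow x (A \<union> B - {w}) (insert {w, b} (E1 \<union> E2)) g"
  shows "g {w, b} = sgn (x b) * sum x B"
    and "pos_flow x (A - {w}) E1 g" "pos_flow x (B - {b}) E2 g"
proof -
  note inc = join_incident[OF T1 T2 AB]
  have fin: "finite E2" using T2 by (rule graph_tree_finite_edges)
  show f1: "pos_flow x (A - {w}) E1 g"
    unfolding pos_flow_def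
  proof (intro conjI ballI)
    fix v assume v: "v \<in> A - {w}"
    show "(\<Sum>e | e \<in> E1 \<and> v \<in> e. g e) = \<bar>x v\<bar>"
      using flow v unfolding inc(1)[OF v, symmetric] by (auto simp: pos_flow_def)
  qed (use flow in \<open>auto simp: pos_flow_def\<close>)
  show f2: "pos_flow x (B - {b}) E2 g"
    unfolding pos_flow_def
  proof (intro conjI ballI)
    fix v assume v: "v \<in> B - {b}"
    then have "v \<in> A \<union> B - {w}" using AB by auto
    then show "(\<Sum>e | e \<in> E2 \<and> v \<in> e. g e) = \<bar>x v\<bar>"
      using flow unfolding inc(2)[OF v, symmetric] by (auto simp: pos_flow_def)
  qed (use flow in \<open>auto simp: pos_flow_def\<close>)
  have bip2: "sign_bipartite x E2" using bip by (auto simp: sign_bipartite_def)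
  have "(\<Sum>e | e \<in> E2 \<and> b \<in> e. g e) = \<bar>x b\<bar> - sgn (x b) * sum x B"
    by (rule flow_at_root[OF graph_tree_finite[OF T2] AB(3) _ bip2 f2 nz])
      (use graph_tree_edge[OF T2] in auto)
  moreover have "(\<Sum>e | e \<in> insert {w, b} (E1 \<union> E2) \<and> b \<in> e. g e) = \<bar>x b\<bar>"
    using flow AB by (auto simp: pos_flow_def)
  then have "g {w, b} + (\<Sum>e | e \<in> E2 \<and> b \<in> e. g e) = \<bar>x b\<bar>"
    unfolding inc(4) using inc(6) fin by simp
  ultimately show "g {w, b} = sgn (x b) * sum x B" by simp
qed

text \<open>The flow on the joining edge is forced by \<open>pos_flow_cut\<close>, so solvability
  splits into the two halves and the positivity of this one value.\<close>

lemma feasible_join: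
  assumes T1: "graph_tree A E1" and T2: "graph_tree B E2"
    and AB: "A \<inter> B = {}" "w \<in> A" "b \<in> B" and nz: "x b \<noteq> 0"
  shows "feasible x (A \<union> B - {w}) (insert {w, b} (E1 \<union> E2)) \<longleftrightarrow>
    feasible x (A - {w}) E1 \<and> feasible x (B - {b}) E2 \<and> x w * x b < 0 \<and> 0 < sum x B * x b"
    (is "?L \<longleftrightarrow> ?R")
proof
  assume ?L
  then obtain g where bip: "sign_bipartite x (insert {w, b} (E1 \<union> E2))"
    and flow: "pos_flow x (A \<union> B - {w}) (insert {w, b} (E1 \<union> E2)) g" by (auto simp: feasible_def)
  note cut = pos_flow_cut[OF T1 T2 AB nz bip flow]
  have "0 < g {w, b}" using flow by (auto simp: pos_flow_def)
  then have "0 < sum x B * x b" unfolding cut(1)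
    by (auto simp: sgn_if zero_less_mult_iff split: if_splits)
  moreover have "sign_bipartite x E1" "sign_bipartite x E2" "x w * x b < 0"
    using bip unfolding sign_bipartite_edge by (auto simp: sign_bipartite_def)
  ultimately show ?R using cut by (auto simp: feasible_def)
next
  assume R: ?R
  then obtain g1 g2 where g: "pos_flow x (A - {w}) E1 g1" "pos_flow x (B - {b}) E2 g2"
    and bip: "sign_bipartite x E1" "sign_bipartite x E2" by (auto simp: feasible_def)
  note inc = join_incident[OF T1 T2 AB]
  have fin: "finite E2" using T2 by (rule graph_tree_finite_edges)
  define g where "g e = (if e \<in> E1 then g1 e else if e \<in> E2 then g2 e else sgn (x b) * sum x B)" for e
  have bipE: "sign_bipartite x (insert {w, b} (E1 \<union> E2))"
    using R bip unfolding sign_bipartite_edge by (auto simp: sign_bipartite_def)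
  have g1: "(\<Sum>e | e \<in> E1 \<and> v \<in> e. g e) = (\<Sum>e | e \<in> E1 \<and> v \<in> e. g1 e)" for v
    by (rule sum.cong) (auto simp: g_def)
  have g2: "(\<Sum>e | e \<in> E2 \<and> v \<in> e. g e) = (\<Sum>e | e \<in> E2 \<and> v \<in> e. g2 e)" for v
    using inc(7) by (intro sum.cong) (auto simp: g_def)
  have gwb: "g {w, b} = sgn (x b) * sum x B" using inc by (simp add: g_def)
  have "pos_flow x (A \<union> B - {w}) (insert {w, b} (E1 \<union> E2)) g"
    unfolding pos_flow_def
  proof (intro conjI ballI)
    fix e assume "e \<in> insert {w, b} (E1 \<union> E2)"
    then show "0 < g e"
      using g R inc by (auto simp: g_def pos_flow_def sgn_if zero_less_mult_iff)
  next
    fix v assume "v \<in> A \<union> B - {w}"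
    then consider "v \<in> A - {w}" | "v \<in> B - {b}" | "v = b" by blast
    then show "(\<Sum>e | e \<in> insert {w, b} (E1 \<union> E2) \<and> v \<in> e. g e) = \<bar>x v\<bar>"
    proof cases
      case 1
      then show ?thesis using g unfolding inc(1)[OF 1] g1 by (auto simp: pos_flow_def)
    next
      case 2
      then show ?thesis using g unfolding inc(2)[OF 2] g2 by (auto simp: pos_flow_def)
    next
      case 3
      have "(\<Sum>e | e \<in> E2 \<and> b \<in> e. g2 e) = \<bar>x b\<bar> - sgn (x b) * sum x B"
        by (rule flow_at_root[OF graph_tree_finite[OF T2] AB(3) _ bip(2) g(2) nz])
          (use graph_tree_edge[OF T2] in auto)
      then have "g {w, b} + (\<Sum>e | e \<in> E2 \<and> b \<in> e. g e) = \<bar>x b\<bar>" unfolding gwb g2 by simp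
      then show ?thesis unfolding 3 inc(4) using inc(6) fin by simp
    qed
  qed
  then show ?L using bipE by (auto simp: feasible_def)
qed

text \<open>Every edge of a tree is a cut edge, so its flow can be read off from one side.\<close>

lemma pos_flow_unique:
  assumes T: "graph_tree V E" and nz: "\<And>v. v \<in> V \<Longrightarrow> x v \<noteq> 0" and bip: "sign_bipartite x E"
    and flow: "pos_flow x V E g" "pos_flow x V E g'" and e: "e \<in> E"
  shows "g e = g' e"
proof -
  obtain w b where wb: "e = {w, b}" using bip e by (auto simp: sign_bipartite_def)
  define B where "B = branch E w b"
  have e': "{w, b} \<in> E" using e wb by simp
  note s = graph_tree_split[OF T e', folded B_def]
  have d: "(V - B) \<inter> B = {}" "w \<in> V - B" "b \<in> B"
    and V: "V - B \<union> B = V" using s(1,2) graph_tree_edge[OF T e'] by auto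
  have "h e = sgn (x b) * sum x B" if "pos_flow x V E h" for h
    unfolding wb
    by (rule pos_flow_cut(1)[OF s(3,4) d, unfolded V s(5)[symmetric]])
      (use that nz bip graph_tree_edge[OF T e'] in \<open>auto simp: pos_flow_def\<close>)
  from this[OF flow(1)] this[OF flow(2)] show ?thesis by simp
qed

section \<open>Weighted counts of planted trees\<close>

abbreviation vdeg :: "'a set set \<Rightarrow> 'a \<Rightarrow> nat" where
  "vdeg E v \<equiv> card {e \<in> E. v \<in> e}"

text \<open>Counts planted trees with a rotation at each vertex: the stem at \<open>r\<close> opens
  the cyclic order there into one of (deg r)! linear orders. The flow on the stem is free; its sign
  is imposed afterwards through \<open>restr\<close>.\<close>

definition rooted_weight :: "('a \<Rightarrow> int) \<Rightarrow> 'a set \<Rightarrow> 'a \<Rightarrow> real" where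
  "rooted_weight x V r = (\<Sum>E | graph_tree V E.
     if feasible x (V - {r}) E then fact (vdeg E r) * (\<Prod>v\<in>V - {r}. fact (vdeg E v - 1)) else 0)"

lemma rooted_weight_uminus: "rooted_weight (\<lambda>v. - x v) = rooted_weight x"
  by (simp add: rooted_weight_def feasible_uminus fun_eq_iff)

lemma rooted_weight_singleton: "rooted_weight x {r} r = 1"
  by (simp add: rooted_weight_def graph_tree_singleton feasible_def sign_bipartite_def pos_flow_def)

lemma vdeg_eq_card_neighbours:
  assumes "graph_tree V E"
  shows "card {b. {r, b} \<in> E} = vdeg E r"
proof -
  have "bij_betw (\<lambda>b. {r, b}) {b. {r, b} \<in> E} {e \<in> E. r \<in> e}"
  proof (rule bij_betw_imageI)
    show "(\<lambda>b. {r, b}) ` {b. {r, b} \<in> E} = {e \<in> E. r \<in> e}"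
    proof (intro equalityI subsetI)
      fix e assume e: "e \<in> {e \<in> E. r \<in> e}"
      then have "card e = 2" using graph_tree_edge[OF assms] by auto
      then obtain b where "e = {r, b}" using e by (auto simp: card_2_iff insert_commute)
      then show "e \<in> (\<lambda>b. {r, b}) ` {b. {r, b} \<in> E}" using e by auto
    qed auto
  qed (auto simp: inj_on_def doubleton_eq_iff)
  then show ?thesis by (rule bij_betw_same_card)
qed

text \<open>The number of rotation systems of the tree: d edges at a vertex have (d - 1)! cyclic
  orders.\<close>

definition cyclic_weight :: "'a set \<Rightarrow> 'a set set \<Rightarrow> real" where
  "cyclic_weight V E = (\<Prod>v\<in>V. fact (vdeg E v - 1))"

text \<open>The factor \<open>vdeg E r\<close> marks an edge at \<open>r\<close>. Cutting it lowers
  the degree by one at both ends, so that (d - 1)! becomes the factorial of the new degree, as it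
  should be at a planted root.\<close>

lemma rooted_weight_split:
  assumes V: "finite V" "r \<in> V" and nz: "\<And>v. v \<in> V \<Longrightarrow> x v \<noteq> 0"
  shows "(\<Sum>E | graph_tree V E. if feasible x (V - {r}) E then real (vdeg E r) * cyclic_weight V E else 0) =
    (\<Sum>B | B \<subseteq> V - {r}. \<Sum>b\<in>B. if x r * x b < 0 \<and> 0 < sum x B * x b
       then rooted_weight x (V - B) r * rooted_weight x B b else 0)"
proof -
  let ?F = "\<lambda>E b. if feasible x (V - {r}) E then cyclic_weight V E else 0"
  let ?f = "\<lambda>V r E. if feasible x (V - {r}) E then fact (vdeg E r) * (\<Prod>v\<in>V - {r}. fact (vdeg E v - 1)) else (0::real)"
  have "(\<Sum>E | graph_tree V E. if feasible x (V - {r}) E then real (vdeg E r) * cyclic_weight V E else 0) =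
    (\<Sum>E | graph_tree V E. \<Sum>b | {r, b} \<in> E. ?F E b)"
    by (intro sum.cong refl) (simp add: vdeg_eq_card_neighbours)
  also have "\<dots> = (\<Sum>B | B \<subseteq> V - {r}. \<Sum>b\<in>B. \<Sum>E1 | graph_tree (V - B) E1. \<Sum>E2 | graph_tree B E2.
       ?F (insert {r, b} (E1 \<union> E2)) b)"
    by (rule sum_edge_split[OF V])
  also have "\<dots> = (\<Sum>B | B \<subseteq> V - {r}. \<Sum>b\<in>B. \<Sum>E1 | graph_tree (V - B) E1. \<Sum>E2 | graph_tree B E2.
       if x r * x b < 0 \<and> 0 < sum x B * x b then ?f (V - B) r E1 * ?f B b E2 else 0)"
  proof (intro sum.cong refl)
    fix B b E1 E2
    assume "B \<in> {B. B \<subseteq> V - {r}}" and b: "b \<in> B" and "E1 \<in> {E1. graph_tree (V - B) E1}"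
      "E2 \<in> {E2. graph_tree B E2}"
    then have B: "B \<subseteq> V - {r}" and T1: "graph_tree (V - B) E1" and T2: "graph_tree B E2" by auto
    have d: "(V - B) \<inter> B = {}" "r \<in> V - B" and VB: "V - B \<union> B = V" using B V by auto
    let ?E = "insert {r, b} (E1 \<union> E2)"
    note inc = join_incident[OF T1 T2 d b]
    have feas: "feasible x (V - {r}) ?E \<longleftrightarrow>
      feasible x (V - B - {r}) E1 \<and> feasible x (B - {b}) E2 \<and> x r * x b < 0 \<and> 0 < sum x B * x b"
      using feasible_join[OF T1 T2 d b, of x, unfolded VB] nz B b by auto
    have fin: "finite E1" "finite E2" using T1 T2 by (auto dest: graph_tree_finite_edges)
    have degr: "vdeg ?E r = Suc (vdeg E1 r)" unfolding inc(3) using inc(5) fin by simp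
    have degb: "vdeg ?E b = Suc (vdeg E2 b)" unfolding inc(4) using inc(6) fin by simp
    have finV: "finite (V - B)" "finite B" using V B finite_subset by auto
    have "cyclic_weight V ?E = (\<Prod>v\<in>V - B. fact (vdeg ?E v - 1)) * (\<Prod>v\<in>B. fact (vdeg ?E v - 1))"
      unfolding cyclic_weight_def using finV d by (subst VB[symmetric], subst prod.union_disjoint) auto
    also have "(\<Prod>v\<in>V - B. fact (vdeg ?E v - 1)) =
        (fact (vdeg E1 r) * (\<Prod>v\<in>V - B - {r}. fact (vdeg E1 v - 1)) :: real)"
    proof -
      have "(\<Prod>v\<in>V - B - {r}. fact (vdeg ?E v - 1)) = (\<Prod>v\<in>V - B - {r}. fact (vdeg E1 v - 1) :: real)"
        by (intro prod.cong refl) (simp only: inc(1))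
      then show ?thesis using prod.remove[OF finV(1) d(2), of "\<lambda>v. fact (vdeg ?E v - 1) :: real"] degr by simp
    qed
    also have "(\<Prod>v\<in>B. fact (vdeg ?E v - 1)) =
        (fact (vdeg E2 b) * (\<Prod>v\<in>B - {b}. fact (vdeg E2 v - 1)) :: real)"
    proof -
      have "(\<Prod>v\<in>B - {b}. fact (vdeg ?E v - 1)) = (\<Prod>v\<in>B - {b}. fact (vdeg E2 v - 1) :: real)"
        by (intro prod.cong refl) (simp only: inc(2))
      then show ?thesis using prod.remove[OF finV(2) b, of "\<lambda>v. fact (vdeg ?E v - 1) :: real"] degb by simp
    qed
    finally have cw: "cyclic_weight V ?E = fact (vdeg E1 r) * (\<Prod>v\<in>V - B - {r}. fact (vdeg E1 v - 1)) *
        (fact (vdeg E2 b) * (\<Prod>v\<in>B - {b}. fact (vdeg E2 v - 1)))" .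
    show "?F ?E b = (if x r * x b < 0 \<and> 0 < sum x B * x b then ?f (V - B) r E1 * ?f B b E2 else 0)"
      unfolding feas cw by simp
  qed
  also have "\<dots> = (\<Sum>B | B \<subseteq> V - {r}. \<Sum>b\<in>B. if x r * x b < 0 \<and> 0 < sum x B * x b
       then rooted_weight x (V - B) r * rooted_weight x B b else 0)"
  proof (intro sum.cong refl)
    fix B b
    show "(\<Sum>E1 | graph_tree (V - B) E1. \<Sum>E2 | graph_tree B E2.
       if x r * x b < 0 \<and> 0 < sum x B * x b then ?f (V - B) r E1 * ?f B b E2 else 0) =
      (if x r * x b < 0 \<and> 0 < sum x B * x b then rooted_weight x (V - B) r * rooted_weight x B b else 0)"
      by (cases "x r * x b < 0 \<and> 0 < sum x B * x b") (simp_all only: rooted_weight_def sum_product if_True if_False sum.neutral_const simp_thms)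
  qed
  finally show ?thesis .
qed

text \<open>Splits off one branch at the root, say the first in its linear order. The identity d! =
  d (d - 1)! behind it requires d > 0, hence the exclusion of the single vertex.\<close>

lemma rooted_weight_rec:
  assumes V: "finite V" "r \<in> V" "V \<noteq> {r}" and nz: "\<And>v. v \<in> V \<Longrightarrow> x v \<noteq> 0"
  shows "rooted_weight x V r =
    (\<Sum>B | B \<subseteq> V - {r}. \<Sum>b\<in>B. if x r * x b < 0 \<and> 0 < sum x B * x b
       then rooted_weight x (V - B) r * rooted_weight x B b else 0)"
proof -
  have "rooted_weight x V r =
    (\<Sum>E | graph_tree V E. if feasible x (V - {r}) E then real (vdeg E r) * cyclic_weight V E else 0)"
    unfolding rooted_weight_def
  proof (intro sum.cong refl if_cong)
    fix E assume "E \<in> {E. graph_tree V E}"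
    then have T: "graph_tree V E" by simp
    obtain b where "{r, b} \<in> E" using graph_tree_edge_at[OF T] V by blast
    then have "vdeg E r \<noteq> 0" using graph_tree_finite_edges[OF T] by auto
    then obtain d where d: "vdeg E r = Suc d" by (cases "vdeg E r") auto
    show "fact (vdeg E r) * (\<Prod>v\<in>V - {r}. fact (vdeg E v - 1)) = real (vdeg E r) * cyclic_weight V E"
      unfolding cyclic_weight_def prod.remove[OF V(1,2)] d by simp
  qed
  also note rooted_weight_split[OF V(1,2) nz]
  finally show ?thesis .
qed

definition planted_gf :: "('a \<Rightarrow> int) \<Rightarrow> 'a sfun" where
  "planted_gf x = sfun (\<lambda>S. \<Sum>r | r \<in> S \<and> 0 < x r. rooted_weight x S r)"

text \<open>A branch hanging from a white root has a black root, hence \<open>- x\<close> in the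
  last factor, and it needs a negative total for its edge to carry positive flow.\<close>

lemma planted_gf_rec:
  assumes nz: "\<And>v. x v \<noteq> 0"
  shows "planted_gf x = pos_point_gf x + planted_gf x * restr (\<lambda>S. sum x S < 0) (planted_gf (\<lambda>v. - x v))"
proof (rule sfun_eqI)
  fix S :: "'a set" assume S: "finite S"
  let ?K = "restr (\<lambda>S. sum x S < 0) (planted_gf (\<lambda>v. - x v))"
  have K: "coef ?K B = (if sum x B < 0 then \<Sum>b | b \<in> B \<and> x b < 0. rooted_weight x B b else 0)"
    if "finite B" for B
    using that by (simp add: planted_gf_def rooted_weight_uminus)
  have inner: "(\<Sum>b\<in>B. if x r * x b < 0 \<and> 0 < sum x B * x b
       then rooted_weight x (S - B) r * rooted_weight x B b else 0) =
       rooted_weight x (S - B) r * coef ?K B" if "0 < x r" "finite B" for r B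
  proof -
    have "(\<Sum>b\<in>B. if x r * x b < 0 \<and> 0 < sum x B * x b
       then rooted_weight x (S - B) r * rooted_weight x B b else 0) =
       (\<Sum>b | b \<in> B \<and> x b < 0. if sum x B < 0 then rooted_weight x (S - B) r * rooted_weight x B b else 0)"
      using that by (intro sum.mono_neutral_cong_right) (auto simp: mult_less_0_iff zero_less_mult_iff)
    also have "\<dots> = rooted_weight x (S - B) r * coef ?K B"
      unfolding K[OF that(2)] by (simp add: sum_distrib_left)
    finally show ?thesis .
  qed
  have "coef (planted_gf x * ?K) S = coef (?K * planted_gf x) S" by (simp only: mult.commute)
  also have "\<dots> = (\<Sum>B\<in>Pow S. \<Sum>r | r \<in> S - B \<and> 0 < x r. rooted_weight x (S - B) r * coef ?K B)"
    unfolding coef_mult using S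
    by (intro sum.cong refl) (simp add: planted_gf_def sum_distrib_left mult.commute)
  also have "\<dots> = (\<Sum>B\<in>Pow S. \<Sum>r | r \<in> {r \<in> S. 0 < x r} \<and> r \<notin> B. rooted_weight x (S - B) r * coef ?K B)"
    by (intro sum.cong) auto
  also have "\<dots> = (\<Sum>r | r \<in> S \<and> 0 < x r. \<Sum>B | B \<in> Pow S \<and> r \<notin> B. rooted_weight x (S - B) r * coef ?K B)"
    using S by (subst sum.swap_restrict) auto
  \<comment> \<open>The correction by 1 is for the single vertex, from which no branch can be split
    off.\<close>
  also have "\<dots> = (\<Sum>r | r \<in> S \<and> 0 < x r. rooted_weight x S r - (if S = {r} then 1 else 0))"
  proof (intro sum.cong refl)
    fix r assume "r \<in> {r. r \<in> S \<and> 0 < x r}"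
    then have r: "r \<in> S" "0 < x r" by auto
    have sub: "{B. B \<in> Pow S \<and> r \<notin> B} = {B. B \<subseteq> S - {r}}" by auto
    show "(\<Sum>B | B \<in> Pow S \<and> r \<notin> B. rooted_weight x (S - B) r * coef ?K B) =
        rooted_weight x S r - (if S = {r} then 1 else 0)"
    proof (cases "S = {r}")
      case True
      have "{B. B \<in> Pow S \<and> r \<notin> B} = {{}}" using True by auto
      then show ?thesis using True by (simp add: rooted_weight_singleton K del: coef_restr)
    next
      case False
      then have "rooted_weight x S r = (\<Sum>B | B \<subseteq> S - {r}. rooted_weight x (S - B) r * coef ?K B)"
        unfolding rooted_weight_rec[OF S r(1) False nz] using S r
        by (intro sum.cong refl inner) (auto intro: finite_subset)
      then show ?thesis using False unfolding sub by simp
    qed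
  qed
  also have "\<dots> = coef (planted_gf x) S - coef (pos_point_gf x) S"
  proof -
    have "(\<Sum>r | r \<in> S \<and> 0 < x r. if S = {r} then 1 else 0) = coef (pos_point_gf x) S"
    proof (cases "\<exists>w. S = {w} \<and> 0 < x w")
      case True
      then obtain w where w: "S = {w}" "0 < x w" by blast
      then have "{r. r \<in> S \<and> 0 < x r} = {w}" by auto
      then show ?thesis using w by (auto simp: coef_pos_point_gf)
    next
      case False
      then have "(\<Sum>r | r \<in> S \<and> 0 < x r. if S = {r} then 1 else 0) = (0::real)"
        by (intro sum.neutral) auto
      then show ?thesis unfolding coef_pos_point_gf using False by auto
    qed
    then show ?thesis using S by (simp add: sum_subtractf planted_gf_def)
  qed
  finally show "coef (planted_gf x) S = coef (pos_point_gf x + planted_gf x * ?K) S" by simp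
qed

text \<open>Both factors vanish at the empty set, the second because an empty total is not negative.
  So the product at S involves only proper subsets, and induction works for \<open>x\<close> and
  \<open>- x\<close> simultaneously.\<close>

lemma restr_recursion_unique:
  assumes f: "\<And>x. P x \<Longrightarrow> f x = c x + f x * restr (\<lambda>S. sum x S < 0) (f (\<lambda>v. - x v))"
    and g: "\<And>x. P x \<Longrightarrow> g x = c x + g x * restr (\<lambda>S. sum x S < 0) (g (\<lambda>v. - x v))"
    and f0: "\<And>x. P x \<Longrightarrow> coef (f x) {} = 0" and g0: "\<And>x. P x \<Longrightarrow> coef (g x) {} = 0"
    and P: "\<And>x. P x \<Longrightarrow> P (\<lambda>v. - x v)" and Px: "P (x :: 'a \<Rightarrow> int)"
  shows "f x = g x"
proof (rule sfun_eqI)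
  fix S :: "'a set" assume "finite S"
  then show "coef (f x) S = coef (g x) S" using Px
  proof (induction S arbitrary: x rule: finite_psubset_induct)
    case (psubset S)
    note x = psubset.prems and x' = P[OF psubset.prems]
    have "coef (f x) A * coef (restr (\<lambda>S. sum x S < 0) (f (\<lambda>v. - x v))) (S - A) =
        coef (g x) A * coef (restr (\<lambda>S. sum x S < 0) (g (\<lambda>v. - x v))) (S - A)" if A: "A \<subseteq> S" for A
    proof -
      consider "A = {}" | "A = S" | "A \<subset> S" "S - A \<subset> S" using A by blast
      then show ?thesis
      proof cases
        case 3
        then show ?thesis using psubset.IH[OF 3(1) x] psubset.IH[OF 3(2) x'] by simp
      qed (simp_all add: f0 g0 x x')
    qed
    then show ?case
      by (subst f[OF x], subst g[OF x], simp add: coef_mult del: coef_restr)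
  qed
qed

text \<open>Attached sets have total 0, so the total tested by Q is the same before and after the
  substitution.\<close>

lemma twist_restr:
  assumes "\<And>S. coef D S \<noteq> 0 \<Longrightarrow> sum x S = 0" and Q: "\<And>S. Q S \<longleftrightarrow> R (sum (x :: 'a \<Rightarrow> int) S)"
  shows "twist D (restr Q f) = restr Q (twist D f)"
proof (rule sfun_eqI)
  fix S :: "'a set" assume S: "finite S"
  have pw: "sum x S = 0" if "coef (D ^ n) S \<noteq> 0" for n S
    using that
  proof (induction n arbitrary: S)
    case (Suc n)
    then obtain A where A: "A \<subseteq> S" "coef D A \<noteq> 0" "coef (D ^ n) (S - A) \<noteq> 0"
      unfolding power_Suc coef_mult by (metis (no_types, lifting) PowD mult_eq_0_iff sum.neutral)
    have "finite S" using Suc.prems coef_infinite by blast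
    then show ?case using A assms(1) Suc.IH sum.subset_diff[of A S x] by auto
  qed (auto split: if_splits)
  have "coef (restr Q f) A * coef (D ^ card A) (S - A) =
      (if Q S then coef f A * coef (D ^ card A) (S - A) else 0)" if "A \<subseteq> S" for A
  proof (cases "coef (D ^ card A) (S - A) = 0")
    case False
    then have "sum x A = sum x S" using pw S that sum.subset_diff[of A S x] by fastforce
    then show ?thesis by (simp add: Q)
  qed simp
  then show "coef (twist D (restr Q f)) S = coef (restr Q (twist D f)) S"
    by (auto simp: coef_twist simp del: coef_restr intro!: sum.cong) (auto simp: coef_twist intro!: sum.cong)
qed

lemma twist_point:
  "twist D (pos_point_gf x) = pos_point_gf x * D"
proof (rule sfun_eqI)
  fix S :: "'a set"
  have "coef (pos_point_gf x) A * coef (D ^ card A) (S - A) = coef (pos_point_gf x) A * coef D (S - A)" for A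
    by (auto simp: coef_pos_point_gf)
  from sum.cong[OF refl this]
  show "coef (twist D (pos_point_gf x)) S = coef (pos_point_gf x * D) S"
    unfolding coef_twist coef_mult .
qed

text \<open>The comparison of trees with words. The left side inherits the recursion of
  \<open>planted_gf_rec\<close> because \<open>twist\<close> is multiplicative; the right side
  satisfies the same one by \<open>prefix_gf_decomp\<close> at \<open>- x\<close>.\<close>

lemma twist_planted_gf:
  assumes nz: "\<And>v. x v \<noteq> 0"
  shows "twist (dyck_gf x) (planted_gf x) = pos_point_gf x * prefix_gf (\<lambda>v. - x v)"
proof (rule restr_recursion_unique[where P = "\<lambda>x. \<forall>v. x v \<noteq> 0" and
    f = "\<lambda>x. twist (dyck_gf x) (planted_gf x)" and g = "\<lambda>x. pos_point_gf x * prefix_gf (\<lambda>v. - x v)" and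
    c = "\<lambda>x. pos_point_gf x * dyck_gf x"])
  fix x :: "'a \<Rightarrow> int" assume x: "\<forall>v. x v \<noteq> 0"
  have "twist (dyck_gf x) (planted_gf x) = twist (dyck_gf x) (pos_point_gf x) +
      twist (dyck_gf x) (planted_gf x) *
      twist (dyck_gf x) (restr (\<lambda>S. sum x S < 0) (planted_gf (\<lambda>v. - x v)))"
    by (subst planted_gf_rec) (use x in \<open>simp_all add: twist_add twist_mult\<close>)
  also have "twist (dyck_gf x) (restr (\<lambda>S. sum x S < 0) (planted_gf (\<lambda>v. - x v))) =
      restr (\<lambda>S. sum x S < 0) (twist (dyck_gf (\<lambda>v. - x v)) (planted_gf (\<lambda>v. - x v)))"
    unfolding dyck_gf_uminus by (rule twist_restr[where R = "\<lambda>n. n < 0"]) (auto dest: coef_dyck_gf_nonzero)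
  finally show "twist (dyck_gf x) (planted_gf x) = pos_point_gf x * dyck_gf x +
      twist (dyck_gf x) (planted_gf x) *
      restr (\<lambda>S. sum x S < 0) (twist (dyck_gf (\<lambda>v. - x v)) (planted_gf (\<lambda>v. - x v)))"
    unfolding twist_point .
  have "(\<lambda>S. 0 < sum (\<lambda>v. - x v) S) = (\<lambda>S. sum x S < 0)" by (simp add: sum_negf fun_eq_iff)
  then have "prefix_gf (\<lambda>v. - x v) = dyck_gf x + prefix_gf (\<lambda>v. - x v) *
      restr (\<lambda>S. sum x S < 0) (pos_point_gf (\<lambda>v. - x v) * prefix_gf x)"
    using prefix_gf_decomp[of "\<lambda>v. - x v"] by (simp add: dyck_gf_uminus)
  then have "pos_point_gf x * prefix_gf (\<lambda>v. - x v) = pos_point_gf x * (dyck_gf x + prefix_gf (\<lambda>v. - x v) *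
      restr (\<lambda>S. sum x S < 0) (pos_point_gf (\<lambda>v. - x v) * prefix_gf x))" by (rule arg_cong)
  then show "pos_point_gf x * prefix_gf (\<lambda>v. - x v) = pos_point_gf x * dyck_gf x +
      pos_point_gf x * prefix_gf (\<lambda>v. - x v) *
      restr (\<lambda>S. sum x S < 0) (pos_point_gf (\<lambda>v. - x v) * prefix_gf (\<lambda>v. - (- x v)))"
    by (rule trans) (simp add: distrib_left mult.assoc)
qed (auto simp: coef_twist coef_pos_point_gf planted_gf_def nz)

definition tree_weight :: "('a \<Rightarrow> int) \<Rightarrow> 'a set \<Rightarrow> real" where
  "tree_weight x V = (\<Sum>E | graph_tree V E. if feasible x V E then cyclic_weight V E else 0)"

text \<open>A white and a black planted tree glued along their stems form a tree with a marked edge.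
  Balance makes the two totals opposite, so the sign conditions agree. Each edge has one white end,
  so the white degrees add up to the number of edges.\<close>

lemma edge_rooted_gf:
  assumes V: "finite V" and bal: "sum x V = 0" and nz: "\<And>v. x v \<noteq> 0"
  shows "coef (restr (\<lambda>S. 0 < sum x S) (planted_gf x) * restr (\<lambda>S. sum x S < 0) (planted_gf (\<lambda>v. - x v))) V =
    real (card V - 1) * tree_weight x V"
proof -
  let ?K = "restr (\<lambda>S. sum x S < 0) (planted_gf (\<lambda>v. - x v))"
  let ?W = "restr (\<lambda>S. 0 < sum x S) (planted_gf x)"
  have K: "coef ?K B = (if sum x B < 0 then \<Sum>b | b \<in> B \<and> x b < 0. rooted_weight x B b else 0)"
    if "finite B" for B
    using that by (simp add: planted_gf_def rooted_weight_uminus)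
  have "coef (?W * ?K) V = coef (?K * ?W) V" by (simp only: mult.commute)
  also have "\<dots> = (\<Sum>B\<in>Pow V. \<Sum>r | r \<in> {r \<in> V. 0 < x r} \<and> r \<notin> B. rooted_weight x (V - B) r * coef ?K B)"
    unfolding coef_mult
  proof (intro sum.cong refl)
    fix B assume B: "B \<in> Pow V"
    then have fB: "finite B" using V finite_subset by auto
    have "{r. r \<in> {r \<in> V. 0 < x r} \<and> r \<notin> B} = {r. r \<in> V - B \<and> 0 < x r}" by auto
    moreover have "sum x B < 0 \<Longrightarrow> 0 < sum x (V - B)"
      using sum.subset_diff[of B V x] B V bal by auto
    ultimately show "coef ?K B * coef ?W (V - B) =
      (\<Sum>r | r \<in> {r \<in> V. 0 < x r} \<and> r \<notin> B. rooted_weight x (V - B) r * coef ?K B)"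
      unfolding K[OF fB] using V
      by (cases "sum x B < 0") (simp_all add: planted_gf_def sum_distrib_right sum_distrib_left mult.commute)
  qed
  also have "\<dots> = (\<Sum>r | r \<in> V \<and> 0 < x r. \<Sum>B | B \<in> Pow V \<and> r \<notin> B. rooted_weight x (V - B) r * coef ?K B)"
    using V by (subst sum.swap_restrict) auto
  also have "\<dots> = (\<Sum>r | r \<in> V \<and> 0 < x r. \<Sum>E | graph_tree V E.
      if feasible x V E then real (vdeg E r) * cyclic_weight V E else 0)"
  proof (intro sum.cong refl)
    fix r assume "r \<in> {r. r \<in> V \<and> 0 < x r}"
    then have r: "r \<in> V" "0 < x r" by auto
    \<comment> \<open>In a balanced set the exempted vertex is saturated automatically.\<close>
    have feas: "feasible x V E \<longleftrightarrow> feasible x (V - {r}) E" if "graph_tree V E" for E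
      using pos_flow_balanced[OF V r(1) _ _ nz bal] graph_tree_edge[OF that]
      unfolding feasible_def by blast
    have sub: "{B. B \<in> Pow V \<and> r \<notin> B} = {B. B \<subseteq> V - {r}}" by auto
    have "(\<Sum>B | B \<subseteq> V - {r}. rooted_weight x (V - B) r * coef ?K B) =
       (\<Sum>B | B \<subseteq> V - {r}. \<Sum>b\<in>B. if x r * x b < 0 \<and> 0 < sum x B * x b
       then rooted_weight x (V - B) r * rooted_weight x B b else 0)"
    proof (intro sum.cong refl)
      fix B assume "B \<in> {B. B \<subseteq> V - {r}}"
      then have fB: "finite B" using V finite_subset by auto
      have "(\<Sum>b\<in>B. if x r * x b < 0 \<and> 0 < sum x B * x b
         then rooted_weight x (V - B) r * rooted_weight x B b else 0) =
         (\<Sum>b | b \<in> B \<and> x b < 0. if sum x B < 0 then rooted_weight x (V - B) r * rooted_weight x B b else 0)"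
        using fB r by (intro sum.mono_neutral_cong_right) (auto simp: mult_less_0_iff zero_less_mult_iff)
      then show "rooted_weight x (V - B) r * coef ?K B = (\<Sum>b\<in>B. if x r * x b < 0 \<and> 0 < sum x B * x b
         then rooted_weight x (V - B) r * rooted_weight x B b else 0)"
        unfolding K[OF fB] by (simp add: sum_distrib_left)
    qed
    also have "\<dots> = (\<Sum>E | graph_tree V E. if feasible x (V - {r}) E then real (vdeg E r) * cyclic_weight V E else 0)"
      by (rule rooted_weight_split[symmetric]) (use V r nz in auto)
    also have "\<dots> = (\<Sum>E | graph_tree V E. if feasible x V E then real (vdeg E r) * cyclic_weight V E else 0)"
      by (intro sum.cong refl) (simp add: feas)
    finally show "(\<Sum>B | B \<in> Pow V \<and> r \<notin> B. rooted_weight x (V - B) r * coef ?K B) =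
      (\<Sum>E | graph_tree V E. if feasible x V E then real (vdeg E r) * cyclic_weight V E else 0)"
      unfolding sub .
  qed
  also have "\<dots> = (\<Sum>E | graph_tree V E. \<Sum>r | r \<in> V \<and> 0 < x r.
      if feasible x V E then real (vdeg E r) * cyclic_weight V E else 0)"
    by (rule sum.swap)
  also have "\<dots> = (\<Sum>E | graph_tree V E. if feasible x V E then real (card V - 1) * cyclic_weight V E else 0)"
  proof (intro sum.cong refl)
    fix E assume "E \<in> {E. graph_tree V E}"
    then have T: "graph_tree V E" by simp
    have fE: "finite E" using T by (rule graph_tree_finite_edges)
    have "(\<Sum>r | r \<in> V \<and> 0 < x r. vdeg E r) = card V - 1" if "feasible x V E"
    proof -
      have bip: "sign_bipartite x E" using that by (simp add: feasible_def)
      have "(\<Sum>r | r \<in> V \<and> 0 < x r. vdeg E r) = (\<Sum>r | r \<in> V \<and> 0 < x r. \<Sum>e | e \<in> E \<and> r \<in> e. 1)" by simp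
      also have "\<dots> = (\<Sum>e\<in>E. \<Sum>r | r \<in> {r. r \<in> V \<and> 0 < x r} \<and> r \<in> e. 1)"
        using V fE by (intro sum.swap_restrict) auto
      also have "\<dots> = (\<Sum>e\<in>E. 1)"
      proof (intro sum.cong refl)
        fix e assume e: "e \<in> E"
        then obtain w b where wb: "e = {w, b}" "0 < x w" "x b < 0" using bip by (auto simp: sign_bipartite_def)
        then have "{r. r \<in> {r. r \<in> V \<and> 0 < x r} \<and> r \<in> e} = {w}" using graph_tree_edge[OF T e] by auto
        then show "(\<Sum>r | r \<in> {r. r \<in> V \<and> 0 < x r} \<and> r \<in> e. 1) = (1::nat)" by simp
      qed
      finally show ?thesis using graph_tree_card[OF T] by simp
    qed
    then show "(\<Sum>r | r \<in> V \<and> 0 < x r. if feasible x V E then real (vdeg E r) * cyclic_weight V E else 0) =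
       (if feasible x V E then real (card V - 1) * cyclic_weight V E else 0)"
      by (auto simp: sum_distrib_right[symmetric] of_nat_sum[symmetric] simp del: of_nat_sum)
  qed
  also have "\<dots> = real (card V - 1) * tree_weight x V"
    by (simp add: tree_weight_def sum_distrib_left if_distrib cong: if_cong)
  finally show ?thesis .
qed

text \<open>One factor is the choice of an edge in \<open>edge_rooted_gf\<close>, the other comes
  from \<open>lagrange_inversion\<close>.\<close>

lemma tree_weight_formula:
  assumes V: "finite V" "2 \<le> card V" and bal: "sum x V = 0" and nz: "\<And>v. x v \<noteq> 0"
  shows "real (card V - 1) * (real (card V - 1) * tree_weight x V) =
     - (\<Sum>P | partition_on V P. (- real (card V - 1)) ^ card P * (\<Prod>p\<in>P. coef (cycle_gf x) p))"
proof -
  let ?D = "dyck_gf x"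
  let ?W = "restr (\<lambda>S. 0 < sum x S) (planted_gf x)"
  let ?K = "restr (\<lambda>S. sum x S < 0) (planted_gf (\<lambda>v. - x v))"
  let ?b = "restr (\<lambda>S. sum x S = 0) (?W * ?K)"
  let ?J = "exp_coeffs (cycle_gf x) (- 1)"
  have tw: "twist ?D (restr Q f) = restr Q (twist ?D f)" if "\<And>S. Q S \<longleftrightarrow> R (sum x S)" for Q R f
    using twist_restr[of ?D x Q R f] coef_dyck_gf_nonzero that by blast
  have W: "twist ?D ?W = restr (\<lambda>S. 0 < sum x S) (pos_point_gf x * prefix_gf (\<lambda>v. - x v))"
    by (subst tw[where R = "\<lambda>n. 0 < n"]) (simp_all add: twist_planted_gf nz)
  have K: "twist ?D ?K = restr (\<lambda>S. sum x S < 0) (pos_point_gf (\<lambda>v. - x v) * prefix_gf x)"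
    using twist_planted_gf[of "\<lambda>v. - x v"] nz
    by (subst tw[where R = "\<lambda>n. n < 0"]) (simp_all add: dyck_gf_uminus)
  \<comment> \<open>The substitution turns the two planted factors into the two halves of a Dyck
    word, so \<open>dyck_gf_decomp\<close> becomes the functional equation to be inverted.\<close>
  have D: "?D = 1 + twist ?D ?b"
    unfolding tw[where R = "\<lambda>n. n = 0", OF refl] twist_mult W K by (rule dyck_gf_decomp[OF nz])
  have inv: "?D * ?J = 1"
    unfolding dyck_gf_eq_exp exp_coeffs_add[symmetric] by (simp add: exp_coeffs_0)
  have "coef ?b {} = 0" by simp
  moreover have "V \<noteq> {}" using V by auto
  ultimately have "real (card V - 1) * coef ?b V = - coef (?J ^ (card V - 1)) V"
    using lagrange_inversion[OF inv D _ V(1)] by blast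
  moreover have "coef ?b V = real (card V - 1) * tree_weight x V"
    using bal by (simp add: edge_rooted_gf[OF V(1) bal nz] del: coef_mult)
  \<comment> \<open>Since J = exp (- C), taking a power only rescales the exponent.\<close>
  moreover have "?J ^ (card V - 1) = exp_coeffs (cycle_gf x) (- real (card V - 1))"
    by (simp add: exp_coeffs_power)
  ultimately show ?thesis using V by (simp add: exp_coeffs_def)
qed

section \<open>Isomorphism classes of w-trees\<close>

lemma cyclic_on_orbit_list:
  assumes f: "cyclic_on f S" and a: "a \<in> S"
  shows "inj_on (\<lambda>i. (f ^^ i) a) {0..<card S}" "(\<lambda>i. (f ^^ i) a) ` {0..<card S} = S" "(f ^^ card S) a = a"
proof -
  have S: "S = orbit f a" using f a by (auto simp: cyclic_on_alldef)
  then have aa: "a \<in> orbit f a" using a by simp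
  note inj = inj_on_funpow_dist1[OF aa] and im = orbit_conv_funpow_dist1[OF aa]
  have "card S = funpow_dist1 f a a" unfolding S using card_image[OF inj] im by simp
  then show "inj_on (\<lambda>i. (f ^^ i) a) {0..<card S}" "(\<lambda>i. (f ^^ i) a) ` {0..<card S} = S" "(f ^^ card S) a = a"
    using inj im S funpow_dist1_prop[OF aa] by metis+
qed

text \<open>List S along the orbit of a fixed \<open>a\<close>: what follows \<open>a\<close> is an
  arbitrary arrangement of the rest. Extensionality lets each cyclic order count once.\<close>

lemma card_cyclic_functions:
  assumes S: "finite S" "S \<noteq> {}"
  shows "card {f \<in> S \<rightarrow>\<^sub>E S. cyclic_on f S} = fact (card S - 1)"
proof -
  obtain a where a: "a \<in> S" using S by blast
  define n where "n = card S"
  have n: "0 < n" using S by (simp add: n_def card_gt_0_iff)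
  let ?G = "\<lambda>f. map (\<lambda>i. (f ^^ i) a) [1..<n]"
  have "bij_betw ?G {f \<in> S \<rightarrow>\<^sub>E S. cyclic_on f S} (permutations_of_set (S - {a}))"
  proof (rule bij_betw_imageI)
    show "inj_on ?G {f \<in> S \<rightarrow>\<^sub>E S. cyclic_on f S}"
    proof (rule inj_onI)
      fix f f' assume f: "f \<in> {f \<in> S \<rightarrow>\<^sub>E S. cyclic_on f S}" and f': "f' \<in> {f \<in> S \<rightarrow>\<^sub>E S. cyclic_on f S}"
        and eq: "?G f = ?G f'"
      have pow: "(f ^^ i) a = (f' ^^ i) a" if i: "i \<le> n" for i
      proof -
        consider "i = 0" | "i = n" | "1 \<le> i" "i < n" using i by linarith
        then show ?thesis
        proof cases
          case 2
          then show ?thesis using f f' a cyclic_on_orbit_list(3)[of f S a] cyclic_on_orbit_list(3)[of f' S a]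
            by (simp add: n_def)
        next
          case 3
          then have "?G f ! (i - 1) = ?G f' ! (i - 1)" using eq by simp
          then show ?thesis using 3 by simp
        qed simp
      qed
      show "f = f'"
      proof (rule PiE_ext[of _ S "\<lambda>_. S"])
        fix y assume "y \<in> S"
        then obtain i where i: "i < n" "y = (f ^^ i) a"
          using cyclic_on_orbit_list(2)[of f S a] f a by (force simp: n_def)
        then show "f y = f' y" using pow[of i] pow[of "Suc i"] by simp
      qed (use f f' in auto)
    qed
    show "?G ` {f \<in> S \<rightarrow>\<^sub>E S. cyclic_on f S} = permutations_of_set (S - {a})"
    proof (intro equalityI subsetI)
      fix zs assume "zs \<in> ?G ` {f \<in> S \<rightarrow>\<^sub>E S. cyclic_on f S}"
      then obtain f where f: "cyclic_on f S" "zs = ?G f" by auto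
      note c = cyclic_on_orbit_list[OF f(1) a, folded n_def]
      have "{0..<n} = insert 0 {1..<n}" using n by auto
      then have "S = insert a ((\<lambda>i. (f ^^ i) a) ` {1..<n})" using c(2) by auto
      moreover have "a \<notin> (\<lambda>i. (f ^^ i) a) ` {1..<n}"
        using inj_onD[OF c(1), of 0] n by fastforce
      ultimately have "set zs = S - {a}" unfolding f(2) by auto
      moreover have "distinct zs" unfolding f(2) using c(1)
        by (auto simp: distinct_map intro: inj_on_subset)
      ultimately show "zs \<in> permutations_of_set (S - {a})" by (auto simp: permutations_of_set_def)
    next
      fix zs assume "zs \<in> permutations_of_set (S - {a})"
      then have zs: "distinct (a # zs)" "set (a # zs) = S" using a by (auto simp: permutations_of_set_def)
      define xs where "xs = a # zs"
      have xs: "distinct xs" "set xs = S" "length xs = n"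
        using zs distinct_card[OF zs(1)] by (auto simp: xs_def n_def)
      define idx where "idx = inv_into {..<n} ((!) xs)"
      have inj: "inj_on ((!) xs) {..<n}" using xs by (auto intro: inj_on_nth)
      have idx: "idx (xs ! i) = i" if "i < n" for i
        unfolding idx_def using inj that by (simp add: inv_into_f_f)
      define f where "f = restrict (\<lambda>y. xs ! (Suc (idx y) mod n)) S"
      have f: "f (xs ! i) = xs ! (Suc i mod n)" if "i < n" for i
        using that xs by (auto simp: f_def idx)
      have pow: "(f ^^ i) a = xs ! i" if "i < n" for i
        using that
      proof (induction i)
        case (Suc i)
        then show ?case using f[of i] by simp
      qed (simp add: xs_def)
      have nth: "\<exists>i<n. y = xs ! i" if "y \<in> S" for y
        using that xs by (metis in_set_conv_nth)
      have ext: "f \<in> S \<rightarrow>\<^sub>E S"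
      proof (rule PiE_I)
        fix y assume "y \<in> S"
        then obtain i where "i < n" "y = xs ! i" using nth by blast
        moreover have "xs ! (Suc i mod n) \<in> set xs" using n xs(3) by (intro nth_mem) simp
        ultimately show "f y \<in> S" using f xs(2) by simp
      qed (simp add: f_def)
      have loop: "(f ^^ n) a = a"
      proof -
        obtain m where m: "n = Suc m" using n by (cases n) auto
        have "(f ^^ n) a = f (xs ! m)" unfolding m using pow[of m] m by simp
        also have "\<dots> = a" using f[of m] m by (simp add: xs_def)
        finally show ?thesis .
      qed
      have "S = orbit f a"
      proof (intro equalityI subsetI)
        fix y assume "y \<in> S"
        then obtain i where "i < n" "y = xs ! i" using nth by blast
        \<comment> \<open>A full extra turn makes the exponent positive, as an orbit begins with the
          first iterate.\<close>
        then have "y = (f ^^ (i + n)) a" using pow[of i] loop by (simp add: funpow_add)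
        then show "y \<in> orbit f a" unfolding orbit_altdef using n by blast
      next
        fix y assume "y \<in> orbit f a"
        then show "y \<in> S" by induction (use a ext in auto)
      qed
      then have mem: "f \<in> {f \<in> S \<rightarrow>\<^sub>E S. cyclic_on f S}" using ext a by (auto simp: cyclic_on_def)
      have G: "?G f = map ((!) xs) [1..<n]" using pow by (intro map_cong refl) simp
      have Z: "map ((!) xs) [1..<n] = zs" using xs(3) by (intro nth_equalityI) (auto simp: xs_def)
      show "zs \<in> ?G ` {f \<in> S \<rightarrow>\<^sub>E S. cyclic_on f S}"
        using imageI[OF mem, of ?G] unfolding trans[OF G Z] .
    qed
  qed
  from bij_betw_same_card[OF this] show ?thesis using S a by simp
qed

lemma w_tree_edge:
  assumes "is_w_tree S" "e \<in> edges S"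
  shows "e \<subseteq> verts S"
  using assms by (auto simp: is_w_tree_def dest: graph_tree_edge)

lemma w_tree_rot_edge:
  assumes "is_w_tree S" "v \<in> verts S" "e \<in> incident S v"
  shows "rot S v e \<in> incident S v"
  using assms by (auto simp: is_w_tree_def dest: cyclic_on_inI)

text \<open>\<open>w_tree_iso\<close> with the witness exposed, for composing and inverting
  maps.\<close>

definition iso_map :: "('a \<Rightarrow> 'b) \<Rightarrow> 'a w_tree \<Rightarrow> 'b w_tree \<Rightarrow> bool" where
  "iso_map f S T \<longleftrightarrow>
     bij_betw f (verts S) (verts T) \<and> f ` whites S = whites T \<and> f ` blacks S = blacks T \<and>
     (\<lambda>e. f ` e) ` edges S = edges T \<and>
     (\<forall>v\<in>verts S. \<forall>e\<in>incident S v. rot T (f v) (f ` e) = f ` rot S v e) \<and>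
     (\<forall>v\<in>verts S. vweight T (f v) = vweight S v) \<and>
     (\<forall>e\<in>edges S. eweight T (f ` e) = eweight S e)"

lemma w_tree_iso_iff: "w_tree_iso S T \<longleftrightarrow> (\<exists>f. iso_map f S T)"
  by (simp add: w_tree_iso_def iso_map_def)

lemma iso_map_incident:
  assumes S: "is_w_tree S" and f: "iso_map f S T" and v: "v \<in> verts S"
  shows "incident T (f v) = (\<lambda>e. f ` e) ` incident S v"
proof -
  have inj: "inj_on f (verts S)" using f by (auto simp: iso_map_def bij_betw_def)
  have E: "edges T = (\<lambda>e. f ` e) ` edges S" using f by (simp add: iso_map_def)
  have "f v \<in> f ` e \<longleftrightarrow> v \<in> e" if "e \<in> edges S" for e
    using inj_on_image_mem_iff[OF inj v w_tree_edge[OF S that]] .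
  then show ?thesis unfolding incident_def E by auto
qed

lemma w_tree_iso_refl: "w_tree_iso S S"
  unfolding w_tree_iso_iff iso_map_def by (intro exI[of _ id]) (auto simp: bij_betw_def)

lemma w_tree_iso_trans:
  assumes S: "is_w_tree S" and "w_tree_iso S T" "w_tree_iso T U"
  shows "w_tree_iso S U"
proof -
  obtain f g where f: "iso_map f S T" and g: "iso_map g T U" using assms by (auto simp: w_tree_iso_iff)
  have "iso_map (g \<circ> f) S U" unfolding iso_map_def
  proof (intro conjI ballI)
    show "bij_betw (g \<circ> f) (verts S) (verts U)"
      using f g by (auto simp: iso_map_def intro: bij_betw_trans)
    show "(g \<circ> f) ` whites S = whites U" "(g \<circ> f) ` blacks S = blacks U"
      using f g unfolding image_comp[symmetric] by (auto simp: iso_map_def)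
    show "(\<lambda>e. (g \<circ> f) ` e) ` edges S = edges U"
    proof -
      have "(\<lambda>e. (g \<circ> f) ` e) ` edges S = (\<lambda>e. g ` e) ` (\<lambda>e. f ` e) ` edges S"
        unfolding image_image by (simp add: image_image)
      then show ?thesis using f g by (simp add: iso_map_def)
    qed
    have vT: "f v \<in> verts T" if "v \<in> verts S" for v
      using f that by (auto simp: iso_map_def bij_betw_def)
    show "vweight U ((g \<circ> f) v) = vweight S v" if "v \<in> verts S" for v
      using f g vT[OF that] that by (simp add: iso_map_def)
    show "eweight U ((g \<circ> f) ` e) = eweight S e" if "e \<in> edges S" for e
    proof -
      have "f ` e \<in> edges T" using f that by (auto simp: iso_map_def)
      then show ?thesis using f g that unfolding image_comp[symmetric] by (simp add: iso_map_def)
    qed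
    show "rot U ((g \<circ> f) v) ((g \<circ> f) ` e) = (g \<circ> f) ` rot S v e" if "v \<in> verts S" "e \<in> incident S v" for v e
    proof -
      have "f ` e \<in> incident T (f v)" using iso_map_incident[OF S f that(1)] that by auto
      then have "rot U (g (f v)) (g ` f ` e) = g ` rot T (f v) (f ` e)"
        using g vT[OF that(1)] by (simp add: iso_map_def)
      also have "rot T (f v) (f ` e) = f ` rot S v e" using f that by (simp add: iso_map_def)
      finally show ?thesis by (simp add: image_comp)
    qed
  qed
  then show ?thesis by (auto simp: w_tree_iso_iff)
qed

text \<open>An isomorphism constrains rotations at incident edges only. In a w-tree the successor of
  an incident edge is again incident, so all edges involved lie inside the vertex set, where the map
  can be inverted.\<close>

lemma w_tree_iso_sym:
  assumes S: "is_w_tree S" and "w_tree_iso S T"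
  shows "w_tree_iso T S"
proof -
  obtain f where f: "iso_map f S T" using assms by (auto simp: w_tree_iso_iff)
  define g where "g = inv_into (verts S) f"
  have bij: "bij_betw f (verts S) (verts T)" using f by (simp add: iso_map_def)
  then have inj: "inj_on f (verts S)" by (simp add: bij_betw_def)
  have gf: "g (f v) = v" if "v \<in> verts S" for v using inj that by (simp add: g_def)
  have gim: "g ` f ` A = A" if "A \<subseteq> verts S" for A
    using gf that by (force simp: image_image subset_iff)
  have surj: "\<exists>u\<in>verts S. v = f u" if "v \<in> verts T" for v
    using that bij by (auto simp: bij_betw_def)
  have "iso_map g T S" unfolding iso_map_def
  proof (intro conjI ballI)
    show "bij_betw g (verts T) (verts S)" using bij by (simp add: g_def bij_betw_inv_into)
    have "whites T = f ` whites S" "blacks T = f ` blacks S" using f by (simp_all add: iso_map_def)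
    then show "g ` whites T = whites S" "g ` blacks T = blacks S"
      using gim[of "whites S"] gim[of "blacks S"] by (auto simp: verts_def)
    have eT: "edges T = (\<lambda>e. f ` e) ` edges S" using f by (simp add: iso_map_def)
    then have "(\<lambda>e. g ` e) ` edges T = (\<lambda>e. g ` f ` e) ` edges S" by (simp add: image_image)
    also have "\<dots> = (\<lambda>e. e) ` edges S" by (rule image_cong) (simp_all add: gim w_tree_edge[OF S])
    finally show "(\<lambda>e. g ` e) ` edges T = edges S" by simp
    show "vweight S (g v) = vweight T v" if "v \<in> verts T" for v
      using surj[OF that] f gf by (auto simp: iso_map_def)
    show "eweight S (g ` e) = eweight T e" if "e \<in> edges T" for e
    proof -
      obtain d where d: "d \<in> edges S" "e = f ` d" using \<open>e \<in> edges T\<close> eT by auto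
      then show ?thesis using f gim[OF w_tree_edge[OF S d(1)]] by (simp add: iso_map_def)
    qed
    show "rot S (g v) (g ` e) = g ` rot T v e" if v: "v \<in> verts T" and e: "e \<in> incident T v" for v e
    proof -
      obtain u where u: "u \<in> verts S" "v = f u" using surj[OF v] by blast
      then obtain e' where e': "e' \<in> incident S u" "e = f ` e'"
        using iso_map_incident[OF S f u(1)] e by auto
      have sub: "rot S u e' \<subseteq> verts S" "e' \<subseteq> verts S"
        using w_tree_rot_edge[OF S u(1) e'(1)] e'(1) w_tree_edge[OF S] by (auto simp: incident_def)
      have "rot T v e = f ` rot S u e'" using f u e' by (simp add: iso_map_def)
      then show ?thesis using gim[OF sub(1)] gim[OF sub(2)] u e' gf by simp
    qed
  qed
  then show ?thesis by (auto simp: w_tree_iso_iff)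
qed

lemma adj_rtrancl_image:
  assumes "(u, v) \<in> (adj E)\<^sup>*"
  shows "(f u, f v) \<in> (adj ((\<lambda>e. f ` e) ` E))\<^sup>*"
  using assms
proof (induction rule: rtrancl_induct)
  case (step y z)
  then have "(f y, f z) \<in> adj ((\<lambda>e. f ` e) ` E)" by (auto intro!: image_eqI[of _ _ "{y, z}"])
  then show ?case using step.IH by (rule rtrancl_into_rtrancl[rotated])
qed simp

text \<open>A detour around an edge of the image is pulled back along \<open>inv_into V f\<close> to
  a detour in the original tree.\<close>

lemma graph_tree_image:
  assumes T: "graph_tree V E" and inj: "inj_on f V"
  shows "graph_tree (f ` V) ((\<lambda>e. f ` e) ` E)"
proof (rule graph_treeI_bridge)
  show "finite (f ` V)" using T by (simp add: graph_tree_finite)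
  show "e \<subseteq> f ` V \<and> card e = 2" if "e \<in> (\<lambda>e. f ` e) ` E" for e
  proof -
    obtain d where d: "d \<in> E" "e = f ` d" using \<open>e \<in> (\<lambda>e. f ` e) ` E\<close> by auto
    note dV = graph_tree_edge[OF T d(1)]
    have "card (f ` d) = card d" using dV by (intro card_image inj_on_subset[OF inj]) simp
    then show ?thesis using dV d by auto
  qed
  obtain r where r: "r \<in> V" using graph_tree_nonempty[OF T] by blast
  show "graph_connected (f ` V) ((\<lambda>e. f ` e) ` E)"
  proof (rule graph_connectedI[of "f r"])
    fix v assume "v \<in> f ` V"
    then obtain u where "u \<in> V" "v = f u" by blast
    then show "(f r, v) \<in> (adj ((\<lambda>e. f ` e) ` E))\<^sup>*"
      using adj_rtrancl_image[OF graph_tree_reach[OF T r]] by simp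
  qed (use r in auto)
  fix u' v' assume "{u', v'} \<in> (\<lambda>e. f ` e) ` E"
  then obtain e where e: "e \<in> E" "{u', v'} = f ` e" by auto
  define g where "g = inv_into V f"
  have gim: "g ` f ` e = e" if "e \<in> E" for e
    unfolding g_def using graph_tree_edge[OF T that] inv_into_image_cancel[OF inj] by simp
  have "{g u', g v'} = e" using gim[OF e(1)] e(2)[symmetric] by simp
  then have e': "{g u', g v'} \<in> E" using e by simp
  show "(u', v') \<notin> (adj ((\<lambda>e. f ` e) ` E - {{u', v'}}))\<^sup>*"
  proof
    assume "(u', v') \<in> (adj ((\<lambda>e. f ` e) ` E - {{u', v'}}))\<^sup>*"
    then have "(g u', g v') \<in> (adj ((\<lambda>e. g ` e) ` ((\<lambda>e. f ` e) ` E - {{u', v'}})))\<^sup>*"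
      by (rule adj_rtrancl_image)
    moreover have "(\<lambda>e. g ` e) ` ((\<lambda>e. f ` e) ` E - {{u', v'}}) \<subseteq> E - {{g u', g v'}}"
    proof
      fix d assume "d \<in> (\<lambda>e. g ` e) ` ((\<lambda>e. f ` e) ` E - {{u', v'}})"
      then obtain d' where d': "d' \<in> E" "f ` d' \<noteq> {u', v'}" "d = g ` f ` d'" by auto
      then have "d = d'" "d' \<noteq> e" using gim e by auto
      then show "d \<in> E - {{g u', g v'}}" using d' \<open>{g u', g v'} = e\<close> by simp
    qed
    ultimately have "(g u', g v') \<in> (adj (E - {{g u', g v'}}))\<^sup>*" by (rule adj_rtrancl_mono)
    then show False using graph_tree_bridge[OF T e'] by blast
  qed
qed

lemma iso_map_w_tree:
  assumes S: "is_w_tree S" and f: "iso_map f S T"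
  shows "is_w_tree T"
proof -
  have bij: "bij_betw f (verts S) (verts T)" and E: "edges T = (\<lambda>e. f ` e) ` edges S"
    and W: "whites T = f ` whites S" and B: "blacks T = f ` blacks S"
    using f by (simp_all add: iso_map_def)
  then have inj: "inj_on f (verts S)" and V: "verts T = f ` verts S" by (simp_all add: bij_betw_def)
  have inj_e: "inj_on (\<lambda>e. f ` e) (Pow (verts S))" using inj by (rule inj_on_image_Pow)
  show ?thesis unfolding is_w_tree_def
  proof (intro conjI ballI)
    show "graph_tree (verts T) (edges T)"
      unfolding V E using S inj by (auto simp: is_w_tree_def intro: graph_tree_image)
    show "properly_colored T" unfolding properly_colored_def
    proof (intro conjI ballI)
      have "f ` whites S \<inter> f ` blacks S = f ` (whites S \<inter> blacks S)"
        by (rule inj_on_image_Int[OF inj, symmetric]) (auto simp: verts_def)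
      then show "whites T \<inter> blacks T = {}"
        using S unfolding W B by (simp add: is_w_tree_def properly_colored_def)
      fix e assume "e \<in> edges T"
      then obtain d where d: "d \<in> edges S" "e = f ` d" using E by auto
      then obtain u v where "u \<in> whites S" "v \<in> blacks S" "d = {u, v}"
        using S by (auto simp: is_w_tree_def properly_colored_def)
      then show "\<exists>u\<in>whites T. \<exists>v\<in>blacks T. e = {u, v}" unfolding W B using d by auto
    qed
    show "0 < eweight T e" if "e \<in> edges T" for e
    proof -
      obtain d where "d \<in> edges S" "e = f ` d" using \<open>e \<in> edges T\<close> E by auto
      then show ?thesis using f S by (simp add: iso_map_def is_w_tree_def)
    qed
    fix v assume "v \<in> verts T"
    then obtain u where u: "u \<in> verts S" "v = f u" using V by auto
    note inc = iso_map_incident[OF S f u(1), folded u(2)]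
    show "0 < vweight T v" using u f S by (auto simp: iso_map_def is_w_tree_def)
    show "cyclic_on (rot T v) (incident T v)"
      unfolding inc
    proof (rule cyclic_on_image)
      show "cyclic_on (rot S u) (incident S u)" using S u by (simp add: is_w_tree_def)
      show "rot T v (f ` e) = f ` rot S u e" if "e \<in> incident S u" for e
        using f u that by (simp add: iso_map_def)
    qed
    have "inj_on (\<lambda>e. f ` e) (incident S u)"
      using inj_e by (rule inj_on_subset) (auto simp: incident_def dest: w_tree_edge[OF S])
    then have "(\<Sum>e\<in>incident T v. eweight T e) = (\<Sum>e\<in>incident S u. eweight T (f ` e))"
      unfolding inc by (simp add: sum.reindex)
    also have "\<dots> = (\<Sum>e\<in>incident S u. eweight S e)"
      using f by (intro sum.cong) (auto simp: iso_map_def incident_def)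
    also have "\<dots> = vweight T v" using S f u by (simp add: is_w_tree_def iso_map_def)
    finally show "vweight T v = (\<Sum>e\<in>incident T v. eweight T e)" by simp
  qed
qed

text \<open>Comparing sizes of the multisets gives as many vertices as weights, so distinct weights
  name the vertices.\<close>

lemma image_mset_set_bij:
  assumes "finite A" "distinct ys" "image_mset f (mset_set A) = mset ys"
  shows "bij_betw f A (set ys)"
proof -
  have im: "f ` A = set ys" using arg_cong[OF assms(3), of set_mset] assms(1) by simp
  have "card A = card (set ys)"
    using arg_cong[OF assms(3), of size] distinct_card[OF assms(2)] by simp
  then have "inj_on f A" using im assms(1) by (metis eq_card_imp_inj_on)
  then show ?thesis using im by (simp add: bij_betw_def)
qed

section \<open>Canonical representatives for a simple type\<close>

locale simple_weights =
  fixes k l :: "nat list"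
  assumes simple: "simple_type k l"
begin

abbreviation white_set :: "nat set" where "white_set \<equiv> {..<length k}"
abbreviation black_set :: "nat set" where "black_set \<equiv> {length k..<length k + length l}"

definition vset :: "nat set" where "vset = {..<length k + length l}"

text \<open>The value 1 beyond the vertices keeps \<open>wt\<close> nonzero everywhere, as the
  lemmas on words and planted trees demand.\<close>

definition wt :: "nat \<Rightarrow> int" where
  "wt i = (if i < length k then int (k ! i)
    else if i < length k + length l then - int (l ! (i - length k)) else 1)"

lemma lengths: "0 < length k" "0 < length l"
  using simple by (auto simp: simple_type_def is_type_def)

lemma pos_nth: "i < length k \<Longrightarrow> 0 < k ! i" "j < length l \<Longrightarrow> 0 < l ! j"
  using simple by (auto simp: simple_type_def is_type_def)

lemma distinct_weights: "distinct k" "distinct l"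
  using simple by (auto simp: simple_type_def)

lemma vset_Un: "vset = white_set \<union> black_set"
  by (auto simp: vset_def)

lemma wt_nonzero: "wt i \<noteq> 0"
  using pos_nth(1)[of i] pos_nth(2)[of "i - length k"] by (auto simp: wt_def)

lemma wt_pos_iff: "i \<in> vset \<Longrightarrow> 0 < wt i \<longleftrightarrow> i \<in> white_set"
  and wt_neg_iff: "i \<in> vset \<Longrightarrow> wt i < 0 \<longleftrightarrow> i \<in> black_set"
  using pos_nth(1)[of i] pos_nth(2)[of "i - length k"] by (auto simp: wt_def vset_def)

lemma sum_black: "(\<Sum>i\<in>(\<lambda>j. length k + j) ` J. wt i) = - int (\<Sum>j\<in>J. l ! j)" if "J \<subseteq> {..<length l}"
proof -
  have "(\<Sum>i\<in>(\<lambda>j. length k + j) ` J. wt i) = (\<Sum>j\<in>J. wt (length k + j))"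
    by (subst sum.reindex) (auto simp: inj_on_def)
  also have "\<dots> = (\<Sum>j\<in>J. - int (l ! j))" using that by (intro sum.cong) (auto simp: wt_def)
  finally show ?thesis by (simp add: sum_negf)
qed

lemma sum_white: "(\<Sum>i\<in>I. wt i) = int (\<Sum>i\<in>I. k ! i)" if "I \<subseteq> white_set"
proof -
  have "(\<Sum>i\<in>I. wt i) = (\<Sum>i\<in>I. int (k ! i))" using that by (intro sum.cong) (auto simp: wt_def)
  then show ?thesis by simp
qed

definition merge :: "nat set \<times> nat set \<Rightarrow> nat set" where
  "merge = (\<lambda>(I, J). I \<union> (\<lambda>j. length k + j) ` J)"

definition unmerge :: "nat set \<Rightarrow> nat set \<times> nat set" where
  "unmerge p = (p \<inter> white_set, {j. length k + j \<in> p})"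

lemma merge_unmerge: "merge (unmerge p) = p"
proof -
  have "i \<in> (\<lambda>j. length k + j) ` {j. length k + j \<in> p}" if "i \<in> p" "\<not> i < length k" for i
    using that by (intro image_eqI[of _ _ "i - length k"]) auto
  then show ?thesis by (auto simp: merge_def unmerge_def)
qed

lemma unmerge_merge: "I \<subseteq> white_set \<Longrightarrow> unmerge (merge (I, J)) = (I, J)"
  by (auto simp: merge_def unmerge_def)

lemma sum_merge:
  assumes "I \<subseteq> white_set" "J \<subseteq> {..<length l}"
  shows "sum wt (merge (I, J)) = int (\<Sum>i\<in>I. k ! i) - int (\<Sum>j\<in>J. l ! j)"
proof -
  have "finite I" "finite J" using assms finite_subset by blast+
  moreover have "I \<inter> (\<lambda>j. length k + j) ` J = {}" using assms by auto
  ultimately show ?thesis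
    unfolding merge_def using sum_black[OF assms(2)] sum_white[OF assms(1)]
    by (simp add: sum.union_disjoint)
qed

lemma merge_full: "merge (white_set, {..<length l}) = vset"
proof -
  have "(\<lambda>j. length k + j) ` {..<length l} = black_set"
    by (simp add: lessThan_atLeast0 image_add_atLeastLessThan add.commute)
  then show ?thesis by (simp add: merge_def vset_Un)
qed

lemma sum_nth_eq: "(\<Sum>i<length xs. xs ! i) = sum_list (xs :: nat list)"
  by (simp add: sum_list_sum_nth lessThan_atLeast0)

lemma wt_balanced: "sum wt vset = 0"
  using sum_merge[of white_set "{..<length l}"] simple
  by (simp add: merge_full sum_nth_eq simple_type_def is_type_def del: of_nat_sum)

lemma card_vset: "card vset = length k + length l" "2 \<le> card vset" "finite vset"
proof -
  show "card vset = length k + length l" "finite vset" by (simp_all add: vset_def)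
  then show "2 \<le> card vset" using lengths by linarith
qed

definition canon :: "nat set set \<Rightarrow> (nat \<Rightarrow> nat set \<Rightarrow> nat set) \<Rightarrow> (nat set \<Rightarrow> nat) \<Rightarrow> nat w_tree" where
  "canon E \<rho> g = \<lparr>whites = white_set, blacks = black_set, edges = E, rot = \<rho>,
     vweight = (\<lambda>v. nat \<bar>wt v\<bar>), eweight = g\<rparr>"

lemma canon_simps [simp]:
  "whites (canon E \<rho> g) = white_set" "blacks (canon E \<rho> g) = black_set"
  "edges (canon E \<rho> g) = E" "rot (canon E \<rho> g) = \<rho>"
  "vweight (canon E \<rho> g) v = nat \<bar>wt v\<bar>" "eweight (canon E \<rho> g) = g"
  "verts (canon E \<rho> g) = vset" "incident (canon E \<rho> g) v = {e \<in> E. v \<in> e}"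
  by (simp_all add: canon_def verts_def vset_Un incident_def)

lemma properly_colored_canon:
  assumes "\<And>e. e \<in> E \<Longrightarrow> e \<subseteq> vset"
  shows "properly_colored (canon E \<rho> g) \<longleftrightarrow> sign_bipartite wt E"
proof -
  have "(\<exists>u\<in>white_set. \<exists>v\<in>black_set. e = {u, v}) \<longleftrightarrow> (\<exists>w b. e = {w, b} \<and> 0 < wt w \<and> wt b < 0)"
    if "e \<in> E" for e
  proof
    assume "\<exists>u\<in>white_set. \<exists>v\<in>black_set. e = {u, v}"
    then show "\<exists>w b. e = {w, b} \<and> 0 < wt w \<and> wt b < 0"
      using wt_pos_iff wt_neg_iff vset_Un by (metis UnCI)
  next
    assume "\<exists>w b. e = {w, b} \<and> 0 < wt w \<and> wt b < 0"
    then show "\<exists>u\<in>white_set. \<exists>v\<in>black_set. e = {u, v}"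
      using wt_pos_iff wt_neg_iff assms[OF that] by (metis insert_subset)
  qed
  then show ?thesis by (auto simp: properly_colored_def sign_bipartite_def)
qed

lemma is_w_tree_canon:
  "is_w_tree (canon E \<rho> g) \<longleftrightarrow> graph_tree vset E \<and> sign_bipartite wt E \<and>
     pos_flow wt vset E (\<lambda>e. int (g e)) \<and> (\<forall>v\<in>vset. cyclic_on (\<rho> v) {e \<in> E. v \<in> e})"
proof -
  have eq: "nat \<bar>wt v\<bar> = (\<Sum>e | e \<in> E \<and> v \<in> e. g e) \<longleftrightarrow>
      (\<Sum>e | e \<in> E \<and> v \<in> e. int (g e)) = \<bar>wt v\<bar>" for v
    by (simp only: of_nat_sum[symmetric]) linarith
  have "graph_tree vset E \<Longrightarrow> properly_colored (canon E \<rho> g) \<longleftrightarrow> sign_bipartite wt E"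
    by (rule properly_colored_canon) (auto dest: graph_tree_edge)
  then show ?thesis
    unfolding is_w_tree_def pos_flow_def by (auto simp: eq wt_nonzero)
qed

lemma canon_in_type:
  assumes "is_w_tree (canon E \<rho> g)"
  shows "canon E \<rho> g \<in> w_trees_of_type k l"
proof -
  have "image_mset (\<lambda>v. nat \<bar>wt v\<bar>) (mset_set white_set) = mset k"
  proof -
    have "image_mset (\<lambda>v. nat \<bar>wt v\<bar>) (mset_set white_set) = mset (map (\<lambda>v. nat \<bar>wt v\<bar>) [0..<length k])"
      by (simp add: lessThan_atLeast0)
    also have "map (\<lambda>v. nat \<bar>wt v\<bar>) [0..<length k] = k"
      by (intro nth_equalityI) (auto simp: wt_def)
    finally show ?thesis .
  qed
  moreover have "image_mset (\<lambda>v. nat \<bar>wt v\<bar>) (mset_set black_set) = mset l"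
  proof -
    have "image_mset (\<lambda>v. nat \<bar>wt v\<bar>) (mset_set black_set) =
        mset (map (\<lambda>v. nat \<bar>wt v\<bar>) [length k..<length k + length l])" by simp
    also have "map (\<lambda>v. nat \<bar>wt v\<bar>) [length k..<length k + length l] = l"
      by (intro nth_equalityI) (auto simp: wt_def)
    finally show ?thesis .
  qed
  ultimately show ?thesis using assms by (simp add: w_trees_of_type_def canon_def)
qed

text \<open>On a feasible tree the chosen flow is unique on the edges by
  \<open>pos_flow_unique\<close>, so edge weights carry no information beyond the tree.\<close>

definition edge_weight :: "nat set set \<Rightarrow> nat set \<Rightarrow> int" where
  "edge_weight E = (SOME g. pos_flow wt vset E g)"

text \<open>Functions are extensional both in the vertex and in the edge, so that distinct elements
  differ at an actual edge of the tree.\<close>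

definition rotation_systems :: "(nat set set \<times> (nat \<Rightarrow> nat set \<Rightarrow> nat set)) set" where
  "rotation_systems = Sigma {E. graph_tree vset E \<and> feasible wt vset E}
     (\<lambda>E. \<Pi>\<^sub>E v\<in>vset. {f \<in> {e \<in> E. v \<in> e} \<rightarrow>\<^sub>E {e \<in> E. v \<in> e}. cyclic_on f {e \<in> E. v \<in> e}})"

definition realize :: "nat set set \<times> (nat \<Rightarrow> nat set \<Rightarrow> nat set) \<Rightarrow> nat w_tree" where
  "realize = (\<lambda>(E, \<rho>). canon E \<rho> (\<lambda>e. nat (edge_weight E e)))"

lemma edge_weight_flow: "feasible wt vset E \<Longrightarrow> pos_flow wt vset E (edge_weight E)"
  unfolding edge_weight_def feasible_def by (metis someI_ex)

lemma realize_w_tree: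
  assumes "q \<in> rotation_systems"
  shows "is_w_tree (realize q)"
proof -
  obtain E \<rho> where q: "q = (E, \<rho>)" "graph_tree vset E" "feasible wt vset E"
    and \<rho>: "\<rho> \<in> (\<Pi>\<^sub>E v\<in>vset. {f \<in> {e \<in> E. v \<in> e} \<rightarrow>\<^sub>E {e \<in> E. v \<in> e}. cyclic_on f {e \<in> E. v \<in> e}})"
    using assms by (auto simp: rotation_systems_def)
  have flow: "pos_flow wt vset E (edge_weight E)" using q by (simp add: edge_weight_flow)
  have "(\<Sum>e | e \<in> E \<and> v \<in> e. int (nat (edge_weight E e))) = (\<Sum>e | e \<in> E \<and> v \<in> e. edge_weight E e)" for v
    using flow by (intro sum.cong) (auto simp: pos_flow_def less_imp_le)
  then have "pos_flow wt vset E (\<lambda>e. int (nat (edge_weight E e)))"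
    using flow unfolding pos_flow_def by (metis int_nat_eq less_imp_le)
  moreover have "cyclic_on (\<rho> v) {e \<in> E. v \<in> e}" if "v \<in> vset" for v
    using PiE_mem[OF \<rho> that] by simp
  ultimately show ?thesis
    using q by (simp add: realize_def is_w_tree_canon feasible_def)
qed

lemma realize_in_type: "q \<in> rotation_systems \<Longrightarrow> realize q \<in> w_trees_of_type k l"
  using realize_w_tree canon_in_type by (cases q) (auto simp: realize_def)

text \<open>An isomorphism preserves colour and weight, and equally coloured vertices have distinct
  weights; so it fixes every vertex.\<close>

lemma realize_inj:
  assumes q: "q \<in> rotation_systems" "q' \<in> rotation_systems" and iso: "w_tree_iso (realize q) (realize q')"
  shows "q = q'"
proof -
  obtain E \<rho> E' \<rho>' where qq: "q = (E, \<rho>)" "q' = (E', \<rho>')" by (cases q; cases q') auto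
  from iso obtain f where f: "iso_map f (realize q) (realize q')" by (auto simp: w_tree_iso_iff)
  have fw: "f ` white_set = white_set" and fb: "f ` black_set = black_set"
    and fE: "(\<lambda>e. f ` e) ` E = E'" and fv: "\<And>v. v \<in> vset \<Longrightarrow> nat \<bar>wt (f v)\<bar> = nat \<bar>wt v\<bar>"
    and fr: "\<And>v e. v \<in> vset \<Longrightarrow> e \<in> E \<Longrightarrow> v \<in> e \<Longrightarrow> \<rho>' (f v) (f ` e) = f ` \<rho> v e"
    using f by (auto simp: iso_map_def qq realize_def)
  have fid: "f v = v" if v: "v \<in> vset" for v
  proof (cases "v \<in> white_set")
    case True
    then have "f v \<in> white_set" using fw by blast
    then show ?thesis using fv[OF v] True distinct_weights(1) by (simp add: wt_def nth_eq_iff_index_eq)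
  next
    case False
    then have b: "v \<in> black_set" using v vset_Un by auto
    then have fb': "f v \<in> black_set" using fb by blast
    then have "l ! (f v - length k) = l ! (v - length k)" using fv[OF v] b by (simp add: wt_def)
    then have "f v - length k = v - length k"
      using fb' b by (subst (asm) nth_eq_iff_index_eq[OF distinct_weights(2)]) auto
    then show ?thesis using fb' b by (metis atLeastLessThan_iff le_add_diff_inverse)
  qed
  have fe: "f ` e = e" if "e \<subseteq> vset" for e
    using fid that by (force simp: subset_iff)
  have T: "graph_tree vset E" using q qq by (simp add: rotation_systems_def)
  have Ev: "e \<subseteq> vset" if "e \<in> E" for e using graph_tree_edge[OF T that] by simp
  have "(\<lambda>e. f ` e) ` E = (\<lambda>e. e) ` E" by (rule image_cong) (simp_all add: fe Ev)
  then have E: "E' = E" using fE by simp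
  have R: "\<rho> \<in> (\<Pi>\<^sub>E v\<in>vset. {f \<in> {e \<in> E. v \<in> e} \<rightarrow>\<^sub>E {e \<in> E. v \<in> e}. cyclic_on f {e \<in> E. v \<in> e}})"
    and R': "\<rho>' \<in> (\<Pi>\<^sub>E v\<in>vset. {f \<in> {e \<in> E. v \<in> e} \<rightarrow>\<^sub>E {e \<in> E. v \<in> e}. cyclic_on f {e \<in> E. v \<in> e}})"
    using q unfolding qq E by (simp_all add: rotation_systems_def)
  have "\<rho> = \<rho>'"
  proof (rule PiE_ext[OF R R'])
    fix v assume v: "v \<in> vset"
    have m: "\<rho> v \<in> {e \<in> E. v \<in> e} \<rightarrow>\<^sub>E {e \<in> E. v \<in> e}" "\<rho>' v \<in> {e \<in> E. v \<in> e} \<rightarrow>\<^sub>E {e \<in> E. v \<in> e}"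
      using PiE_mem[OF R v] PiE_mem[OF R' v] by auto
    show "\<rho> v = \<rho>' v"
    proof (rule PiE_ext[OF m])
      fix e assume e: "e \<in> {e \<in> E. v \<in> e}"
      then have "\<rho> v e \<in> E" using m(1) by (auto dest: PiE_mem)
      then show "\<rho> v e = \<rho>' v e" using fr[OF v] e fid[OF v] fe Ev by auto
    qed
  qed
  then show ?thesis using qq E by simp
qed

text \<open>Each vertex moves to the position of its weight in \<open>k\<close> or \<open>l\<close>.
  The transported edge weights then coincide with \<open>edge_weight\<close> by uniqueness of the
  flow.\<close>

lemma realize_surj:
  assumes T: "T \<in> w_trees_of_type k l"
  shows "\<exists>q\<in>rotation_systems. w_tree_iso T (realize q)"
proof -
  have Tt: "is_w_tree T" and mw: "image_mset (vweight T) (mset_set (whites T)) = mset k"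
    and mb: "image_mset (vweight T) (mset_set (blacks T)) = mset l"
    using T by (auto simp: w_trees_of_type_def)
  have fin: "finite (whites T)" "finite (blacks T)" and disj: "whites T \<inter> blacks T = {}"
    using Tt by (auto simp: is_w_tree_def graph_tree_def verts_def properly_colored_def)
  have bw: "bij_betw (vweight T) (whites T) (set k)"
    by (rule image_mset_set_bij[OF fin(1) distinct_weights(1) mw])
  have bb: "bij_betw (vweight T) (blacks T) (set l)"
    by (rule image_mset_set_bij[OF fin(2) distinct_weights(2) mb])
  define iw where "iw = inv_into {..<length k} ((!) k)"
  define ib where "ib = inv_into {..<length l} ((!) l)"
  have kb: "bij_betw ((!) k) {..<length k} (set k)" and lb: "bij_betw ((!) l) {..<length l} (set l)"
    using distinct_weights by (auto intro: bij_betw_nth)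
  define h where "h v = (if v \<in> whites T then iw (vweight T v) else length k + ib (vweight T v))" for v
  have hw: "bij_betw h (whites T) white_set"
  proof -
    have "bij_betw (iw \<circ> vweight T) (whites T) white_set"
      using bw bij_betw_inv_into[OF kb] unfolding iw_def by (rule bij_betw_trans)
    then show ?thesis by (rule bij_betw_cong[THEN iffD1, rotated]) (simp add: h_def)
  qed
  have hb: "bij_betw h (blacks T) black_set"
  proof -
    have "bij_betw (\<lambda>j. length k + j) {..<length l} black_set"
      by (rule bij_betw_imageI) (simp_all add: lessThan_atLeast0 image_add_atLeastLessThan add.commute)
    then have "bij_betw ((\<lambda>j. length k + j) \<circ> (ib \<circ> vweight T)) (blacks T) black_set"
      using bij_betw_trans[OF bij_betw_trans[OF bb bij_betw_inv_into[OF lb]]] unfolding ib_def by blast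
    moreover have "v \<notin> whites T" if "v \<in> blacks T" for v using disj that by blast
    ultimately show ?thesis by (subst bij_betw_cong[of _ _ "(\<lambda>j. length k + j) \<circ> (ib \<circ> vweight T)"]) (auto simp: h_def)
  qed
  have hv: "bij_betw h (verts T) vset"
    unfolding verts_def vset_Un by (rule bij_betw_combine[OF hw hb]) auto
  then have inj: "inj_on h (verts T)" by (simp add: bij_betw_def)
  have wth: "nat \<bar>wt (h v)\<bar> = vweight T v" if "v \<in> verts T" for v
  proof (cases "v \<in> whites T")
    case True
    then have "vweight T v \<in> (!) k ` {..<length k}" using bw kb by (auto simp: bij_betw_def)
    from f_inv_into_f[OF this] inv_into_into[OF this]
    have "k ! iw (vweight T v) = vweight T v" "iw (vweight T v) < length k" by (simp_all add: iw_def)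
    then show ?thesis using True by (simp add: h_def wt_def)
  next
    case False
    then have "v \<in> blacks T" using that by (simp add: verts_def)
    then have "vweight T v \<in> (!) l ` {..<length l}" using bb lb by (auto simp: bij_betw_def)
    from f_inv_into_f[OF this] inv_into_into[OF this]
    have "l ! ib (vweight T v) = vweight T v" "ib (vweight T v) < length l" by (simp_all add: ib_def)
    then show ?thesis using False by (simp add: h_def wt_def)
  qed
  define g where "g = inv_into (verts T) h"
  have gh: "g (h v) = v" if "v \<in> verts T" for v using inj that by (simp add: g_def)
  have ghe: "g ` h ` e = e" if "e \<in> edges T" for e
    unfolding g_def by (rule inv_into_image_cancel[OF inj w_tree_edge[OF Tt that]])
  define E where "E = (\<lambda>e. h ` e) ` edges T"
  \<comment> \<open>Cut down in both arguments, since \<open>rot T\<close> is arbitrary away from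
    the tree.\<close>
  define \<rho> where "\<rho> = (\<lambda>v\<in>vset. \<lambda>e\<in>{e \<in> E. v \<in> e}. h ` rot T (g v) (g ` e))"
  let ?T' = "canon E \<rho> (\<lambda>e. eweight T (g ` e))"
  have iso: "iso_map h T ?T'" unfolding iso_map_def
  proof (intro conjI ballI)
    show "rot ?T' (h v) (h ` e) = h ` rot T v e" if v: "v \<in> verts T" and e: "e \<in> incident T v" for v e
    proof -
      have "h v \<in> vset" using hv v by (auto simp: bij_betw_def)
      moreover have "h ` e \<in> E" "h v \<in> h ` e" using e by (auto simp: E_def incident_def)
      ultimately show ?thesis using gh[OF v] ghe[of e] e by (simp add: \<rho>_def incident_def)
    qed
  qed (use hv hw hb wth ghe in \<open>auto simp: E_def bij_betw_def\<close>)
  have T': "is_w_tree ?T'" by (rule iso_map_w_tree[OF Tt iso])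
  then have tree: "graph_tree vset E" and bip: "sign_bipartite wt E"
    and flow: "pos_flow wt vset E (\<lambda>e. int (eweight T (g ` e)))"
    and cyc: "\<And>v. v \<in> vset \<Longrightarrow> cyclic_on (\<rho> v) {e \<in> E. v \<in> e}"
    unfolding is_w_tree_canon by auto
  have feas: "feasible wt vset E" using bip flow by (auto simp: feasible_def)
  have "\<rho> \<in> (\<Pi>\<^sub>E v\<in>vset. {f \<in> {e \<in> E. v \<in> e} \<rightarrow>\<^sub>E {e \<in> E. v \<in> e}. cyclic_on f {e \<in> E. v \<in> e}})"
  proof (rule PiE_I)
    fix v assume v: "v \<in> vset"
    have "\<rho> v \<in> {e \<in> E. v \<in> e} \<rightarrow>\<^sub>E {e \<in> E. v \<in> e}"
    proof (rule PiE_I)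
      fix e assume "e \<in> {e \<in> E. v \<in> e}"
      then show "\<rho> v e \<in> {e \<in> E. v \<in> e}" by (rule cyclic_on_inI[OF cyc[OF v]])
    qed (auto simp: \<rho>_def v)
    then show "\<rho> v \<in> {f \<in> {e \<in> E. v \<in> e} \<rightarrow>\<^sub>E {e \<in> E. v \<in> e}. cyclic_on f {e \<in> E. v \<in> e}}"
      using cyc[OF v] by simp
  qed (simp add: \<rho>_def)
  then have q: "(E, \<rho>) \<in> rotation_systems" using tree feas by (simp add: rotation_systems_def)
  have "edge_weight E e = int (eweight T (g ` e))" if "e \<in> E" for e
    by (rule pos_flow_unique[OF tree wt_nonzero bip edge_weight_flow[OF feas] flow that])
  then have "iso_map h T (realize (E, \<rho>))"
    using iso by (simp add: iso_map_def realize_def E_def)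
  then show ?thesis using q by (auto simp: w_tree_iso_iff)
qed

lemma num_w_trees_eq_card: "num_w_trees k l = card rotation_systems"
proof -
  let ?W = "w_trees_of_type k l"
  let ?R = "{(S, T). S \<in> ?W \<and> T \<in> ?W \<and> w_tree_iso S T}"
  have W: "is_w_tree T" if "T \<in> ?W" for T using that by (simp add: w_trees_of_type_def)
  have "bij_betw (\<lambda>q. ?R `` {realize q}) rotation_systems (?W // ?R)"
  proof (rule bij_betw_imageI)
    show "inj_on (\<lambda>q. ?R `` {realize q}) rotation_systems"
    proof (rule inj_onI)
      fix q q' assume q: "q \<in> rotation_systems" "q' \<in> rotation_systems"
        and eq: "?R `` {realize q} = ?R `` {realize q'}"
      have "realize q' \<in> ?R `` {realize q}"
        unfolding eq using q by (simp add: realize_in_type w_tree_iso_refl)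
      then show "q = q'" using q realize_inj by blast
    qed
    show "(\<lambda>q. ?R `` {realize q}) ` rotation_systems = ?W // ?R"
    proof (intro equalityI subsetI)
      fix X assume "X \<in> (\<lambda>q. ?R `` {realize q}) ` rotation_systems"
      then obtain q where q: "q \<in> rotation_systems" and X: "X = ?R `` {realize q}" by blast
      show "X \<in> ?W // ?R" unfolding X by (rule quotientI[OF realize_in_type[OF q]])
    next
      fix X assume "X \<in> ?W // ?R"
      then obtain T where T: "T \<in> ?W" "X = ?R `` {T}" by (rule quotientE)
      then obtain q where q: "q \<in> rotation_systems" "w_tree_iso T (realize q)"
        using realize_surj by blast
      have sym: "w_tree_iso (realize q) T" by (rule w_tree_iso_sym[OF W[OF T(1)] q(2)])
      have "?R `` {T} = ?R `` {realize q}"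
        using w_tree_iso_trans[OF W[OF T(1)] q(2)] w_tree_iso_trans[OF realize_w_tree[OF q(1)] sym]
          T(1) realize_in_type[OF q(1)] by blast
      then show "X \<in> (\<lambda>q. ?R `` {realize q}) ` rotation_systems" using T q by auto
    qed
  qed
  then show ?thesis unfolding num_w_trees_def type_classes_def by (simp add: bij_betw_same_card)
qed

lemma num_w_trees_eq_weight: "real (num_w_trees k l) = tree_weight wt vset"
proof -
  have c: "real (card (\<Pi>\<^sub>E v\<in>vset. {f \<in> {e \<in> E. v \<in> e} \<rightarrow>\<^sub>E {e \<in> E. v \<in> e}. cyclic_on f {e \<in> E. v \<in> e}})) =
      cyclic_weight vset E" if T: "graph_tree vset E" for E
  proof -
    have "card {f \<in> {e \<in> E. v \<in> e} \<rightarrow>\<^sub>E {e \<in> E. v \<in> e}. cyclic_on f {e \<in> E. v \<in> e}} = fact (vdeg E v - 1)"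
      if v: "v \<in> vset" for v
    proof (rule card_cyclic_functions)
      show "finite {e \<in> E. v \<in> e}" using graph_tree_finite_edges[OF T] by simp
      \<comment> \<open>With at least two vertices none is isolated, so there is a cyclic order to
        count at each.\<close>
      have "vset \<noteq> {v}" using card_vset(2) by auto
      then show "{e \<in> E. v \<in> e} \<noteq> {}" using graph_tree_edge_at[OF T v] by auto
    qed
    then show ?thesis by (simp add: card_PiE card_vset cyclic_weight_def)
  qed
  have fin: "finite {E. graph_tree vset E \<and> feasible wt vset E}"
    using finite_graph_trees[OF card_vset(3)] by (rule rev_finite_subset) auto
  have finPi: "finite (\<Pi>\<^sub>E v\<in>vset. {f \<in> {e \<in> E. v \<in> e} \<rightarrow>\<^sub>E {e \<in> E. v \<in> e}. cyclic_on f {e \<in> E. v \<in> e}})"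
    if T: "graph_tree vset E" for E
    using card_vset(3) graph_tree_finite_edges[OF T]
    by (intro finite_PiE) (auto intro!: finite_subset[OF Collect_subset] finite_PiE)
  have "real (num_w_trees k l) = (\<Sum>E | graph_tree vset E \<and> feasible wt vset E. cyclic_weight vset E)"
    unfolding num_w_trees_eq_card rotation_systems_def using fin finPi
    by (subst card_SigmaI) (auto simp: c)
  also have "\<dots> = tree_weight wt vset"
    unfolding tree_weight_def using finite_graph_trees[OF card_vset(3)]
    by (intro sum.mono_neutral_cong_left) auto
  finally show ?thesis .
qed

section \<open>Partitions of the type as set partitions of the vertices\<close>

abbreviation balanced_partitions :: "nat set set set" where
  "balanced_partitions \<equiv> {P. partition_on vset P \<and> (\<forall>p\<in>P. sum wt p = 0)}"

lemma type_partition_block: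
  assumes "P \<in> type_partitions k l" "(I, J) \<in> P"
  shows "I \<subseteq> white_set" "J \<subseteq> {..<length l}"
  using assms partition_onD1 by (force simp: type_partitions_def)+

lemma merge_partition:
  assumes P: "P \<in> type_partitions k l"
  shows "merge ` P \<in> balanced_partitions" "inj_on merge P" "unmerge ` merge ` P = P"
proof -
  note blk = type_partition_block[OF P]
  have um: "unmerge (merge z) = z" if "z \<in> P" for z
    using that blk by (cases z) (simp add: unmerge_merge)
  then show "inj_on merge P" by (rule inj_on_inverseI)
  show "unmerge ` merge ` P = P" using um by (force simp: image_image)
  have fstP: "partition_on white_set (fst ` P)" "inj_on fst P" and sndP: "partition_on {..<length l} (snd ` P)" "inj_on snd P"
    and bal: "\<And>I J. (I, J) \<in> P \<Longrightarrow> (\<Sum>i\<in>I. k ! i) = (\<Sum>j\<in>J. l ! j)"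
    using P by (auto simp: type_partitions_def)
  have "partition_on vset (merge ` P)"
  proof (rule partition_onI)
    have "\<Union>(merge ` P) = \<Union>(fst ` P) \<union> (\<lambda>j. length k + j) ` \<Union>(snd ` P)"
      by (force simp: merge_def)
    also have "\<dots> = merge (white_set, {..<length l})"
      using partition_onD1[OF fstP(1)] partition_onD1[OF sndP(1)] by (simp add: merge_def)
    finally show "\<Union>(merge ` P) = vset" unfolding merge_full .
  next
    fix p q assume "p \<in> merge ` P" "q \<in> merge ` P" "p \<noteq> q"
    then obtain I J I' J' where z: "(I, J) \<in> P" "(I', J') \<in> P" "p = merge (I, J)" "q = merge (I', J')"
      "(I, J) \<noteq> (I', J')" by auto
    have ne: "I \<noteq> I'" "J \<noteq> J'"
      using inj_onD[OF fstP(2) _ z(1,2)] inj_onD[OF sndP(2) _ z(1,2)] z(5) by auto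
    have "I \<inter> I' = {}"
      using disjointD[OF partition_onD2[OF fstP(1)] _ _ ne(1)] imageI[OF z(1), of fst] imageI[OF z(2), of fst]
      by simp
    moreover have "J \<inter> J' = {}"
      using disjointD[OF partition_onD2[OF sndP(1)] _ _ ne(2)] imageI[OF z(1), of snd] imageI[OF z(2), of snd]
      by simp
    ultimately have "I \<inter> I' = {}" "J \<inter> J' = {}" by simp_all
    then show "disjnt p q" using blk(1)[OF z(1)] blk(1)[OF z(2)] z(3,4) by (auto simp: disjnt_def merge_def)
  next
    have "{} \<notin> fst ` P" using partition_onD3[OF fstP(1)] .
    then show "{} \<notin> merge ` P" by (force simp: merge_def)
  qed
  moreover have "sum wt p = 0" if "p \<in> merge ` P" for p
    using that bal blk sum_merge by (auto simp del: of_nat_sum)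
  ultimately show "merge ` P \<in> balanced_partitions" by blast
qed

text \<open>Weights are positive, so a balanced nonempty block contains both colours. Its two halves
  are nonempty and disjoint from those of other blocks, which makes both projections
  injective.\<close>

lemma unmerge_partition:
  assumes P: "P \<in> balanced_partitions"
  shows "unmerge ` P \<in> type_partitions k l" "merge ` unmerge ` P = P"
proof -
  show "merge ` unmerge ` P = P" by (simp add: image_image merge_unmerge)
  have part: "partition_on vset P" and bal: "\<And>p. p \<in> P \<Longrightarrow> sum wt p = 0" using P by auto
  have pV: "p \<subseteq> vset" "finite p" if "p \<in> P" for p
    using partition_onD1[OF part] that card_vset(3) by (auto intro: finite_subset)
  have sub: "fst (unmerge p) \<subseteq> white_set" "snd (unmerge p) \<subseteq> {..<length l}" if "p \<in> P" for p
    using pV[OF that] by (auto simp: unmerge_def vset_def)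
  have weights: "(\<Sum>i\<in>fst (unmerge p). k ! i) = (\<Sum>j\<in>snd (unmerge p). l ! j)" if "p \<in> P" for p
    using sum_merge[OF sub[OF that]] bal[OF that] by (simp add: merge_unmerge del: of_nat_sum)
  have ne: "fst (unmerge p) \<noteq> {} \<and> snd (unmerge p) \<noteq> {}" if p: "p \<in> P" for p
  proof -
    have "p \<noteq> {}" using partition_onD3[OF part] p by auto
    then have "fst (unmerge p) \<noteq> {} \<or> snd (unmerge p) \<noteq> {}"
      using merge_unmerge[of p] by (auto simp: merge_def split: prod.splits)
    moreover have "(\<Sum>i\<in>fst (unmerge p). k ! i) = 0 \<longleftrightarrow> fst (unmerge p) = {}"
      using sub(1)[OF p] pos_nth(1) finite_subset[OF sub(1)[OF p]] by (force simp: sum_eq_0_iff)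
    moreover have "(\<Sum>j\<in>snd (unmerge p). l ! j) = 0 \<longleftrightarrow> snd (unmerge p) = {}"
      using sub(2)[OF p] pos_nth(2) finite_subset[OF sub(2)[OF p]] by (force simp: sum_eq_0_iff)
    ultimately show ?thesis using weights[OF p] by metis
  qed
  have dis: "fst (unmerge p) \<inter> fst (unmerge q) = {} \<and> snd (unmerge p) \<inter> snd (unmerge q) = {}"
    if "p \<in> P" "q \<in> P" "p \<noteq> q" for p q
    using partition_onD2[OF part] that by (auto simp: disjoint_def unmerge_def)
  have inj: "inj_on (fst \<circ> unmerge) P" "inj_on (snd \<circ> unmerge) P"
    using dis ne by (fastforce intro!: inj_onI)+
  show "unmerge ` P \<in> type_partitions k l" unfolding type_partitions_def
  proof (intro CollectI conjI)
    show "partition_on white_set (fst ` unmerge ` P)"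
    proof (rule partition_onI)
      have "\<Union>(fst ` unmerge ` P) = \<Union>P \<inter> white_set" by (auto simp: unmerge_def)
      then show "\<Union>(fst ` unmerge ` P) = white_set" using partition_onD1[OF part] by (auto simp: vset_def)
    next
      fix A B assume "A \<in> fst ` unmerge ` P" "B \<in> fst ` unmerge ` P" "A \<noteq> B"
      moreover then obtain p q where "p \<in> P" "q \<in> P" "A = fst (unmerge p)" "B = fst (unmerge q)" by blast
      ultimately show "disjnt A B" using dis[of p q] by (auto simp: disjnt_def)
    next
      show "{} \<notin> fst ` unmerge ` P" using ne by (metis imageE)
    qed
    show "partition_on {..<length l} (snd ` unmerge ` P)"
    proof (rule partition_onI)
      have "\<Union>(snd ` unmerge ` P) = {j. length k + j \<in> \<Union>P}" by (auto simp: unmerge_def)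
      also have "\<dots> = {..<length l}" unfolding partition_onD1[OF part, symmetric] by (auto simp: vset_def)
      finally show "\<Union>(snd ` unmerge ` P) = {..<length l}" .
    next
      fix A B assume "A \<in> snd ` unmerge ` P" "B \<in> snd ` unmerge ` P" "A \<noteq> B"
      moreover then obtain p q where "p \<in> P" "q \<in> P" "A = snd (unmerge p)" "B = snd (unmerge q)" by blast
      ultimately show "disjnt A B" using dis[of p q] by (auto simp: disjnt_def)
    next
      show "{} \<notin> snd ` unmerge ` P" using ne by (metis imageE)
    qed
    show "inj_on fst (unmerge ` P)" "inj_on snd (unmerge ` P)"
      using inj by (auto simp: inj_on_def)
    show "\<forall>(I, J)\<in>unmerge ` P. (\<Sum>i\<in>I. k ! i) = (\<Sum>j\<in>J. l ! j)"
      using weights by (auto simp: case_prod_unfold)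
  qed
qed

lemma card_merge:
  assumes "P \<in> type_partitions k l" "(I, J) \<in> P"
  shows "card (merge (I, J)) = card I + card J"
proof -
  note blk = type_partition_block[OF assms]
  have "finite I" "finite J" using blk finite_subset by blast+
  moreover have "I \<inter> (\<lambda>j. length k + j) ` J = {}" using blk by auto
  moreover have "card ((\<lambda>j. length k + j) ` J) = card J" by (rule card_image) simp
  ultimately show ?thesis by (simp add: merge_def card_Un_disjoint)
qed

text \<open>\<open>tree_weight_formula\<close> divided by (v - 1)^2. A block of nonzero total
  annihilates its summand through \<open>cycle_gf\<close>, so exactly the partitions of the type
  remain.\<close>

lemma num_w_trees_formula:
  "real (num_w_trees k l) = (\<Sum>P\<in>type_partitions k l. partition_term k l P)"
proof -
  define m where "m = real (card vset - 1)"
  have m: "m \<noteq> 0" using card_vset(2) by (simp add: m_def)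
  let ?C = "coef (cycle_gf wt)"
  have finP: "finite {P. partition_on vset P}" using finitely_many_partition_on card_vset by blast
  have "(\<Sum>P | partition_on vset P. (- m) ^ card P * (\<Prod>p\<in>P. ?C p)) =
    (\<Sum>P\<in>balanced_partitions. (- m) ^ card P * (\<Prod>p\<in>P. ?C p))"
  proof (rule sum.mono_neutral_right[OF finP])
    show "\<forall>P\<in>{P. partition_on vset P} - balanced_partitions. (- m) ^ card P * (\<Prod>p\<in>P. ?C p) = 0"
    proof
      fix P assume P: "P \<in> {P. partition_on vset P} - balanced_partitions"
      then obtain p where "p \<in> P" "sum wt p \<noteq> 0" by blast
      moreover have "finite P" using P card_vset(3) by (auto intro: finite_elements)
      ultimately have "(\<Prod>p\<in>P. ?C p) = 0" by (intro prod_zero) (auto simp: cycle_gf_def)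
      then show "(- m) ^ card P * (\<Prod>p\<in>P. ?C p) = 0" by simp
    qed
  qed auto
  also have "\<dots> = (\<Sum>P\<in>type_partitions k l. - (m * m * partition_term k l P))"
  proof (rule sum.reindex_bij_witness[of _ "\<lambda>P. merge ` P" "\<lambda>P. unmerge ` P"])
    fix P assume P: "P \<in> balanced_partitions"
    let ?Q = "unmerge ` P"
    note Q = unmerge_partition[OF P]
    show "merge ` unmerge ` P = P" "unmerge ` P \<in> type_partitions k l" using Q by auto
    have inj: "inj_on merge ?Q" using merge_partition(2)[OF Q(1)] .
    have part: "partition_on vset P" using P by simp
    then have finP: "finite P" using card_vset(3) by (auto intro: finite_elements)
    have cQ: "card ?Q = card P" using card_image[OF inj] Q(2) by simp
    have "P \<noteq> {}" using part card_vset(2) by (auto simp: partition_on_def)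
    then have "0 < card P" using finP by (simp add: card_gt_0_iff)
    \<comment> \<open>The shift by one absorbs the overall minus sign: - (- m)^(n+1) = (-1)^n
      m^(n+1), with n = card P - 1 as in \<open>partition_term\<close>.\<close>
    then obtain n where n: "card P = Suc n" by (cases "card P") auto
    have "(\<Prod>p\<in>P. ?C p) = (\<Prod>z\<in>?Q. ?C (merge z))"
      using prod.reindex[OF inj, of ?C] Q(2) by simp
    also have "\<dots> = (\<Prod>(I, J)\<in>?Q. fact (card I + card J - 1))"
    proof (intro prod.cong refl)
      fix z assume z: "z \<in> ?Q"
      obtain I J where IJ: "z = (I, J)" by (cases z)
      have mP: "merge z \<in> P" using z Q(2) by blast
      then have "merge z \<noteq> {}" "sum wt (merge z) = 0" "finite (merge z)"
        using P partition_onD1[OF part] partition_onD3[OF part] card_vset(3) by (auto intro: finite_subset)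
      then show "?C (merge z) = (case z of (I, J) \<Rightarrow> fact (card I + card J - 1))"
        using card_merge[OF Q(1), of I J] z IJ by (simp add: cycle_gf_def)
    qed
    finally have pr: "(\<Prod>p\<in>P. ?C p) = (\<Prod>(I, J)\<in>?Q. fact (card I + card J - 1))" .
    have nv: "real (num_verts k l - 1) = m" by (simp add: m_def num_verts_def card_vset(1))
    \<comment> \<open>For one block the exponent is -1, so this is an integer power and adding
      exponents needs \<open>m\<close> to be nonzero.\<close>
    have "m * m * m powi (int (Suc n) - 2) = m powi 2 * m powi (int (Suc n) - 2)"
      by (simp add: power2_eq_square)
    also have "\<dots> = m powi (int (Suc n))" 
      using m power_int_add[of m 2 "int (Suc n) - 2"] by simp
    finally have pw: "m * m * m powi (int (Suc n) - 2) = m ^ Suc n" by (simp only: power_int_of_nat)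
    have "m * m * partition_term k l ?Q =
        (- 1) ^ n * (m * m * m powi (int (Suc n) - 2)) * (\<Prod>(I, J)\<in>?Q. fact (card I + card J - 1))"
      unfolding partition_term_def nv cQ n by (simp add: algebra_simps)
    also have "\<dots> = - ((- m) ^ Suc n * (\<Prod>p\<in>P. ?C p))"
      unfolding pw pr by (simp add: power_minus[of m n])
    finally show "- (m * m * partition_term k l (unmerge ` P)) = (- m) ^ card P * (\<Prod>p\<in>P. ?C p)"
      unfolding n by simp
  next
    fix P assume P: "P \<in> type_partitions k l"
    show "unmerge ` merge ` P = P" "merge ` P \<in> balanced_partitions"
      using merge_partition[OF P] by auto
  qed
  finally have "m * (m * tree_weight wt vset) = m * m * (\<Sum>P\<in>type_partitions k l. partition_term k l P)"
    using tree_weight_formula[OF card_vset(3,2) wt_balanced wt_nonzero, folded m_def]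
    by (simp add: sum_negf sum_distrib_left)
  then show ?thesis using m num_w_trees_eq_weight by simp
qed

lemma trivial_partition:
  "{({..<length k}, {..<length l})} \<in> type_partitions k l"
  "partition_term k l {({..<length k}, {..<length l})} = fact (num_verts k l - 2)"
proof -
  show "{({..<length k}, {..<length l})} \<in> type_partitions k l"
    using lengths simple
    by (auto simp: type_partitions_def sum_nth_eq simple_type_def is_type_def intro!: partition_on_space)
  \<comment> \<open>Two vertices at least, so v - 1 is nonzero and (v - 1)! / (v - 1) = (v -
    2)!.\<close>
  obtain m where m: "length k + length l = Suc (Suc m)"
    using lengths by (metis Suc_pred add_Suc_right add_Suc gr0_conv_Suc)
  show "partition_term k l {({..<length k}, {..<length l})} = fact (num_verts k l - 2)"
    by (simp add: partition_term_def num_verts_def m power_int_minus)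
qed

end

theorem theorem3:
  fixes k l :: "nat list"
  assumes "simple_type k l"
  shows "real (num_w_trees k l) = (\<Sum>P\<in>type_partitions k l. partition_term k l P) \<and>
         {({..<length k}, {..<length l})} \<in> type_partitions k l \<and>
         partition_term k l {({..<length k}, {..<length l})} = fact (num_verts k l - 2)"
proof -
  interpret simple_weights k l by unfold_locales (rule assms)
  show ?thesis using num_w_trees_formula trivial_partition by blast
qed

end
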